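(* Consider the semi-implicit time Euler scheme $\{u^n,\theta^n\}_{n=0,\dots,N}$ with mesh $h=T/N$ for the stochastic Boussinesq system with additive noise, as defined in the context, with $C_L=0$. (i) Let $\theta_0\in H^0$ and $u_0\in V^0$ be deterministic, and set $\tilde\beta_0:=\frac{\kappa\tilde\lambda_1}{4\mathrm{Tr}(\tilde Q)}$. Then for any $\beta\in(0,\tilde\beta_0)$ there exists a constant $C(\beta)<\infty$ such that for $N$ large enough, $$\mathbb E\Big[\exp\Big(\beta\max_{0\le n\le N}\Big\{\|\theta^n\|_{H^0}^2+\frac TN\,\kappa\sum_{l=1}^n\|\tilde A^{1/2}\theta^l\|_{H^0}^2\Big\}\Big)\Big]\le C(\beta).\qquad( * )$$ (ii) Let $\theta_0$ be random, $\mathcal F_0$-measurable, and satisfy $\mathbb E[\exp(\tilde\gamma_0\|\theta_0\|_{H^0}^2)]<\infty$ for some $\tilde\gamma_0>0$. Set $$\tilde\beta_1:=\frac{\kappa\tilde\lambda_1\tilde\gamma_0}{4\mathrm{Tr}(\tilde Q)\tilde\gamma_0+\kappa\tilde\lambda_1}.$$ Then for every $\beta\in(0,\tilde\beta_1)$, $( * )$ holds for $N$ large enough, for some constant $C(\beta)<\infty$.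
   Context: Domain and spaces. $L>0$, $T>0$, $D=[0,L]^2$; $v_1,v_2$ is the canonical basis of $\mathbb R^2$. Velocity fields are periodic of period $L$ in both variables. $V^0$ is the closed subspace of $L^2(D)^2$ of divergence-free periodic fields (normalized to have zero spatial mean), with the $L^2$ norm; $V^k=\{\phi\in W^{k,2}(D)^2:\ \mathrm{div}\,\phi=0\}$ (same conventions), with the $W^{k,2}$ norm. $\Pi:L^2(D)^2\to V^0$ is the orthogonal (Leray) projection, $A=-\Pi\Delta$ is the Stokes operator with domain $V^2$ and eigenvalues $0<\lambda_1\le\lambda_2\le\dots$. Temperatures $\theta$ vanish on $\{x_2=0\}\cup\{x_2=L\}$ and are periodic of period $L$ in $x_1$; $\tilde A=-\Delta$ on $L^2(D)$ with these boundary conditions, with eigenvalues $\tilde\lambda_1\le\tilde\lambda_2\le\dots$, $\tilde\lambda_1>0$: $\|\theta\|_{H^0}^2\le\tilde\lambda_1^{-1}\|\tilde A^{1/2}\theta\|_{H^0}^2$ for $\theta\in H^1$; $H^k=\mathrm{Dom}(\tilde A^{k/2})$, $H^0=L^2(D)$. $B(u,v)=\Pi[(u\cdot\nabla)v]$; $(u\cdot\nabla)\theta=\sum_{i=1,2}u_i\partial_i\theta$. Additive noise. On a filtered probability space $(\Omega,\mathcal F,(\mathcal F_t)_{t\ge0},\mathbb P)$, $W(t)=\sum_{j\ge1}\sqrt{q_j}\,\beta_j(t)\zeta_j$ and $\tilde W(t)=\sum_{j\ge1}\sqrt{\tilde q_j}\,\tilde\beta_j(t)\tilde\zeta_j$,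 where $\{\beta_j\},\{\tilde\beta_j\}$ are mutually independent one-dimensional $(\mathcal F_t)$-Brownian motions, $\{\zeta_j\}$ (resp. $\{\tilde\zeta_j\}$) is a complete orthonormal system of $V^0$ (resp. $H^0$) with $A\zeta_j=\lambda_j\zeta_j$ (resp. $\tilde A\tilde\zeta_j=\tilde\lambda_j\tilde\zeta_j$), $q_j,\tilde q_j>0$, $Q\zeta_j=q_j\zeta_j$, $\tilde Q\tilde\zeta_j=\tilde q_j\tilde\zeta_j$, $\mathrm{Tr}(Q)=\sum_jq_j$, $\mathrm{Tr}(\tilde Q)=\sum_j\tilde q_j$. Standing assumption: $\sum_j\lambda_jq_j<\infty$ and $\sum_j\tilde\lambda_j\tilde q_j<\infty$. Scheme (with $C_L=0$). $\nu,\kappa>0$ are constants. For $N\ge1$, $h=T/N$, $t_j=jh$, $\Delta_lW=W(t_l)-W(t_{l-1})$, $\Delta_l\tilde W=\tilde W(t_l)-\tilde W(t_{l-1})$. Set $u^0=u_0$, $\theta^0=\theta_0$ ($\mathcal F_0$-measurable), and for $l=1,\dots,N$ let $u^l\in V^1$, $\theta^l\in H^1$ ($\mathcal F_{t_l}$-measurable) solve, for all $\varphi\in V^1$, $\psi\in H^1$, $$(u^l-u^{l-1}+h\nu Au^l+hB(u^{l-1},u^l),\varphi)=h(\Pi(\theta^{l-1}v_2),\varphi)+(\Delta_lW,\varphi),$$ $$(\theta^l-\theta^{l-1}+h\kappa\tilde A\theta^l+h(u^{l-1}\cdot\nabla)\theta^l,\psi)=(\Delta_l\tilde W,\psi),$$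 with $Au^l$, $\tilde A\theta^l$ understood in the weak sense. *)

theory Defs
  imports "HOL-Probability.Probability"
begin

section \<open>Square integrable fields on the square\<close>

definition dom_measure :: "real \<Rightarrow> (real^2) measure" where
  "dom_measure L = restrict_space lborel (cbox 0 (\<chi> i. L))"

text \<open>
  Elements of \<open>L\<^sup>2(D)\<close> are represented by functions; two representatives that agree almost
  everywhere on \<open>D = [0,L]\<^sup>2\<close> denote the same element, and values outside \<open>D\<close> are irrelevant.
  The codomain is \<open>real\<close> for temperatures and \<open>real^2\<close> for velocities.
\<close>

definition L2 :: "real \<Rightarrow> (real^2 \<Rightarrow> 'b::euclidean_space) set" where
  "L2 L = {f \<in> borel_measurable (dom_measure L). integrable (dom_measure L) (\<lambda>x. (norm (f x))\<^sup>2)}"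

definition L2_inner :: "real \<Rightarrow> (real^2 \<Rightarrow> 'b::euclidean_space) \<Rightarrow> (real^2 \<Rightarrow> 'b) \<Rightarrow> real" where
  "L2_inner L f g = (\<integral>x. f x \<bullet> g x \<partial>dom_measure L)"

definition L2_norm :: "real \<Rightarrow> (real^2 \<Rightarrow> 'b::euclidean_space) \<Rightarrow> real" where
  "L2_norm L f = sqrt (L2_inner L f f)"

definition L2_open :: "real \<Rightarrow> (real^2 \<Rightarrow> 'b::euclidean_space) set \<Rightarrow> bool" where
  "L2_open L U \<longleftrightarrow> U \<subseteq> L2 L \<and>
     (\<forall>f\<in>U. \<exists>r>0. \<forall>g\<in>L2 L. L2_norm L (\<lambda>x. g x - f x) < r \<longrightarrow> g \<in> U)"

definition L2_borel :: "real \<Rightarrow> (real^2 \<Rightarrow> 'b::euclidean_space) measure" where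
  "L2_borel L = sigma (L2 L) {U. L2_open L U}"

definition complete_ons ::
  "real \<Rightarrow> (real^2 \<Rightarrow> 'b::euclidean_space) set \<Rightarrow> (nat \<Rightarrow> real^2 \<Rightarrow> 'b) \<Rightarrow> bool" where
  "complete_ons L S e \<longleftrightarrow>
     (\<forall>j. e j \<in> S) \<and>
     (\<forall>i j. L2_inner L (e i) (e j) = (if i = j then 1 else 0)) \<and>
     (\<forall>f\<in>S. (\<lambda>n. L2_norm L (\<lambda>x. f x - (\<Sum>j<n. L2_inner L f (e j) *\<^sub>R e j x))) \<longlonglongrightarrow> 0)"

section \<open>Weak derivatives\<close>

definition pderiv_dir :: "2 \<Rightarrow> (real^2 \<Rightarrow> real) \<Rightarrow> real^2 \<Rightarrow> real" where
  "pderiv_dir i f x = frechet_derivative f (at x) (axis i 1)"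

primrec Ck :: "nat \<Rightarrow> (real^2 \<Rightarrow> real) \<Rightarrow> bool" where
  "Ck 0 f \<longleftrightarrow> continuous_on UNIV f"
| "Ck (Suc k) f \<longleftrightarrow> (\<forall>x. f differentiable (at x)) \<and> (\<forall>i. Ck k (pderiv_dir i f))"

definition smooth :: "(real^2 \<Rightarrow> real) \<Rightarrow> bool" where
  "smooth f \<longleftrightarrow> (\<forall>k. Ck k f)"

definition per_test :: "real \<Rightarrow> (real^2 \<Rightarrow> real) set" where
  "per_test L = {\<phi>. smooth \<phi> \<and> (\<forall>i x. \<phi> (x + axis i L) = \<phi> x)}"

definition strip_test :: "real \<Rightarrow> (real^2 \<Rightarrow> real) set" where
  "strip_test L = {\<phi>. smooth \<phi> \<and> (\<forall>x. \<phi> (x + axis 1 L) = \<phi> x) \<and>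
     (\<exists>\<delta>>0. \<forall>x. x $ 2 < \<delta> \<or> x $ 2 > L - \<delta> \<longrightarrow> \<phi> x = 0)}"

text \<open>
  The set \<open>K\<close> of test functions determines the periodicity: with \<open>K = per_test L\<close> the weak
  derivatives are those of distributions on the torus, and with \<open>K = strip_test L\<close> those of
  distributions on the open strip \<open>0 < x\<^sub>2 < L\<close> that are \<open>L\<close>-periodic in \<open>x\<^sub>1\<close>. As test functions need
  not vanish on the identified sides of \<open>D\<close>, a weakly differentiable function has matching traces
  there.
\<close>

definition has_wderiv ::
  "real \<Rightarrow> (real^2 \<Rightarrow> real) set \<Rightarrow> 2 \<Rightarrow> (real^2 \<Rightarrow> 'b::euclidean_space) \<Rightarrow> (real^2 \<Rightarrow> 'b) \<Rightarrow> bool" where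
  "has_wderiv L K i f g \<longleftrightarrow> g \<in> L2 L \<and>
     (\<forall>\<phi>\<in>K. (\<integral>x. pderiv_dir i \<phi> x *\<^sub>R f x \<partial>dom_measure L) = - (\<integral>x. \<phi> x *\<^sub>R g x \<partial>dom_measure L))"

definition wderiv ::
  "real \<Rightarrow> (real^2 \<Rightarrow> real) set \<Rightarrow> 2 \<Rightarrow> (real^2 \<Rightarrow> 'b::euclidean_space) \<Rightarrow> real^2 \<Rightarrow> 'b" where
  "wderiv L K i f = (SOME g. has_wderiv L K i f g)"

primrec sobolev ::
  "real \<Rightarrow> (real^2 \<Rightarrow> real) set \<Rightarrow> nat \<Rightarrow> (real^2 \<Rightarrow> 'b::euclidean_space) set" where
  "sobolev L K 0 = L2 L"
| "sobolev L K (Suc k) = {f \<in> L2 L. \<forall>i. \<exists>g \<in> sobolev L K k. has_wderiv L K i f g}"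

definition wlaplacian ::
  "real \<Rightarrow> (real^2 \<Rightarrow> real) set \<Rightarrow> (real^2 \<Rightarrow> 'b::euclidean_space) \<Rightarrow> real^2 \<Rightarrow> 'b" where
  "wlaplacian L K f x = (\<Sum>i\<in>UNIV. wderiv L K i (wderiv L K i f) x)"

definition advect ::
  "real \<Rightarrow> (real^2 \<Rightarrow> real) set \<Rightarrow> (real^2 \<Rightarrow> real^2) \<Rightarrow> (real^2 \<Rightarrow> 'b::euclidean_space) \<Rightarrow> real^2 \<Rightarrow> 'b" where
  "advect L K u v x = (\<Sum>i\<in>UNIV. (u x $ i) *\<^sub>R wderiv L K i v x)"

section \<open>Velocities: divergence-free fields, Leray projection, Stokes operator\<close>

definition divfree :: "real \<Rightarrow> (real^2 \<Rightarrow> real^2) \<Rightarrow> bool" where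
  "divfree L u \<longleftrightarrow>
     (\<forall>\<phi>\<in>per_test L. (\<integral>x. (\<Sum>i\<in>UNIV. u x $ i * pderiv_dir i \<phi> x) \<partial>dom_measure L) = 0)"

definition Vsp :: "real \<Rightarrow> nat \<Rightarrow> (real^2 \<Rightarrow> real^2) set" where
  "Vsp L k = {u \<in> sobolev L (per_test L) k. divfree L u \<and> (\<integral>x. u x \<partial>dom_measure L) = 0}"

definition leray :: "real \<Rightarrow> (real^2 \<Rightarrow> real^2) \<Rightarrow> real^2 \<Rightarrow> real^2" where
  "leray L f = (SOME g. g \<in> Vsp L 0 \<and> (\<forall>\<phi>\<in>Vsp L 0. L2_inner L (\<lambda>x. f x - g x) \<phi> = 0))"

definition stokes :: "real \<Rightarrow> (real^2 \<Rightarrow> real^2) \<Rightarrow> real^2 \<Rightarrow> real^2" where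
  "stokes L u x = - leray L (wlaplacian L (per_test L) u) x"

definition stokes_weak :: "real \<Rightarrow> (real^2 \<Rightarrow> real^2) \<Rightarrow> (real^2 \<Rightarrow> real^2) \<Rightarrow> real" where
  "stokes_weak L u \<phi> = (\<Sum>i\<in>UNIV. L2_inner L (wderiv L (per_test L) i u) (wderiv L (per_test L) i \<phi>))"

text \<open>All sequences are indexed from 0: \<open>lam 0\<close> is the first eigenvalue.\<close>

definition stokes_eigensystem :: "real \<Rightarrow> (nat \<Rightarrow> real) \<Rightarrow> (nat \<Rightarrow> real^2 \<Rightarrow> real^2) \<Rightarrow> bool" where
  "stokes_eigensystem L lam \<zeta> \<longleftrightarrow>
     0 < lam 0 \<and> mono lam \<and> complete_ons L (Vsp L 0) \<zeta> \<and>
     (\<forall>j. \<zeta> j \<in> Vsp L 2 \<and> (AE x in dom_measure L. stokes L (\<zeta> j) x = lam j *\<^sub>R \<zeta> j x))"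

section \<open>Temperatures: the Laplacian with mixed boundary conditions and its powers\<close>

text \<open>
  Vanishing on the sides \<open>x\<^sub>2 = 0\<close> and \<open>x\<^sub>2 = L\<close> is meant as for \<open>W\<^sub>0\<^sup>1\<^sup>,\<^sup>2\<close>: membership in the
  \<open>W\<^sup>1\<^sup>,\<^sup>2\<close>-closure of the test functions supported away from these sides.
\<close>

definition vanishes_on_sides :: "real \<Rightarrow> (real^2 \<Rightarrow> real) \<Rightarrow> bool" where
  "vanishes_on_sides L \<theta> \<longleftrightarrow> \<theta> \<in> sobolev L (strip_test L) 1 \<and>
     (\<exists>\<phi>. (\<forall>n::nat. \<phi> n \<in> strip_test L) \<and>
        (\<lambda>n. L2_norm L (\<lambda>x. \<phi> n x - \<theta> x)) \<longlonglongrightarrow> 0 \<and>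
        (\<forall>i. (\<lambda>n. L2_norm L (\<lambda>x. pderiv_dir i (\<phi> n) x - wderiv L (strip_test L) i \<theta> x)) \<longlonglongrightarrow> 0))"

definition tempop_dom :: "real \<Rightarrow> (real^2 \<Rightarrow> real) set" where
  "tempop_dom L = {\<theta> \<in> sobolev L (strip_test L) 2. vanishes_on_sides L \<theta>}"

definition tempop :: "real \<Rightarrow> (real^2 \<Rightarrow> real) \<Rightarrow> real^2 \<Rightarrow> real" where
  "tempop L \<theta> x = - wlaplacian L (strip_test L) \<theta> x"

definition temp_eigensystem :: "real \<Rightarrow> (nat \<Rightarrow> real) \<Rightarrow> (nat \<Rightarrow> real^2 \<Rightarrow> real) \<Rightarrow> bool" where
  "temp_eigensystem L lam \<zeta> \<longleftrightarrow>
     0 < lam 0 \<and> mono lam \<and> complete_ons L (L2 L) \<zeta> \<and>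
     (\<forall>j. \<zeta> j \<in> tempop_dom L \<and> (AE x in dom_measure L. tempop L (\<zeta> j) x = lam j * \<zeta> j x))"

text \<open>
  The powers are those of the spectral calculus of the operator with eigenvalues \<open>lam\<close> and
  orthonormal eigenbasis \<open>\<zeta>\<close>.
\<close>

definition power_dom :: "real \<Rightarrow> (nat \<Rightarrow> real) \<Rightarrow> (nat \<Rightarrow> real^2 \<Rightarrow> real) \<Rightarrow> real \<Rightarrow> (real^2 \<Rightarrow> real) set" where
  "power_dom L lam \<zeta> s = {f \<in> L2 L. summable (\<lambda>j. (lam j powr s * L2_inner L f (\<zeta> j))\<^sup>2)}"

definition op_power ::
  "real \<Rightarrow> (nat \<Rightarrow> real) \<Rightarrow> (nat \<Rightarrow> real^2 \<Rightarrow> real) \<Rightarrow> real \<Rightarrow> (real^2 \<Rightarrow> real) \<Rightarrow> real^2 \<Rightarrow> real" where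
  "op_power L lam \<zeta> s f = (SOME g. g \<in> L2 L \<and>
     (\<lambda>n. L2_norm L (\<lambda>x. g x - (\<Sum>j<n. lam j powr s * L2_inner L f (\<zeta> j) * \<zeta> j x))) \<longlonglongrightarrow> 0)"

definition Hsp :: "real \<Rightarrow> (nat \<Rightarrow> real) \<Rightarrow> (nat \<Rightarrow> real^2 \<Rightarrow> real) \<Rightarrow> nat \<Rightarrow> (real^2 \<Rightarrow> real) set" where
  "Hsp L lam \<zeta> k = power_dom L lam \<zeta> (real k / 2)"

section \<open>Noise\<close>

definition filtered_space :: "'w measure \<Rightarrow> (real \<Rightarrow> 'w measure) \<Rightarrow> bool" where
  "filtered_space P F \<longleftrightarrow> prob_space P \<and> (\<forall>t\<ge>0. subalgebra P (F t)) \<and>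
     (\<forall>s\<ge>0. \<forall>t\<ge>s. subalgebra (F t) (F s))"

definition brownian :: "'w measure \<Rightarrow> (real \<Rightarrow> 'w measure) \<Rightarrow> (real \<Rightarrow> 'w \<Rightarrow> real) \<Rightarrow> bool" where
  "brownian P F b \<longleftrightarrow>
     (\<forall>t\<ge>0. b t \<in> borel_measurable (F t)) \<and>
     (AE \<omega> in P. b 0 \<omega> = 0) \<and>
     (AE \<omega> in P. continuous_on {0..} (\<lambda>t. b t \<omega>)) \<and>
     (\<forall>s\<ge>0. \<forall>t>s.
        distributed P lborel (\<lambda>\<omega>. b t \<omega> - b s \<omega>) (normal_density 0 (sqrt (t - s))) \<and>
        prob_space.indep_set P (sets (F s))
          (sets (vimage_algebra (space P) (\<lambda>\<omega>. b t \<omega> - b s \<omega>) borel)))"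

definition independent_processes :: "'w measure \<Rightarrow> ('i \<Rightarrow> real \<Rightarrow> 'w \<Rightarrow> real) \<Rightarrow> bool" where
  "independent_processes P X \<longleftrightarrow>
     prob_space.indep_vars P (\<lambda>_. \<Pi>\<^sub>M t\<in>{0..}. borel) (\<lambda>i \<omega>. \<lambda>t\<in>{0..}. X i t \<omega>) UNIV"

text \<open>\<open>W(t)\<close> is the sum of the series in \<open>L\<^sup>2(\<Omega>; L\<^sup>2(D))\<close>.\<close>

definition wiener_series ::
  "'w measure \<Rightarrow> real \<Rightarrow> (nat \<Rightarrow> real) \<Rightarrow> (nat \<Rightarrow> real \<Rightarrow> 'w \<Rightarrow> real) \<Rightarrow>
   (nat \<Rightarrow> real^2 \<Rightarrow> 'b::euclidean_space) \<Rightarrow> (real \<Rightarrow> 'w \<Rightarrow> real^2 \<Rightarrow> 'b) \<Rightarrow> bool" where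
  "wiener_series P L q b \<zeta> W \<longleftrightarrow>
     (\<forall>t\<ge>0. W t \<in> measurable P (L2_borel L) \<and>
        (\<lambda>n. \<integral>\<^sup>+\<omega>. ennreal ((L2_norm L (\<lambda>x. W t \<omega> x - (\<Sum>j<n. (sqrt (q j) * b j t \<omega>) *\<^sub>R \<zeta> j x)))\<^sup>2) \<partial>P)
          \<longlonglongrightarrow> 0)"

section \<open>The semi-implicit Euler scheme\<close>

text \<open>
  \<open>(B(u,v),\<phi>)\<close> and \<open>((u\<cdot>\<nabla>)\<theta>,\<psi>)\<close> are the integrals over \<open>D\<close> of \<open>((u\<cdot>\<nabla>)v)\<cdot>\<phi>\<close> and of \<open>((u\<cdot>\<nabla>)\<theta>)\<psi>\<close>.
  For \<open>u\<close> in \<open>V\<^sup>1\<close> the integrands are integrable for all test functions. For the initial velocity,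
  which is only in \<open>V\<^sup>0\<close>, they need not be, so the equation is imposed for those test functions for
  which the integral exists (all bounded ones among them); the premise on integrability below is
  void for every step but the first. A process that satisfies the equation in any stronger sense is
  covered.
\<close>

definition euler_velocity_step ::
  "real \<Rightarrow> real \<Rightarrow> real \<Rightarrow> (real^2 \<Rightarrow> real^2) \<Rightarrow> (real^2 \<Rightarrow> real) \<Rightarrow> (real^2 \<Rightarrow> real^2) \<Rightarrow> (real^2 \<Rightarrow> real^2) \<Rightarrow> bool" where
  "euler_velocity_step L \<nu> h u \<theta> \<Delta>W u' \<longleftrightarrow> u' \<in> Vsp L 1 \<and>
     (\<forall>\<phi>\<in>Vsp L 1. integrable (dom_measure L) (\<lambda>x. advect L (per_test L) u u' x \<bullet> \<phi> x) \<longrightarrow>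
        L2_inner L (\<lambda>x. u' x - u x) \<phi> + h * \<nu> * stokes_weak L u' \<phi>
          + h * L2_inner L (advect L (per_test L) u u') \<phi>
        = h * L2_inner L (leray L (\<lambda>x. \<theta> x *\<^sub>R axis 2 1)) \<phi> + L2_inner L \<Delta>W \<phi>)"

definition euler_temperature_step ::
  "real \<Rightarrow> (nat \<Rightarrow> real) \<Rightarrow> (nat \<Rightarrow> real^2 \<Rightarrow> real) \<Rightarrow> real \<Rightarrow> real \<Rightarrow>
   (real^2 \<Rightarrow> real^2) \<Rightarrow> (real^2 \<Rightarrow> real) \<Rightarrow> (real^2 \<Rightarrow> real) \<Rightarrow> (real^2 \<Rightarrow> real) \<Rightarrow> bool" where
  "euler_temperature_step L lam \<zeta> \<kappa> h u \<theta> \<Delta>W \<theta>' \<longleftrightarrow> \<theta>' \<in> Hsp L lam \<zeta> 1 \<and>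
     (\<forall>\<psi>\<in>Hsp L lam \<zeta> 1. integrable (dom_measure L) (\<lambda>x. advect L (strip_test L) u \<theta>' x * \<psi> x) \<longrightarrow>
        L2_inner L (\<lambda>x. \<theta>' x - \<theta> x) \<psi>
          + h * \<kappa> * L2_inner L (op_power L lam \<zeta> (1/2) \<theta>') (op_power L lam \<zeta> (1/2) \<psi>)
          + h * L2_inner L (advect L (strip_test L) u \<theta>') \<psi>
        = L2_inner L \<Delta>W \<psi>)"

definition euler_scheme ::
  "'w measure \<Rightarrow> (real \<Rightarrow> 'w measure) \<Rightarrow> real \<Rightarrow> real \<Rightarrow> real \<Rightarrow> real \<Rightarrow>
   (nat \<Rightarrow> real) \<Rightarrow> (nat \<Rightarrow> real^2 \<Rightarrow> real) \<Rightarrow>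
   (real \<Rightarrow> 'w \<Rightarrow> real^2 \<Rightarrow> real^2) \<Rightarrow> (real \<Rightarrow> 'w \<Rightarrow> real^2 \<Rightarrow> real) \<Rightarrow>
   ('w \<Rightarrow> real^2 \<Rightarrow> real^2) \<Rightarrow> ('w \<Rightarrow> real^2 \<Rightarrow> real) \<Rightarrow> nat \<Rightarrow>
   (nat \<Rightarrow> 'w \<Rightarrow> real^2 \<Rightarrow> real^2) \<Rightarrow> (nat \<Rightarrow> 'w \<Rightarrow> real^2 \<Rightarrow> real) \<Rightarrow> bool" where
  "euler_scheme P F L T \<nu> \<kappa> lam' \<zeta>' W W' u0 \<theta>0 N u \<theta> \<longleftrightarrow>
     (let h = T / real N; t = (\<lambda>l. real l * h) in
       u 0 = u0 \<and> \<theta> 0 = \<theta>0 \<and>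
       (\<forall>l\<in>{1..N}.
          u l \<in> measurable (F (t l)) (L2_borel L) \<and>
          \<theta> l \<in> measurable (F (t l)) (L2_borel L) \<and>
          (AE \<omega> in P.
             euler_velocity_step L \<nu> h (u (l - 1) \<omega>) (\<theta> (l - 1) \<omega>)
               (\<lambda>x. W (t l) \<omega> x - W (t (l - 1)) \<omega> x) (u l \<omega>) \<and>
             euler_temperature_step L lam' \<zeta>' \<kappa> h (u (l - 1) \<omega>) (\<theta> (l - 1) \<omega>)
               (\<lambda>x. W' (t l) \<omega> x - W' (t (l - 1)) \<omega> x) (\<theta> l \<omega>))))"

definition max_energy ::
  "real \<Rightarrow> real \<Rightarrow> real \<Rightarrow> (nat \<Rightarrow> real) \<Rightarrow> (nat \<Rightarrow> real^2 \<Rightarrow> real) \<Rightarrow> nat \<Rightarrow>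
   (nat \<Rightarrow> 'w \<Rightarrow> real^2 \<Rightarrow> real) \<Rightarrow> 'w \<Rightarrow> real" where
  "max_energy L T \<kappa> lam' \<zeta>' N \<theta> \<omega> =
     Max ((\<lambda>n. (L2_norm L (\<theta> n \<omega>))\<^sup>2
             + T / real N * \<kappa> * (\<Sum>l=1..n. (L2_norm L (op_power L lam' \<zeta>' (1/2) (\<theta> l \<omega>)))\<^sup>2)) ` {0..N})"

end

theory Submission
  imports Defs
begin

text \<open>
  Testing the temperature equation with \<open>\<theta>\<^sup>l\<close> removes the advection term, because the velocity is
  divergence free, and gives
  \<open>\<parallel>\<theta>\<^sup>l\<parallel>\<^sup>2 + 2h\<kappa>\<parallel>A\<^sup>1\<^sup>/\<^sup>2\<theta>\<^sup>l\<parallel>\<^sup>2 \<le> \<parallel>\<theta>\<^sup>l\<^sup>-\<^sup>1\<parallel>\<^sup>2 + 2(\<Delta>\<^sub>lW, \<theta>\<^sup>l\<^sup>-\<^sup>1) + \<parallel>\<Delta>\<^sub>lW\<parallel>\<^sup>2\<close>. Half of the dissipation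
  dominates, by the Poincare inequality, \<open>\<alpha>/2\<close> times the bracket of the martingale with increments
  \<open>2(\<Delta>\<^sub>lW, \<theta>\<^sup>l\<^sup>-\<^sup>1)\<close>, where \<open>\<alpha> = \<kappa>\<lambda>\<^sub>1/(2 Tr Q)\<close>. The maximal energy is thus bounded by
  \<open>(1 + h\<kappa>\<lambda>\<^sub>1)\<parallel>\<theta>\<^sub>0\<parallel>\<^sup>2\<close>, plus the maximum of a process \<open>Y\<close> for which \<open>exp (\<alpha>Y)\<close> is a supermartingale,
  plus \<open>\<Sum>\<^sub>l\<parallel>\<Delta>\<^sub>lW\<parallel>\<^sup>2\<close>. Convexity of the exponential separates the three contributions; the weights
  can be chosen because \<open>\<beta>/\<gamma>\<^sub>0 + 2\<beta>/\<alpha> < 1\<close>. A deterministic initial temperature has exponential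
  moments for all \<open>\<gamma>\<^sub>0\<close>.
\<close>

section \<open>The real Hilbert space of square integrable functions\<close>

text \<open>Given the past, \<alpha> times a martingale increment has exponential moment at most
  exp(2 \<alpha>^2 h Tr(Q) |\<theta>|^2), and the compensator contributes exp(-\<alpha> h \<kappa>
  \<lambda>_1 |\<theta>|^2); \<alpha> is the value at which they cancel. The two thresholds of the
  theorem satisfy 1/\<beta>_1 = 1/\<gamma>_0 + 1/\<beta>_0 with 1/\<beta>_0 = 2/\<alpha>, so \<beta>
  < \<beta>_1 leaves a gap. It is spent on the factor 1 + h \<kappa> \<lambda>_1 and on the sum of
  the |\<Delta>W|^2, whose exponential moments of any given order are bounded uniformly in N once h
  is small: hence N must be large. W is only a mean square limit of its series, and the Brownian
  motions are independent of the past one at a time. Moment bounds are therefore proved for J modes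
  with constants free of J; Fatou's lemma, along a subsequence converging almost surely at every
  grid time, passes to W. On the analytic side H^1 is spectral, advection uses weak derivatives, and
  incompressibility is stated with doubly periodic test functions. Test functions supported inside
  the strip link all three.\<close>

lemma space_dom_measure [simp]: "space (dom_measure L) = cbox 0 (\<chi> i. L)"
  by (simp add: dom_measure_def space_restrict_space)

lemma finite_measure_dom: "finite_measure (dom_measure L)"
proof
  have "emeasure (dom_measure L) (space (dom_measure L)) = emeasure lborel (cbox (0::real^2) (\<chi> i. L))"
    by (simp add: dom_measure_def space_restrict_space emeasure_restrict_space)
  then show "emeasure (dom_measure L) (space (dom_measure L)) \<noteq> \<infinity>"
    using emeasure_lborel_cbox_finite[of "0::real^2" "\<chi> i. L"] by (simp add: less_top)
qed

lemma measurable_dom_measure: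
  "f \<in> borel_measurable borel \<Longrightarrow> f \<in> borel_measurable (dom_measure L)"
  unfolding dom_measure_def by (rule measurable_restrict_space1) simp

lemma L2_real_iff:
  fixes f :: "real^2 \<Rightarrow> real"
  shows "f \<in> L2 L \<longleftrightarrow> f \<in> borel_measurable (dom_measure L) \<and> integrable (dom_measure L) (\<lambda>x. (f x)\<^sup>2)"
  by (simp add: L2_def)

lemma L2_measurable [measurable_dest]:
  "f \<in> L2 L \<Longrightarrow> f \<in> borel_measurable (dom_measure L)"
  by (simp add: L2_def)

lemma L2_square_integrable:
  fixes f :: "real^2 \<Rightarrow> real"
  shows "f \<in> L2 L \<Longrightarrow> integrable (dom_measure L) (\<lambda>x. (f x)\<^sup>2)"
  by (simp add: L2_real_iff)

lemma L2_bound: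
  fixes f g :: "real^2 \<Rightarrow> real"
  assumes "f \<in> L2 L" "g \<in> borel_measurable (dom_measure L)"
    and "\<And>x. x \<in> space (dom_measure L) \<Longrightarrow> \<bar>g x\<bar> \<le> c * \<bar>f x\<bar>"
  shows "g \<in> L2 L"
  unfolding L2_real_iff
proof
  show "g \<in> borel_measurable (dom_measure L)" by fact
  have i: "integrable (dom_measure L) (\<lambda>x. c\<^sup>2 * (f x)\<^sup>2)"
    using assms(1) by (simp add: L2_square_integrable)
  show "integrable (dom_measure L) (\<lambda>x. (g x)\<^sup>2)"
  proof (rule Bochner_Integration.integrable_bound[OF i])
    show "AE x in dom_measure L. norm ((g x)\<^sup>2) \<le> norm (c\<^sup>2 * (f x)\<^sup>2)"
    proof (rule AE_I2)
      fix x assume x: "x \<in> space (dom_measure L)"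
      have "\<bar>g x\<bar>\<^sup>2 \<le> (c * \<bar>f x\<bar>)\<^sup>2" using assms(3)[OF x] by (intro power_mono) auto
      then show "norm ((g x)\<^sup>2) \<le> norm (c\<^sup>2 * (f x)\<^sup>2)" by (simp add: power_mult_distrib)
    qed
  qed (use assms(2) in measurable)
qed

lemma L2_bounded:
  fixes f :: "real^2 \<Rightarrow> real"
  assumes "f \<in> borel_measurable (dom_measure L)"
    and "\<And>x. x \<in> space (dom_measure L) \<Longrightarrow> \<bar>f x\<bar> \<le> c"
  shows "f \<in> L2 L"
proof (rule L2_bound[where f="\<lambda>_. 1" and c=c])
  interpret finite_measure "dom_measure L" by (rule finite_measure_dom)
  show "(\<lambda>_. 1::real) \<in> L2 L" by (simp add: L2_real_iff)
qed (use assms in auto)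

lemma L2_mult_integrable:
  fixes f g :: "real^2 \<Rightarrow> real"
  assumes "f \<in> L2 L" "g \<in> L2 L"
  shows "integrable (dom_measure L) (\<lambda>x. f x * g x)"
proof (rule Bochner_Integration.integrable_bound)
  show "integrable (dom_measure L) (\<lambda>x. (f x)\<^sup>2 + (g x)\<^sup>2)"
    using assms by (simp add: L2_square_integrable)
  have "\<bar>f x\<bar> * \<bar>g x\<bar> \<le> (f x)\<^sup>2 + (g x)\<^sup>2" for x
  proof -
    have "0 \<le> (\<bar>f x\<bar> - \<bar>g x\<bar>)\<^sup>2 + (f x)\<^sup>2 + (g x)\<^sup>2" by simp
    then show ?thesis by (simp add: power2_diff)
  qed
  then show "AE x in dom_measure L. norm (f x * g x) \<le> norm ((f x)\<^sup>2 + (g x)\<^sup>2)"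
    by (simp add: abs_mult)
qed (use assms in measurable)

lemma L2_add [intro]:
  fixes f g :: "real^2 \<Rightarrow> real"
  assumes "f \<in> L2 L" "g \<in> L2 L"
  shows "(\<lambda>x. f x + g x) \<in> L2 L"
  using assms L2_mult_integrable[OF assms]
  by (auto simp: L2_real_iff power2_sum mult.assoc intro!: Bochner_Integration.integrable_add)

lemma L2_cmult [intro]:
  fixes f :: "real^2 \<Rightarrow> real"
  assumes "f \<in> L2 L"
  shows "(\<lambda>x. c * f x) \<in> L2 L"
  using assms by (auto simp: L2_real_iff power_mult_distrib)

lemma L2_diff [intro]:
  fixes f g :: "real^2 \<Rightarrow> real"
  assumes "f \<in> L2 L" "g \<in> L2 L"
  shows "(\<lambda>x. f x - g x) \<in> L2 L"
  using L2_add[OF assms(1) L2_cmult[OF assms(2), of "-1"]] by simp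

lemma L2_sum [intro]:
  fixes f :: "'i \<Rightarrow> real^2 \<Rightarrow> real"
  assumes "\<And>i. i \<in> I \<Longrightarrow> f i \<in> L2 L"
  shows "(\<lambda>x. \<Sum>i\<in>I. f i x) \<in> L2 L"
  using assms
proof (induction I rule: infinite_finite_induct)
  case (insert i I)
  then show ?case using L2_add[of "f i" L] by simp
qed (auto intro: L2_bounded[of _ _ 0])

lemma L2_inner_real:
  fixes f g :: "real^2 \<Rightarrow> real"
  shows "L2_inner L f g = (\<integral>x. f x * g x \<partial>dom_measure L)"
  by (simp add: L2_inner_def)

lemma L2_inner_commute:
  fixes f g :: "real^2 \<Rightarrow> real"
  shows "L2_inner L f g = L2_inner L g f"
  by (simp add: L2_inner_real mult.commute)

lemma L2_inner_add_left:
  fixes f g h :: "real^2 \<Rightarrow> real"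
  assumes "f \<in> L2 L" "g \<in> L2 L" "h \<in> L2 L"
  shows "L2_inner L (\<lambda>x. f x + g x) h = L2_inner L f h + L2_inner L g h"
  using assms by (simp add: L2_inner_real distrib_right L2_mult_integrable)

lemma L2_inner_diff_left:
  fixes f g h :: "real^2 \<Rightarrow> real"
  assumes "f \<in> L2 L" "g \<in> L2 L" "h \<in> L2 L"
  shows "L2_inner L (\<lambda>x. f x - g x) h = L2_inner L f h - L2_inner L g h"
  using assms by (simp add: L2_inner_real left_diff_distrib L2_mult_integrable)

lemma L2_inner_cmult_left:
  fixes f h :: "real^2 \<Rightarrow> real"
  shows "L2_inner L (\<lambda>x. c * f x) h = c * L2_inner L f h"
  by (simp add: L2_inner_real mult.assoc)

lemma L2_inner_sum_left:
  fixes f :: "'i \<Rightarrow> real^2 \<Rightarrow> real"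
  assumes "\<And>i. i \<in> I \<Longrightarrow> f i \<in> L2 L" "h \<in> L2 L"
  shows "L2_inner L (\<lambda>x. \<Sum>i\<in>I. f i x) h = (\<Sum>i\<in>I. L2_inner L (f i) h)"
  using assms by (simp add: L2_inner_real sum_distrib_right L2_mult_integrable)

lemma L2_inner_add_right:
  fixes f g h :: "real^2 \<Rightarrow> real"
  assumes "f \<in> L2 L" "g \<in> L2 L" "h \<in> L2 L"
  shows "L2_inner L h (\<lambda>x. f x + g x) = L2_inner L h f + L2_inner L h g"
  using L2_inner_add_left[OF assms] by (simp add: L2_inner_commute)

lemma L2_inner_diff_right:
  fixes f g h :: "real^2 \<Rightarrow> real"
  assumes "f \<in> L2 L" "g \<in> L2 L" "h \<in> L2 L"
  shows "L2_inner L h (\<lambda>x. f x - g x) = L2_inner L h f - L2_inner L h g"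
  using L2_inner_diff_left[OF assms] by (simp add: L2_inner_commute)

lemma L2_inner_cmult_right:
  fixes f h :: "real^2 \<Rightarrow> real"
  shows "L2_inner L h (\<lambda>x. c * f x) = c * L2_inner L h f"
  using L2_inner_cmult_left[of L c f h] by (simp add: L2_inner_commute)

lemma L2_inner_sum_right:
  fixes f :: "'i \<Rightarrow> real^2 \<Rightarrow> real"
  assumes "\<And>i. i \<in> I \<Longrightarrow> f i \<in> L2 L" "h \<in> L2 L"
  shows "L2_inner L h (\<lambda>x. \<Sum>i\<in>I. f i x) = (\<Sum>i\<in>I. L2_inner L h (f i))"
  using L2_inner_sum_left[OF assms] by (simp add: L2_inner_commute)

lemma L2_inner_cong_AE:
  fixes f g f' g' :: "real^2 \<Rightarrow> real"
  assumes "f \<in> L2 L" "f' \<in> L2 L" "g \<in> L2 L" "g' \<in> L2 L"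
    and "AE x in dom_measure L. f x = f' x" "AE x in dom_measure L. g x = g' x"
  shows "L2_inner L f g = L2_inner L f' g'"
  unfolding L2_inner_real
  by (rule integral_cong_AE) (use assms in \<open>auto intro!: borel_measurable_times L2_measurable\<close>)

lemma L2_inner_self_nonneg [simp]: "0 \<le> L2_inner L f (f :: real^2 \<Rightarrow> real)"
  by (simp add: L2_inner_real)

lemma L2_norm_nonneg [simp]: "0 \<le> L2_norm L (f :: real^2 \<Rightarrow> real)"
  by (simp add: L2_norm_def)

lemma L2_norm_sq: "(L2_norm L f)\<^sup>2 = L2_inner L f (f :: real^2 \<Rightarrow> real)"
  by (simp add: L2_norm_def)

lemma L2_norm_minus_commute:
  fixes f g :: "real^2 \<Rightarrow> real"
  shows "L2_norm L (\<lambda>x. f x - g x) = L2_norm L (\<lambda>x. g x - f x)"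
proof -
  have "(f x - g x) * (f x - g x) = (g x - f x) * (g x - f x)" for x by algebra
  then show ?thesis by (simp add: L2_norm_def L2_inner_real)
qed

lemma L2_norm_cmult: "L2_norm L (\<lambda>x. c * f x) = \<bar>c\<bar> * L2_norm L (f :: real^2 \<Rightarrow> real)"
proof -
  have "L2_inner L (\<lambda>x. c * f x) (\<lambda>x. c * f x) = c\<^sup>2 * L2_inner L f f"
    by (simp add: L2_inner_cmult_left L2_inner_cmult_right power2_eq_square)
  then show ?thesis by (simp add: L2_norm_def real_sqrt_mult)
qed

lemma L2_inner_self_add_cmult:
  fixes f g :: "real^2 \<Rightarrow> real"
  assumes "f \<in> L2 L" "g \<in> L2 L"
  shows "L2_inner L (\<lambda>x. f x + c * g x) (\<lambda>x. f x + c * g x)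
    = L2_inner L f f + 2 * c * L2_inner L f g + c\<^sup>2 * L2_inner L g g"
  using assms
  by (simp add: L2_inner_add_left L2_inner_add_right L2_inner_cmult_left L2_inner_cmult_right
      L2_add L2_cmult L2_inner_commute[of L g f] power2_eq_square algebra_simps)

lemma L2_inner_self_diff:
  fixes f g :: "real^2 \<Rightarrow> real"
  assumes "f \<in> L2 L" "g \<in> L2 L"
  shows "L2_inner L (\<lambda>x. f x - g x) (\<lambda>x. f x - g x)
    = L2_inner L f f - 2 * L2_inner L f g + L2_inner L g g"
  using L2_inner_self_add_cmult[OF assms, of "-1"] by simp

section \<open>Cauchy-Schwarz, triangle inequality, convergence and completeness\<close>

lemma L2_Cauchy_Schwarz:
  fixes f g :: "real^2 \<Rightarrow> real"
  assumes "f \<in> L2 L" "g \<in> L2 L"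
  shows "\<bar>L2_inner L f g\<bar> \<le> L2_norm L f * L2_norm L g"
proof -
  define A B C where "A = L2_inner L f f" and "B = L2_inner L f g" and "C = L2_inner L g g"
  have pos: "0 \<le> A + 2 * t * B + t\<^sup>2 * C" for t
    using L2_inner_self_nonneg[of L "\<lambda>x. f x + t * g x"] L2_inner_self_add_cmult[OF assms, of t]
    by (simp add: A_def B_def C_def)
  have C: "0 \<le> C" and A: "0 \<le> A" by (simp_all add: C_def A_def)
  have "B\<^sup>2 \<le> A * C"
  proof (cases "C = 0")
    case True
    have "B = 0"
    proof (rule ccontr)
      assume B: "B \<noteq> 0"
      \<comment> \<open>With C = 0 the quadratic is affine in t, and this t gives it the value
        -1.\<close>
      have "A + 2 * (- (A + 1) / (2 * B)) * B = - 1" using B by (simp add: field_simps)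
      then show False using pos[of "- (A + 1) / (2 * B)"] True by simp
    qed
    then show ?thesis using True by simp
  next
    case False
    \<comment> \<open>The minimiser of the quadratic is t = -B/C.\<close>
    have "A + 2 * (- B / C) * B + (- B / C)\<^sup>2 * C = A - B\<^sup>2 / C"
      using False by (simp add: field_simps power2_eq_square)
    then have "B\<^sup>2 / C \<le> A" using pos[of "- B / C"] by simp
    then show ?thesis using False C by (simp add: field_simps)
  qed
  then have "sqrt (B\<^sup>2) \<le> sqrt (A * C)" by (rule real_sqrt_le_mono)
  then show ?thesis by (simp add: L2_norm_def A_def B_def C_def real_sqrt_mult)
qed

lemma L2_norm_triangle:
  fixes f g :: "real^2 \<Rightarrow> real"
  assumes "f \<in> L2 L" "g \<in> L2 L"
  shows "L2_norm L (\<lambda>x. f x + g x) \<le> L2_norm L f + L2_norm L g"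
proof (rule power2_le_imp_le)
  have "(L2_norm L (\<lambda>x. f x + g x))\<^sup>2 = (L2_norm L f)\<^sup>2 + 2 * L2_inner L f g + (L2_norm L g)\<^sup>2"
    using L2_inner_self_add_cmult[OF assms, of 1] by (simp add: L2_norm_sq)
  also have "\<dots> \<le> (L2_norm L f + L2_norm L g)\<^sup>2"
    using L2_Cauchy_Schwarz[OF assms] by (simp add: power2_sum)
  finally show "(L2_norm L (\<lambda>x. f x + g x))\<^sup>2 \<le> (L2_norm L f + L2_norm L g)\<^sup>2" .
qed simp

lemma L2_norm_triangle_diff:
  fixes f g h :: "real^2 \<Rightarrow> real"
  assumes "f \<in> L2 L" "g \<in> L2 L" "h \<in> L2 L"
  shows "L2_norm L (\<lambda>x. f x - h x) \<le> L2_norm L (\<lambda>x. f x - g x) + L2_norm L (\<lambda>x. g x - h x)"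
  using L2_norm_triangle[OF L2_diff[OF assms(1,2)] L2_diff[OF assms(2,3)]] by simp

lemma L2_norm_diff_le:
  fixes f g :: "real^2 \<Rightarrow> real"
  assumes "f \<in> L2 L" "g \<in> L2 L"
  shows "\<bar>L2_norm L f - L2_norm L g\<bar> \<le> L2_norm L (\<lambda>x. f x - g x)"
  using L2_norm_triangle[OF L2_diff[OF assms] assms(2)]
    L2_norm_triangle[OF L2_diff[OF assms(2,1)] assms(1)]
    L2_norm_minus_commute[of L f g] by simp

lemma L2_norm_mono:
  fixes f g :: "real^2 \<Rightarrow> real"
  assumes "f \<in> L2 L" "g \<in> L2 L" "\<And>x. x \<in> space (dom_measure L) \<Longrightarrow> \<bar>f x\<bar> \<le> \<bar>g x\<bar>"
  shows "L2_norm L f \<le> L2_norm L g"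
  unfolding L2_norm_def L2_inner_real power2_eq_square[symmetric]
  by (intro real_sqrt_le_mono integral_mono)
    (use assms in \<open>auto simp: L2_square_integrable abs_le_square_iff[symmetric]\<close>)

lemma L2_norm_eq_0_AE:
  fixes f :: "real^2 \<Rightarrow> real"
  assumes "f \<in> L2 L" "L2_norm L f = 0"
  shows "AE x in dom_measure L. f x = 0"
proof -
  have "(\<integral>x. (f x)\<^sup>2 \<partial>dom_measure L) = 0"
    using assms(2) by (simp add: L2_norm_def L2_inner_real power2_eq_square)
  then have "AE x in dom_measure L. (f x)\<^sup>2 = 0"
    using integral_nonneg_eq_0_iff_AE[OF L2_square_integrable[OF assms(1)]] by simp
  then show ?thesis by simp
qed

lemma L2_inner_tendsto:
  fixes f :: "nat \<Rightarrow> real^2 \<Rightarrow> real"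
  assumes "\<And>n. f n \<in> L2 L" "g \<in> L2 L" "h \<in> L2 L"
    and lim: "(\<lambda>n. L2_norm L (\<lambda>x. f n x - g x)) \<longlonglongrightarrow> 0"
  shows "(\<lambda>n. L2_inner L (f n) h) \<longlonglongrightarrow> L2_inner L g h"
proof (rule LIM_zero_cancel, rule Lim_null_comparison)
  show "(\<lambda>n. L2_norm L (\<lambda>x. f n x - g x) * L2_norm L h) \<longlonglongrightarrow> 0"
    using tendsto_mult[OF lim tendsto_const] by simp
  show "\<forall>\<^sub>F n in sequentially. norm (L2_inner L (f n) h - L2_inner L g h)
      \<le> L2_norm L (\<lambda>x. f n x - g x) * L2_norm L h"
    using L2_Cauchy_Schwarz[OF L2_diff[OF assms(1) assms(2)] assms(3)] assms
    by (simp add: L2_inner_diff_left)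
qed

lemma L2_norm_tendsto:
  fixes f :: "nat \<Rightarrow> real^2 \<Rightarrow> real"
  assumes "\<And>n. f n \<in> L2 L" "g \<in> L2 L"
    and lim: "(\<lambda>n. L2_norm L (\<lambda>x. f n x - g x)) \<longlonglongrightarrow> 0"
  shows "(\<lambda>n. L2_norm L (f n)) \<longlonglongrightarrow> L2_norm L g"
proof (rule LIM_zero_cancel, rule Lim_null_comparison[OF _ lim])
  show "\<forall>\<^sub>F n in sequentially. norm (L2_norm L (f n) - L2_norm L g) \<le> L2_norm L (\<lambda>x. f n x - g x)"
    using L2_norm_diff_le[OF assms(1) assms(2)] by simp
qed

text \<open>The squared differences tend to 0 in L^1, so the subsequence theorem for L^1 applies to
  them.\<close>

lemma L2_AE_subseq:
  fixes f :: "nat \<Rightarrow> real^2 \<Rightarrow> real"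
  assumes "\<And>n. f n \<in> L2 L" "g \<in> L2 L"
    and lim: "(\<lambda>n. L2_norm L (\<lambda>x. f n x - g x)) \<longlonglongrightarrow> 0"
  shows "\<exists>r. strict_mono r \<and> (AE x in dom_measure L. (\<lambda>n. f (r n) x) \<longlonglongrightarrow> g x)"
proof -
  have "(\<lambda>n. (L2_norm L (\<lambda>x. f n x - g x))\<^sup>2) \<longlonglongrightarrow> 0\<^sup>2" using lim by (rule tendsto_power)
  then have "(\<lambda>n. \<integral>x. norm ((f n x - g x)\<^sup>2) \<partial>dom_measure L) \<longlonglongrightarrow> 0"
    unfolding L2_norm_sq L2_inner_real by (simp add: power2_eq_square)
  then obtain r :: "nat \<Rightarrow> nat" where r: "strict_mono r"
    and ae: "AE x in dom_measure L. (\<lambda>n. (f (r n) x - g x)\<^sup>2) \<longlonglongrightarrow> 0"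
    using tendsto_L1_AE_subseq[of "dom_measure L" "\<lambda>n x. (f n x - g x)\<^sup>2"]
      L2_square_integrable[OF L2_diff[OF assms(1,2)]] by blast
  have "AE x in dom_measure L. (\<lambda>n. f (r n) x) \<longlonglongrightarrow> g x"
    using ae
  proof eventually_elim
    case (elim x)
    then have "(\<lambda>n. sqrt ((f (r n) x - g x)\<^sup>2)) \<longlonglongrightarrow> sqrt 0" by (rule tendsto_real_sqrt)
    then have "(\<lambda>n. f (r n) x - g x) \<longlonglongrightarrow> 0" by (simp add: tendsto_rabs_zero_iff)
    then show ?case by (rule LIM_zero_cancel)
  qed
  with r show ?thesis by blast
qed

text \<open>Along a subsequence with increments below (1/2)^k, finiteness of the measure turns L^2
  bounds into L^1 bounds. The increments are then absolutely summable almost everywhere, which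
  yields a pointwise limit, and Fatou's lemma identifies it as the limit in L^2.\<close>

lemma L2_complete:
  fixes f :: "nat \<Rightarrow> real^2 \<Rightarrow> real"
  assumes f: "\<And>n. f n \<in> L2 L"
    and cauchy: "\<And>e. 0 < e \<Longrightarrow> \<exists>M. \<forall>m\<ge>M. \<forall>n\<ge>M. L2_norm L (\<lambda>x. f m x - f n x) < e"
  shows "\<exists>g\<in>L2 L. (\<lambda>n. L2_norm L (\<lambda>x. f n x - g x)) \<longlonglongrightarrow> 0"
proof -
  let ?M = "dom_measure L"
  interpret finite_measure ?M by (rule finite_measure_dom)
  have "\<exists>r. \<forall>k::nat. (\<forall>m\<ge>r k. \<forall>n\<ge>r k. L2_norm L (\<lambda>x. f m x - f n x) < (1/2)^k) \<and> r k < r (Suc k)"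
  proof (rule dependent_nat_choice)
    show "\<exists>r. \<forall>m\<ge>r. \<forall>n\<ge>r. L2_norm L (\<lambda>x. f m x - f n x) < (1/2)^0"
      using cauchy[of "1"] by simp
  next
    fix r k :: nat
    obtain M where "\<forall>m\<ge>M. \<forall>n\<ge>M. L2_norm L (\<lambda>x. f m x - f n x) < (1/2)^Suc k"
      using cauchy[of "(1/2)^Suc k"] by auto
    then show "\<exists>r'. (\<forall>m\<ge>r'. \<forall>n\<ge>r'. L2_norm L (\<lambda>x. f m x - f n x) < (1/2)^Suc k) \<and> r < r'"
      by (intro exI[of _ "max M (Suc r)"]) auto
  qed
  then obtain r :: "nat \<Rightarrow> nat"
    where r: "\<And>k m n. m \<ge> r k \<Longrightarrow> n \<ge> r k \<Longrightarrow> L2_norm L (\<lambda>x. f m x - f n x) < (1/2)^k"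
      and "\<And>k. r k < r (Suc k)" by blast
  then have sm: "strict_mono r" by (simp add: strict_mono_Suc_iff)
  have one: "(\<lambda>_. 1::real) \<in> L2 L" by (simp add: L2_real_iff)
  define d where "d k x = f (r (Suc k)) x - f (r k) x" for k x
  have d: "d k \<in> L2 L" for k unfolding d_def using f by blast
  have int: "(\<integral>x. \<bar>d k x\<bar> \<partial>?M) \<le> L2_norm L (\<lambda>_. 1::real) * (1/2)^k" for k
  proof -
    have da: "(\<lambda>x. \<bar>d k x\<bar>) \<in> L2 L" using d[of k] by (auto simp: L2_real_iff)
    have "(\<integral>x. \<bar>d k x\<bar> \<partial>?M) \<le> L2_norm L (\<lambda>_. 1::real) * L2_norm L (\<lambda>x. \<bar>d k x\<bar>)"
      using L2_Cauchy_Schwarz[OF one da] by (simp add: L2_inner_real)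
    also have "L2_norm L (\<lambda>x. \<bar>d k x\<bar>) \<le> L2_norm L (d k)" using da d by (intro L2_norm_mono) auto
    also have "L2_norm L (d k) \<le> (1/2)^k"
      unfolding d_def using r[of k "r (Suc k)" "r k"] \<open>\<And>k. r k < r (Suc k)\<close>[of k] by simp
    finally show ?thesis by (simp add: mult_left_mono)
  qed
  have di: "integrable ?M (d k)" for k
    using L2_mult_integrable[OF one d[of k]] by simp
  have "AE x in ?M. summable (\<lambda>k. norm (d k x))"
  proof -
    have m[measurable]: "d k \<in> borel_measurable ?M" for k using d by (rule L2_measurable)
    have "(\<integral>\<^sup>+x. (\<Sum>k. ennreal \<bar>d k x\<bar>) \<partial>?M) = (\<Sum>k. \<integral>\<^sup>+x. ennreal \<bar>d k x\<bar> \<partial>?M)"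
      by (rule nn_integral_suminf) simp
    also have "\<dots> = (\<Sum>k. ennreal (\<integral>x. \<bar>d k x\<bar> \<partial>?M))"
      using di by (intro suminf_cong nn_integral_eq_integral) auto
    also have "\<dots> \<le> (\<Sum>k. ennreal (L2_norm L (\<lambda>_. 1::real) * (1/2)^k))"
      using int by (intro suminf_le ennreal_leI) auto
    also have "\<dots> = ennreal (\<Sum>k. L2_norm L (\<lambda>_. 1::real) * (1/2)^k)"
      by (rule suminf_ennreal2) (auto intro!: summable_mult summable_geometric)
    also have "\<dots> < \<infinity>" by simp
    finally have "(\<integral>\<^sup>+x. (\<Sum>k. ennreal \<bar>d k x\<bar>) \<partial>?M) \<noteq> \<infinity>" by simp
    then have "AE x in ?M. (\<Sum>k. ennreal \<bar>d k x\<bar>) \<noteq> \<infinity>"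
      by (intro nn_integral_noteq_infinite) simp_all
    then show ?thesis
      by eventually_elim (auto intro!: summable_suminf_not_top)
  qed
  then have ae: "AE x in ?M. convergent (\<lambda>k. f (r k) x)"
  proof eventually_elim
    case (elim x)
    then have "summable (\<lambda>k. d k x)" by (rule summable_norm_cancel)
    then have "convergent (\<lambda>n. \<Sum>k<n. d k x)" by (simp add: summable_iff_convergent)
    then have "convergent (\<lambda>n. (\<Sum>k<n. d k x) + f (r 0) x)" by (simp add: convergent_add_const_right_iff)
    moreover have "(\<Sum>k<n. d k x) + f (r 0) x = f (r n) x" for n
      unfolding d_def by (subst sum_lessThan_telescope) simp
    ultimately show ?case by simp
  qed
  \<comment> \<open>Where the subsequence diverges \<open>lim\<close> is an unspecified number, but
    \<open>g\<close> is measurable as a whole and the exceptional set is null.\<close>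
  define g where "g x = lim (\<lambda>k. f (r k) x)" for x
  have fm[measurable]: "f n \<in> borel_measurable ?M" for n using f by (rule L2_measurable)
  have gm[measurable]: "g \<in> borel_measurable ?M" unfolding g_def by measurable
  \<comment> \<open>Used twice: with e = 1 at the index \<open>r 0\<close> to place \<open>g\<close>
    in L^2, then with e/2 for the convergence.\<close>
  have fatou: "(\<integral>\<^sup>+x. ennreal ((f n x - g x)\<^sup>2) \<partial>?M) \<le> ennreal (e\<^sup>2)"
    if e: "\<And>m. m \<ge> n \<Longrightarrow> L2_norm L (\<lambda>x. f n x - f m x) \<le> e" for n e
  proof -
    have e0: "0 \<le> e" using e[of n] L2_norm_nonneg[of L "\<lambda>x. f n x - f n x"] by linarith
    have "(\<integral>\<^sup>+x. ennreal ((f n x - g x)\<^sup>2) \<partial>?M)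
        = (\<integral>\<^sup>+x. liminf (\<lambda>k. ennreal ((f n x - f (r k) x)\<^sup>2)) \<partial>?M)"
    proof (rule nn_integral_cong_AE)
      show "AE x in ?M. ennreal ((f n x - g x)\<^sup>2) = liminf (\<lambda>k. ennreal ((f n x - f (r k) x)\<^sup>2))"
        using ae
      proof eventually_elim
        case (elim x)
        then have "(\<lambda>k. f (r k) x) \<longlonglongrightarrow> g x" unfolding g_def by (simp add: convergent_LIMSEQ_iff)
        then have "(\<lambda>k. ennreal ((f n x - f (r k) x)\<^sup>2)) \<longlonglongrightarrow> ennreal ((f n x - g x)\<^sup>2)"
          by (intro tendsto_ennrealI tendsto_intros)
        from lim_imp_Liminf[OF trivial_limit_sequentially this] show ?case by (rule sym)
      qed
    qed
    also have "\<dots> \<le> liminf (\<lambda>k. \<integral>\<^sup>+x. ennreal ((f n x - f (r k) x)\<^sup>2) \<partial>?M)"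
      by (rule nn_integral_liminf) simp
    also have "\<dots> \<le> liminf (\<lambda>k. ennreal (e\<^sup>2))"
    proof (rule Liminf_mono)
      show "\<forall>\<^sub>F k in sequentially. (\<integral>\<^sup>+x. ennreal ((f n x - f (r k) x)\<^sup>2) \<partial>?M) \<le> ennreal (e\<^sup>2)"
        using eventually_ge_at_top[of n]
      proof eventually_elim
        case (elim k)
        then have "n \<le> r k" using seq_suble[OF sm, of k] by simp
        then have "(L2_norm L (\<lambda>x. f n x - f (r k) x))\<^sup>2 \<le> e\<^sup>2" using e by (intro power_mono) auto
        moreover have "(\<integral>\<^sup>+x. ennreal ((f n x - f (r k) x)\<^sup>2) \<partial>?M)
            = ennreal ((L2_norm L (\<lambda>x. f n x - f (r k) x))\<^sup>2)"
          unfolding L2_norm_sq L2_inner_real power2_eq_square[symmetric]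
          using L2_square_integrable[OF L2_diff[OF f f]] by (rule nn_integral_eq_integral) simp
        ultimately show ?case by (simp add: ennreal_leI)
      qed
    qed
    also have "\<dots> = ennreal (e\<^sup>2)" by (simp add: Liminf_const)
    finally show ?thesis .
  qed
  have diffL2: "(\<lambda>x. f (r 0) x - g x) \<in> L2 L"
  proof -
    have "(\<integral>\<^sup>+x. ennreal ((f (r 0) x - g x)\<^sup>2) \<partial>?M) \<le> ennreal (1\<^sup>2)"
      using r[of 0 "r 0"] by (intro fatou) (simp add: less_imp_le)
    also have "\<dots> < \<infinity>" by simp
    finally show ?thesis
      unfolding L2_real_iff by (auto intro!: integrableI_nonneg)
  qed
  have g: "g \<in> L2 L"
    using L2_diff[OF f[of "r 0"] diffL2] by simp
  have "(\<lambda>n. L2_norm L (\<lambda>x. f n x - g x)) \<longlonglongrightarrow> 0"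
  proof (rule LIMSEQ_I)
    fix e :: real assume "0 < e"
    then obtain M where M: "\<And>m n. m \<ge> M \<Longrightarrow> n \<ge> M \<Longrightarrow> L2_norm L (\<lambda>x. f m x - f n x) < e / 2"
      using cauchy[of "e/2"] by auto
    have "norm (L2_norm L (\<lambda>x. f n x - g x) - 0) < e" if "n \<ge> M" for n
    proof -
      have "(\<integral>\<^sup>+x. ennreal ((f n x - g x)\<^sup>2) \<partial>?M) \<le> ennreal ((e/2)\<^sup>2)"
        using M that by (intro fatou) (auto intro!: less_imp_le)
      moreover have "(\<integral>\<^sup>+x. ennreal ((f n x - g x)\<^sup>2) \<partial>?M) = ennreal ((L2_norm L (\<lambda>x. f n x - g x))\<^sup>2)"
        unfolding L2_norm_sq L2_inner_real power2_eq_square[symmetric]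
        using L2_square_integrable[OF L2_diff[OF f g]] by (rule nn_integral_eq_integral) simp
      ultimately have "(L2_norm L (\<lambda>x. f n x - g x))\<^sup>2 \<le> (e/2)\<^sup>2" by (simp add: ennreal_le_iff)
      then have "L2_norm L (\<lambda>x. f n x - g x) \<le> e/2" using \<open>0 < e\<close> by (rule_tac power2_le_imp_le) auto
      then show ?thesis using \<open>0 < e\<close> by simp
    qed
    then show "\<exists>no. \<forall>n\<ge>no. norm (L2_norm L (\<lambda>x. f n x - g x) - 0) < e" by blast
  qed
  with g show ?thesis by blast
qed

section \<open>Smooth test functions\<close>

lemma pderiv_dir_eqI:
  assumes "(f has_derivative f') (at x)"
  shows "pderiv_dir i f x = f' (axis i 1)"
  using frechet_derivative_at[OF assms] by (simp add: pderiv_dir_def)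

lemma has_derivative_frechet:
  "f differentiable (at x) \<Longrightarrow> (f has_derivative frechet_derivative f (at x)) (at x)"
  by (simp add: frechet_derivative_works)

lemma Ck_Suc_imp: "Ck (Suc k) f \<Longrightarrow> Ck k f"
proof (induction k arbitrary: f)
  case 0
  then show ?case
    by (auto simp: continuous_on_eq_continuous_at intro: differentiable_imp_continuous_within)
qed simp

lemma Ck_const: "Ck k (\<lambda>_. c)"
proof (induction k arbitrary: c)
  case (Suc k)
  have "pderiv_dir i (\<lambda>_. c) = (\<lambda>_. 0)" for i
    by (intro ext) (rule pderiv_dir_eqI[OF has_derivative_const])
  then show ?case using Suc by simp
qed simp

lemma pderiv_dir_add:
  assumes "f differentiable (at x)" "g differentiable (at x)"
  shows "pderiv_dir i (\<lambda>x. f x + g x) x = pderiv_dir i f x + pderiv_dir i g x"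
  by (subst pderiv_dir_eqI[OF has_derivative_add[OF assms[THEN has_derivative_frechet]]])
    (simp add: pderiv_dir_def)

lemma pderiv_dir_mult:
  assumes "f differentiable (at x)" "g differentiable (at x)"
  shows "pderiv_dir i (\<lambda>x. f x * g x) x = f x * pderiv_dir i g x + pderiv_dir i f x * g x"
  by (subst pderiv_dir_eqI[OF has_derivative_mult[OF assms[THEN has_derivative_frechet]]])
    (simp add: pderiv_dir_def)

lemma pderiv_dir_compose:
  assumes "f differentiable (at x)" "(g has_real_derivative g') (at (f x))"
  shows "pderiv_dir i (\<lambda>x. g (f x)) x = g' * pderiv_dir i f x"
  by (subst pderiv_dir_eqI[OF has_derivative_compose[OF has_derivative_frechet[OF assms(1)]
        assms(2)[unfolded has_field_derivative_def]]])
    (simp add: pderiv_dir_def)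

lemma Ck_add: "Ck k f \<Longrightarrow> Ck k g \<Longrightarrow> Ck k (\<lambda>x. f x + g x)"
proof (induction k arbitrary: f g)
  case (Suc k)
  then have "pderiv_dir i (\<lambda>x. f x + g x) = (\<lambda>x. pderiv_dir i f x + pderiv_dir i g x)" for i
    by (auto intro!: ext pderiv_dir_add)
  then show ?case using Suc by auto
qed (auto intro: continuous_on_add)

lemma Ck_mult: "Ck k f \<Longrightarrow> Ck k g \<Longrightarrow> Ck k (\<lambda>x. f x * g x)"
proof (induction k arbitrary: f g)
  case (Suc k)
  then have "pderiv_dir i (\<lambda>x. f x * g x) = (\<lambda>x. f x * pderiv_dir i g x + pderiv_dir i f x * g x)" for i
    by (auto intro!: ext pderiv_dir_mult)
  moreover have "Ck k f" "Ck k g" using Suc.prems Ck_Suc_imp by blast+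
  ultimately show ?case using Suc by (auto intro!: Ck_add)
qed (auto intro: continuous_on_mult)

lemma Ck_cmult: "Ck k f \<Longrightarrow> Ck k (\<lambda>x. c * f x)"
  using Ck_mult[OF Ck_const] .

text \<open>One induction carries both claims, because the derivative of each function involves the
  other.\<close>

lemma Ck_sin_cos: "Ck k f \<Longrightarrow> Ck k (\<lambda>x. sin (f x)) \<and> Ck k (\<lambda>x. cos (f x))"
proof (induction k arbitrary: f)
  case 0
  then show ?case by (auto intro!: continuous_intros)
next
  case (Suc k)
  then have d: "f differentiable (at x)" for x by simp
  have s: "pderiv_dir i (\<lambda>x. sin (f x)) = (\<lambda>x. cos (f x) * pderiv_dir i f x)" for i
    by (intro ext pderiv_dir_compose d) (rule DERIV_sin)
  have c: "pderiv_dir i (\<lambda>x. cos (f x)) = (\<lambda>x. - sin (f x) * pderiv_dir i f x)" for i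
    by (intro ext pderiv_dir_compose d) (rule DERIV_cos)
  have df: "(\<lambda>x. sin (f x)) differentiable (at x)" "(\<lambda>x. cos (f x)) differentiable (at x)" for x
    using has_derivative_sin[OF has_derivative_frechet[OF d]]
      has_derivative_cos[OF has_derivative_frechet[OF d]] by (auto simp: differentiable_def)
  have k: "Ck k (\<lambda>x. sin (f x))" "Ck k (\<lambda>x. cos (f x))" "\<And>i. Ck k (pderiv_dir i f)"
    using Suc Ck_Suc_imp by auto
  have "Ck k (\<lambda>x. - (sin (f x) * pderiv_dir i f x))" for i
    using Ck_cmult[OF Ck_mult[OF k(1,3)], of "-1"] by simp
  then show ?case using k by (auto simp: s c df intro!: Ck_mult)
qed

lemma smooth_differentiable: "smooth f \<Longrightarrow> f differentiable (at x)"
  by (metis Ck.simps(2) smooth_def)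

lemma smooth_continuous: "smooth f \<Longrightarrow> continuous_on UNIV f"
  by (metis Ck.simps(1) smooth_def)

lemma smooth_pderiv_dir: "smooth f \<Longrightarrow> smooth (pderiv_dir i f)"
  by (metis Ck.simps(2) smooth_def)

section \<open>Operations on the test functions of the strip\<close>

lemma smooth_strip_test: "\<phi> \<in> strip_test L \<Longrightarrow> smooth \<phi>"
  by (simp add: strip_test_def)

lemma strip_test_zero: "(\<lambda>_. 0) \<in> strip_test L"
  by (auto simp: strip_test_def smooth_def Ck_const intro: exI[of _ 1])

lemma strip_test_add:
  assumes "\<phi> \<in> strip_test L" "\<psi> \<in> strip_test L"
  shows "(\<lambda>x. \<phi> x + \<psi> x) \<in> strip_test L"
proof -
  obtain d e where "0 < d" "\<forall>x. x $ 2 < d \<or> x $ 2 > L - d \<longrightarrow> \<phi> x = 0"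
    "0 < e" "\<forall>x. x $ 2 < e \<or> x $ 2 > L - e \<longrightarrow> \<psi> x = 0"
    using assms by (auto simp: strip_test_def)
  then have "\<exists>\<delta>>0. \<forall>x. x $ 2 < \<delta> \<or> x $ 2 > L - \<delta> \<longrightarrow> \<phi> x + \<psi> x = 0"
    by (intro exI[of _ "min d e"]) (auto simp: min_def split: if_splits)
  then show ?thesis using assms by (simp add: strip_test_def smooth_def Ck_add)
qed

lemma strip_test_compose:
  assumes "\<phi> \<in> strip_test L" "smooth (\<lambda>x. g (\<phi> x))" "g 0 = 0"
  shows "(\<lambda>x. g (\<phi> x)) \<in> strip_test L"
proof -
  obtain d where "0 < d" "\<And>x. x $ 2 < d \<or> x $ 2 > L - d \<Longrightarrow> \<phi> x = 0"
    using assms(1) by (auto simp: strip_test_def)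
  then have "\<exists>\<delta>>0. \<forall>x. x $ 2 < \<delta> \<or> x $ 2 > L - \<delta> \<longrightarrow> g (\<phi> x) = 0"
    using assms(3) by (intro exI[of _ d]) simp
  then show ?thesis using assms(1,2) by (simp add: strip_test_def)
qed

lemma strip_test_cmult: "\<phi> \<in> strip_test L \<Longrightarrow> (\<lambda>x. c * \<phi> x) \<in> strip_test L"
  by (rule strip_test_compose) (simp_all add: strip_test_def smooth_def Ck_cmult)

lemma strip_test_sum:
  assumes "\<And>j. j \<in> I \<Longrightarrow> \<phi> j \<in> strip_test L"
  shows "(\<lambda>x. \<Sum>j\<in>I. c j * \<phi> j x) \<in> strip_test L"
  using assms
proof (induction I rule: infinite_finite_induct)
  case (insert j I)
  then show ?case by (simp add: strip_test_add strip_test_cmult)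
qed (simp_all add: strip_test_zero)

lemma pderiv_dir_sum:
  assumes "\<And>j. j \<in> I \<Longrightarrow> smooth (\<phi> j)" "finite I"
  shows "pderiv_dir i (\<lambda>x. \<Sum>j\<in>I. c j * \<phi> j x) x = (\<Sum>j\<in>I. c j * pderiv_dir i (\<phi> j) x)"
proof -
  have "((\<lambda>x. \<Sum>j\<in>I. c j * \<phi> j x) has_derivative
      (\<lambda>y. \<Sum>j\<in>I. c j * frechet_derivative (\<phi> j) (at x) y)) (at x)"
    using assms(1)
    by (intro has_derivative_sum has_derivative_mult_right has_derivative_frechet smooth_differentiable)
  from pderiv_dir_eqI[OF this] show ?thesis by (simp add: pderiv_dir_def)
qed

lemma strip_test_sin:
  assumes "\<phi> \<in> strip_test L"
  shows "(\<lambda>x. M * sin (\<phi> x / M)) \<in> strip_test L"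
proof -
  have "Ck k (\<lambda>x. M * sin (\<phi> x / M))" for k
    using assms Ck_cmult[of k \<phi> "1/M"]
    by (intro Ck_cmult conjunct1[OF Ck_sin_cos]) (simp add: strip_test_def smooth_def)
  then show ?thesis by (intro strip_test_compose[OF assms]) (simp_all add: smooth_def)
qed

text \<open>M^2 (1 - cos (s/M)) is the primitive of M sin (s/M) that vanishes at 0. Through it,
  advection of \<phi> tested with M sin (\<phi>/M) becomes u times a gradient, to which
  incompressibility applies.\<close>

lemma strip_test_cos:
  assumes "\<phi> \<in> strip_test L"
  shows "(\<lambda>x. M\<^sup>2 * (1 - cos (\<phi> x / M))) \<in> strip_test L"
proof -
  have "Ck k (\<lambda>x. M\<^sup>2 * (1 + (-1) * cos (\<phi> x / M)))" for k
    using assms Ck_cmult[of k \<phi> "1/M"]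
    by (intro Ck_cmult Ck_add Ck_const conjunct2[OF Ck_sin_cos]) (simp add: strip_test_def smooth_def)
  then show ?thesis by (intro strip_test_compose[OF assms]) (simp_all add: smooth_def)
qed

lemma pderiv_dir_sin:
  assumes "smooth \<phi>" "M \<noteq> 0"
  shows "pderiv_dir i (\<lambda>x. M * sin (\<phi> x / M)) x = cos (\<phi> x / M) * pderiv_dir i \<phi> x"
  by (rule pderiv_dir_compose[where g="\<lambda>s. M * sin (s / M)"])
    (use assms in \<open>auto intro!: smooth_differentiable derivative_eq_intros\<close>)

lemma pderiv_dir_cos:
  assumes "smooth \<phi>" "M \<noteq> 0"
  shows "pderiv_dir i (\<lambda>x. M\<^sup>2 * (1 - cos (\<phi> x / M))) x = M * sin (\<phi> x / M) * pderiv_dir i \<phi> x"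
  by (rule pderiv_dir_compose[where g="\<lambda>s. M\<^sup>2 * (1 - cos (s / M))"])
    (use assms in \<open>auto intro!: smooth_differentiable derivative_eq_intros simp: power2_eq_square\<close>)

lemma continuous_L2:
  fixes f :: "real^2 \<Rightarrow> real"
  assumes "continuous_on UNIV f"
  shows "f \<in> L2 L"
proof -
  have "compact (f ` cbox 0 (\<chi> i. L))"
    using assms continuous_on_subset by (intro compact_continuous_image) auto
  then obtain c where "\<forall>x\<in>cbox 0 (\<chi> i. L). \<bar>f x\<bar> \<le> c"
    by (force dest!: compact_imp_bounded simp: bounded_iff)
  then show ?thesis
    using assms by (intro L2_bounded[where c=c] measurable_dom_measure borel_measurable_continuous_onI) auto
qed

lemma strip_test_L2: "\<phi> \<in> strip_test L' \<Longrightarrow> \<phi> \<in> L2 L"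
  by (intro continuous_L2 smooth_continuous smooth_strip_test)

lemma strip_test_pderiv_L2: "\<phi> \<in> strip_test L' \<Longrightarrow> pderiv_dir i \<phi> \<in> L2 L"
  by (intro continuous_L2 smooth_continuous smooth_pderiv_dir smooth_strip_test)

subsection \<open>Periodic extension\<close>

text \<open>\<open>divfree\<close> tests only with functions periodic in both directions, whereas a
  strip test function is zero for x_2 beyond the strip. Repeating its values on 0 \<le> x_2 < L
  makes it admissible.\<close>

definition periodize :: "real \<Rightarrow> (real^2 \<Rightarrow> real) \<Rightarrow> real^2 \<Rightarrow> real" where
  "periodize L f x = f (x - axis 2 (L * of_int \<lfloor>x $ 2 / L\<rfloor>))"

text \<open>The floor jumps only at multiples of L, where both adjacent translates vanish. The
  neighbourhood may therefore reach \<delta> below the cell of x, and a single translate of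
  \<open>f\<close> describes the extension on all of it.\<close>

lemma periodize_local:
  assumes "0 < \<delta>" "\<delta> \<le> L"
    and van: "\<And>x. x $ 2 < \<delta> \<or> x $ 2 > L - \<delta> \<Longrightarrow> f x = 0"
    and k: "k = \<lfloor>x $ 2 / L\<rfloor>"
  shows "\<exists>U. open U \<and> x \<in> U \<and> (\<forall>y\<in>U. periodize L f y = f (y - axis 2 (L * of_int k)))"
proof (intro exI conjI ballI)
  have L: "0 < L" using assms by simp
  let ?U = "{y :: real^2. L * of_int k - \<delta> < y $ 2} \<inter> {y. y $ 2 < L * of_int (k + 1)}"
  show "open ?U"
    by (intro open_Int open_Collect_less continuous_intros)
  have "of_int k \<le> x $ 2 / L" "x $ 2 / L < of_int k + 1" unfolding k by linarith+
  then have "L * of_int k \<le> x $ 2" "x $ 2 < L * (of_int k + 1)" using L by (simp_all add: field_simps)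
  then show "x \<in> ?U" using assms(1) by simp
  fix y assume y: "y \<in> ?U"
  show "periodize L f y = f (y - axis 2 (L * of_int k))"
  proof (cases "L * of_int k \<le> y $ 2")
    case True
    then have "\<lfloor>y $ 2 / L\<rfloor> = k" using y L by (intro floor_unique) (auto simp: field_simps)
    then show ?thesis by (simp add: periodize_def)
  next
    case False
    then have "\<lfloor>y $ 2 / L\<rfloor> = k - 1"
      using y L assms(2) by (intro floor_unique) (auto simp: field_simps)
    then have "periodize L f y = f (y - axis 2 (L * (of_int k - 1)))" by (simp add: periodize_def)
    also have "\<dots> = 0" using y by (intro van) (simp add: algebra_simps axis_def)
    also have "0 = f (y - axis 2 (L * of_int k))"
      using False assms(1) by (intro van[symmetric]) (simp add: axis_def)
    finally show ?thesis .
  qed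
qed

lemma pderiv_dir_vanishes:
  assumes van: "\<And>x. x $ 2 < \<delta> \<or> x $ 2 > L - \<delta> \<Longrightarrow> f x = 0" and x: "x $ 2 < \<delta> \<or> x $ 2 > L - \<delta>"
  shows "pderiv_dir i f x = 0"
proof -
  have "open ({x :: real^2. x $ 2 < \<delta>} \<union> {x. x $ 2 > L - \<delta>})"
    by (intro open_Un open_Collect_less continuous_intros)
  then have "(f has_derivative (\<lambda>_. 0)) (at x)"
    using x by (rule_tac has_derivative_transform_within_open[OF has_derivative_const[of 0]])
      (auto simp: van)
  then show ?thesis by (simp add: pderiv_dir_eqI)
qed

lemma periodize_derivative:
  assumes "0 < \<delta>" "\<delta> \<le> L"
    and van: "\<And>x. x $ 2 < \<delta> \<or> x $ 2 > L - \<delta> \<Longrightarrow> f x = 0"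
    and d: "\<And>x. f differentiable (at x)"
  shows "periodize L f differentiable (at x)"
    and "pderiv_dir i (periodize L f) x = periodize L (pderiv_dir i f) x"
proof -
  define a :: "real^2" where "a = axis 2 (L * of_int \<lfloor>x $ 2 / L\<rfloor>)"
  have "\<exists>U. open U \<and> x \<in> U \<and> (\<forall>y\<in>U. periodize L f y = f (y - a))"
    unfolding a_def by (rule periodize_local[OF assms(1,2) van]) simp_all
  then obtain U where U: "open U" "x \<in> U" "\<And>y. y \<in> U \<Longrightarrow> periodize L f y = f (y - a)"
    by blast
  have "((\<lambda>y. f (y - a)) has_derivative (\<lambda>y. frechet_derivative f (at (x - a)) y)) (at x)"
    by (rule has_derivative_compose[where g=f and f="\<lambda>y. y - a", OF _ has_derivative_frechet[OF d]])
      (auto intro!: derivative_eq_intros)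
  then have h: "(periodize L f has_derivative (\<lambda>y. frechet_derivative f (at (x - a)) y)) (at x)"
    by (rule has_derivative_transform_within_open[OF _ U(1,2)]) (simp add: U(3))
  then show "periodize L f differentiable (at x)" by (auto simp: differentiable_def)
  show "pderiv_dir i (periodize L f) x = periodize L (pderiv_dir i f) x"
    by (subst pderiv_dir_eqI[OF h]) (simp add: pderiv_dir_def periodize_def a_def)
qed

text \<open>Partial derivatives inherit the vanishing band with the same \<delta>, so the induction
  hypothesis applies to them.\<close>

lemma Ck_periodize:
  assumes "0 < \<delta>" "\<delta> \<le> L"
    and "\<And>x. x $ 2 < \<delta> \<or> x $ 2 > L - \<delta> \<Longrightarrow> f x = 0" and "Ck k f"
  shows "Ck k (periodize L f)"
  using assms(3,4)
proof (induction k arbitrary: f)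
  case 0
  show ?case unfolding Ck.simps continuous_on_eq_continuous_at[OF open_UNIV]
  proof
    fix x :: "real^2"
    define a :: "real^2" where "a = axis 2 (L * of_int \<lfloor>x $ 2 / L\<rfloor>)"
    have "\<exists>U. open U \<and> x \<in> U \<and> (\<forall>y\<in>U. periodize L f y = f (y - a))"
      unfolding a_def by (rule periodize_local[OF assms(1,2) 0(1)]) simp_all
    then obtain U where U: "open U" "x \<in> U" "\<And>y. y \<in> U \<Longrightarrow> periodize L f y = f (y - a)"
      by blast
    have "isCont (\<lambda>y. f (y - a)) x"
    proof (rule isCont_o2[where g=f and f="\<lambda>y. y - a"])
      show "isCont f (x - a)" using 0(2) by (simp add: continuous_on_eq_continuous_at)
    qed simp
    moreover have "\<forall>\<^sub>F y in nhds x. f (y - a) = periodize L f y"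
      using U by (auto simp: eventually_nhds)
    ultimately show "isCont (periodize L f) x" by (simp add: isCont_cong)
  qed
next
  case (Suc k)
  have "pderiv_dir i (periodize L f) = periodize L (pderiv_dir i f)" for i
    using Suc.prems by (intro ext periodize_derivative(2)[OF assms(1,2)]) auto
  moreover have "Ck k (periodize L (pderiv_dir i f))" for i
    using Suc.prems pderiv_dir_vanishes[OF Suc.prems(1)] by (intro Suc.IH) auto
  ultimately show ?case
    using Suc.prems periodize_derivative(1)[OF assms(1,2)] by auto
qed

lemma strip_test_periodic_extension:
  assumes "0 < L" "\<phi> \<in> strip_test L"
  shows "\<exists>g\<in>per_test L. \<forall>i. \<forall>x\<in>cbox 0 (\<chi> i. L). pderiv_dir i g x = pderiv_dir i \<phi> x"
proof (intro bexI ballI allI)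
  obtain d where "0 < d" and d: "\<And>x. x $ 2 < d \<or> x $ 2 > L - d \<Longrightarrow> \<phi> x = 0"
    using assms(2) by (auto simp: strip_test_def)
  \<comment> \<open>Nothing bounds \<open>d\<close> by the period, but the argument at the seam
    needs a band no wider than \<open>L\<close>.\<close>
  define \<delta> where "\<delta> = min d L"
  have \<delta>: "0 < \<delta>" "\<delta> \<le> L" using \<open>0 < d\<close> \<open>0 < L\<close> by (simp_all add: \<delta>_def)
  have van: "\<phi> x = 0" if "x $ 2 < \<delta> \<or> x $ 2 > L - \<delta>" for x
    using that by (intro d) (auto simp: \<delta>_def)
  have "periodize L \<phi> (x + axis 1 L) = periodize L \<phi> x" for x
  proof -
    have "(x + axis 1 L - axis 2 c) = (x - axis 2 c) + axis 1 L" for c by simp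
    moreover have "(x + axis 1 L) $ 2 = x $ 2" by (simp add: axis_def)
    moreover have "\<phi> (y + axis 1 L) = \<phi> y" for y using assms(2) by (simp add: strip_test_def)
    ultimately show ?thesis unfolding periodize_def by metis
  qed
  moreover have "periodize L \<phi> (x + axis 2 L) = periodize L \<phi> x" for x
  proof -
    have f: "\<lfloor>(x $ 2 + L) / L\<rfloor> = \<lfloor>x $ 2 / L\<rfloor> + 1" using \<open>0 < L\<close> by (simp add: add_divide_distrib)
    have "x + axis 2 L - axis 2 (L * of_int (\<lfloor>x $ 2 / L\<rfloor> + 1)) = x - axis 2 (L * of_int \<lfloor>x $ 2 / L\<rfloor>)"
      by (simp add: vec_eq_iff axis_def algebra_simps)
    moreover have "(x + axis 2 L) $ 2 = x $ 2 + L" by simp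
    ultimately show ?thesis unfolding periodize_def using f by metis
  qed
  ultimately have "periodize L \<phi> (x + axis i L) = periodize L \<phi> x" for i x
    using exhaust_2[of i] by auto
  then show "periodize L \<phi> \<in> per_test L"
    using Ck_periodize[OF \<delta> van] assms(2) by (simp add: per_test_def strip_test_def smooth_def)
  fix i :: 2 and x :: "real^2" assume x: "x \<in> cbox 0 (\<chi> i. L)"
  have "pderiv_dir i (periodize L \<phi>) x = periodize L (pderiv_dir i \<phi>) x"
    using assms(2) by (intro periodize_derivative(2)[OF \<delta> van]) (auto intro: smooth_differentiable smooth_strip_test)
  also have "\<dots> = pderiv_dir i \<phi> x"
  \<comment> \<open>On the top side the floor is 1, so the point is moved to the bottom side; the
    derivatives vanish on both sides.\<close>
  proof (cases "x $ 2 = L")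
    case True
    then show ?thesis
      using \<delta> \<open>0 < L\<close> by (simp add: periodize_def pderiv_dir_vanishes[OF van] axis_def)
  next
    case False
    then have "\<lfloor>x $ 2 / L\<rfloor> = 0"
      using x \<open>0 < L\<close> by (intro floor_unique) (auto simp: mem_box_cart less_le)
    moreover have "(axis 2 0 :: real^2) = 0" by (simp add: vec_eq_iff axis_def)
    ultimately show ?thesis by (simp only: periodize_def of_int_0 mult_zero_right diff_zero)
  qed
  finally show "pderiv_dir i (periodize L \<phi>) x = pderiv_dir i \<phi> x" .
qed

lemma divfree_strip_test:
  assumes "0 < L" "divfree L u" "\<phi> \<in> strip_test L"
  shows "(\<integral>x. (\<Sum>i\<in>UNIV. u x $ i * pderiv_dir i \<phi> x) \<partial>dom_measure L) = 0"
proof -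
  obtain g where g: "g \<in> per_test L" "\<And>i x. x \<in> cbox 0 (\<chi> i. L) \<Longrightarrow> pderiv_dir i g x = pderiv_dir i \<phi> x"
    using strip_test_periodic_extension[OF assms(1,3)] by blast
  have "(\<integral>x. (\<Sum>i\<in>UNIV. u x $ i * pderiv_dir i \<phi> x) \<partial>dom_measure L)
      = (\<integral>x. (\<Sum>i\<in>UNIV. u x $ i * pderiv_dir i g x) \<partial>dom_measure L)"
    by (rule Bochner_Integration.integral_cong) (auto simp: g(2))
  then show ?thesis using assms(2) g(1) by (simp add: divfree_def)
qed

section \<open>Spectral calculus of the temperature operator\<close>

text \<open>Only an inequality is asked of the blocks, since the series of partial derivatives of
  the eigenfunctions offers no more: orthogonality of gradients holds for the sum over both
  directions, not for each one.\<close>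

lemma L2_series_converges:
  fixes e :: "nat \<Rightarrow> real^2 \<Rightarrow> real"
  assumes e: "\<And>j. e j \<in> L2 L" and s: "summable s"
    and bound: "\<And>m n. m \<le> n \<Longrightarrow> (L2_norm L (\<lambda>x. \<Sum>j\<in>{m..<n}. a j * e j x))\<^sup>2 \<le> (\<Sum>j\<in>{m..<n}. s j)"
  shows "\<exists>g\<in>L2 L. (\<lambda>n. L2_norm L (\<lambda>x. (\<Sum>j<n. a j * e j x) - g x)) \<longlonglongrightarrow> 0"
proof (rule L2_complete)
  show "(\<lambda>x. \<Sum>j<n. a j * e j x) \<in> L2 L" for n using e by (intro L2_sum L2_cmult)
  fix r :: real assume r: "0 < r"
  then obtain N where N: "\<And>m n. m \<ge> N \<Longrightarrow> norm (\<Sum>j\<in>{m..<n}. s j) < r\<^sup>2"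
    using s unfolding summable_Cauchy by (metis zero_less_power)
  have *: "L2_norm L (\<lambda>x. (\<Sum>j<n. a j * e j x) - (\<Sum>j<m. a j * e j x)) < r" if "N \<le> m" "m \<le> n" for m n
  proof -
    have "(\<Sum>j<n. a j * e j x) - (\<Sum>j<m. a j * e j x) = (\<Sum>j\<in>{m..<n}. a j * e j x)" for x
      using sum_diff_nat_ivl[of 0 m n "\<lambda>j. a j * e j x"] that by (simp add: atLeast0LessThan)
    moreover have "(L2_norm L (\<lambda>x. \<Sum>j\<in>{m..<n}. a j * e j x))\<^sup>2 < r\<^sup>2"
      using bound[OF that(2)] N[OF that(1), of n] by simp
    ultimately show ?thesis using r by (simp add: power_less_imp_less_base)
  qed
  show "\<exists>M. \<forall>m\<ge>M. \<forall>n\<ge>M. L2_norm L (\<lambda>x. (\<Sum>j<m. a j * e j x) - (\<Sum>j<n. a j * e j x)) < r"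
  proof (intro exI allI impI)
    fix m n assume "N \<le> m" "N \<le> n"
    then show "L2_norm L (\<lambda>x. (\<Sum>j<m. a j * e j x) - (\<Sum>j<n. a j * e j x)) < r"
      using *[of m n] *[of n m] L2_norm_minus_commute[of L "\<lambda>x. \<Sum>j<m. a j * e j x"]
      by (cases "m \<le> n") auto
  qed
qed

lemma has_wderiv_real:
  fixes f g :: "real^2 \<Rightarrow> real"
  shows "has_wderiv L K i f g \<longleftrightarrow>
    g \<in> L2 L \<and> (\<forall>\<phi>\<in>K. L2_inner L (pderiv_dir i \<phi>) f = - L2_inner L \<phi> g)"
  by (simp add: has_wderiv_def L2_inner_real)

lemma has_wderiv_wderiv: "has_wderiv L K i f g \<Longrightarrow> has_wderiv L K i f (wderiv L K i f)"
  unfolding wderiv_def by (rule someI[where P="has_wderiv L K i f"])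

lemma has_wderiv_cong_AE:
  fixes f f' g :: "real^2 \<Rightarrow> real"
  assumes "f \<in> L2 L" "f' \<in> L2 L" "AE x in dom_measure L. f x = f' x"
    and "has_wderiv L (strip_test L) i f g"
  shows "has_wderiv L (strip_test L) i f' g"
  unfolding has_wderiv_real
proof (intro conjI ballI)
  show "g \<in> L2 L" using assms(4) by (simp add: has_wderiv_real)
  fix \<phi> assume \<phi>: "\<phi> \<in> strip_test L"
  have "L2_inner L (pderiv_dir i \<phi>) f' = L2_inner L (pderiv_dir i \<phi>) f"
    using assms(1-3) strip_test_pderiv_L2[OF \<phi>] by (intro L2_inner_cong_AE) auto
  then show "L2_inner L (pderiv_dir i \<phi>) f' = - L2_inner L \<phi> g"
    using assms(4) \<phi> by (simp add: has_wderiv_real)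
qed

locale temp_basis =
  fixes L :: real and lam :: "nat \<Rightarrow> real" and \<zeta> :: "nat \<Rightarrow> real^2 \<Rightarrow> real"
  assumes L_pos: "0 < L" and eigensystem: "temp_eigensystem L lam \<zeta>"
begin

abbreviation "coef f j \<equiv> L2_inner L f (\<zeta> j)"
abbreviation "H1 \<equiv> Hsp L lam \<zeta> 1"
abbreviation "sqrtA \<equiv> op_power L lam \<zeta> (1/2)"
abbreviation "D \<equiv> wderiv L (strip_test L) :: 2 \<Rightarrow> (real^2 \<Rightarrow> real) \<Rightarrow> real^2 \<Rightarrow> real"

lemma lam_ge: "lam 0 \<le> lam j"
  using eigensystem by (auto simp: temp_eigensystem_def mono_def)

lemma lam_pos: "0 < lam j"
  using lam_ge[of j] eigensystem by (auto simp: temp_eigensystem_def)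

lemma zeta_L2: "\<zeta> j \<in> L2 L"
  using eigensystem by (auto simp: temp_eigensystem_def tempop_dom_def numeral_2_eq_2)

lemma zeta_orthonormal: "coef (\<zeta> i) j = (if i = j then 1 else 0)"
  using eigensystem by (auto simp: temp_eigensystem_def complete_ons_def)

lemma zeta_complete:
  "f \<in> L2 L \<Longrightarrow> (\<lambda>n. L2_norm L (\<lambda>x. (\<Sum>j<n. coef f j * \<zeta> j x) - f x)) \<longlonglongrightarrow> 0"
  using eigensystem by (subst L2_norm_minus_commute) (auto simp: temp_eigensystem_def complete_ons_def)

lemma partial_sum_L2: "(\<lambda>x. \<Sum>j\<in>I. a j * \<zeta> j x) \<in> L2 L"
  by (intro L2_sum L2_cmult zeta_L2)

lemma inner_partial_sum:
  "f \<in> L2 L \<Longrightarrow> L2_inner L (\<lambda>x. \<Sum>j\<in>I. a j * \<zeta> j x) f = (\<Sum>j\<in>I. a j * coef f j)"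
  by (simp add: L2_inner_sum_left L2_cmult zeta_L2 L2_inner_cmult_left L2_inner_commute[of L f])

lemma parseval:
  assumes "f \<in> L2 L" "g \<in> L2 L"
  shows "(\<lambda>j. coef f j * coef g j) sums L2_inner L f g"
  using L2_inner_tendsto[OF partial_sum_L2 assms zeta_complete[OF assms(1)]]
  by (simp add: sums_def inner_partial_sum assms)

lemma norm_sq_sums: "f \<in> L2 L \<Longrightarrow> (\<lambda>j. (coef f j)\<^sup>2) sums (L2_norm L f)\<^sup>2"
  unfolding L2_norm_sq using parseval[of f f] by (simp add: power2_eq_square)

lemma norm_partial_sum:
  assumes "finite I"
  shows "(L2_norm L (\<lambda>x. \<Sum>j\<in>I. a j * \<zeta> j x))\<^sup>2 = (\<Sum>j\<in>I. (a j)\<^sup>2)"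
proof -
  have "coef (\<lambda>x. \<Sum>k\<in>I. a k * \<zeta> k x) j = (if j \<in> I then a j else 0)" for j
    using assms by (simp add: inner_partial_sum zeta_L2 zeta_orthonormal if_distrib cong: if_cong)
  then show ?thesis
    unfolding L2_norm_sq by (simp add: inner_partial_sum partial_sum_L2 power2_eq_square)
qed

lemma coef_of_limit:
  assumes g: "g \<in> L2 L" and lim: "(\<lambda>n. L2_norm L (\<lambda>x. (\<Sum>j<n. a j * \<zeta> j x) - g x)) \<longlonglongrightarrow> 0"
  shows "coef g k = a k"
proof (rule LIMSEQ_unique)
  show "(\<lambda>n. coef (\<lambda>x. \<Sum>j<n. a j * \<zeta> j x) k) \<longlonglongrightarrow> coef g k"
    by (rule L2_inner_tendsto[OF partial_sum_L2 g zeta_L2 lim])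
  have "\<forall>\<^sub>F n in sequentially. a k = coef (\<lambda>x. \<Sum>j<n. a j * \<zeta> j x) k"
    using eventually_gt_at_top[of k]
    by eventually_elim (simp add: inner_partial_sum zeta_L2 zeta_orthonormal if_distrib cong: if_cong)
  then show "(\<lambda>n. coef (\<lambda>x. \<Sum>j<n. a j * \<zeta> j x) k) \<longlonglongrightarrow> a k"
    by (rule tendsto_eventually[OF eventually_mono]) simp
qed

lemma riesz_fischer:
  assumes "summable (\<lambda>j. (a j)\<^sup>2)"
  shows "\<exists>g\<in>L2 L. (\<lambda>n. L2_norm L (\<lambda>x. (\<Sum>j<n. a j * \<zeta> j x) - g x)) \<longlonglongrightarrow> 0"
  by (rule L2_series_converges[OF zeta_L2 assms]) (simp add: norm_partial_sum)

lemma Hsp_1_iff: "f \<in> H1 \<longleftrightarrow> f \<in> L2 L \<and> summable (\<lambda>j. lam j * (coef f j)\<^sup>2)"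
proof -
  have "(lam j powr (1/2) * coef f j)\<^sup>2 = lam j * (coef f j)\<^sup>2" for j
    using lam_pos[of j] by (simp add: power_mult_distrib powr_half_sqrt)
  then show ?thesis by (simp add: Hsp_def power_dom_def)
qed

lemma Hsp_1_L2: "f \<in> H1 \<Longrightarrow> f \<in> L2 L"
  unfolding Hsp_1_iff by blast

lemma op_power_Hsp:
  assumes "f \<in> H1"
  shows "sqrtA f \<in> L2 L"
    and "coef (sqrtA f) j = lam j powr (1/2) * coef f j"
proof -
  let ?a = "\<lambda>j. lam j powr (1/2) * coef f j"
  let ?g = "sqrtA f"
  have "summable (\<lambda>j. (?a j)\<^sup>2)" using assms by (simp add: Hsp_def power_dom_def)
  then have "\<exists>g. g \<in> L2 L \<and> (\<lambda>n. L2_norm L (\<lambda>x. g x - (\<Sum>j<n. ?a j * \<zeta> j x))) \<longlonglongrightarrow> 0"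
    using riesz_fischer[of ?a] by (subst L2_norm_minus_commute) blast
  then have "?g \<in> L2 L \<and> (\<lambda>n. L2_norm L (\<lambda>x. ?g x - (\<Sum>j<n. ?a j * \<zeta> j x))) \<longlonglongrightarrow> 0"
    unfolding op_power_def by (rule someI_ex)
  then show "?g \<in> L2 L" "coef ?g j = ?a j"
    using coef_of_limit[of ?g ?a] by (auto simp: L2_norm_minus_commute[of L ?g])
qed

lemma op_power_inner_sums:
  assumes "f \<in> H1" "g \<in> H1"
  shows "(\<lambda>j. lam j * (coef f j * coef g j)) sums
    L2_inner L (sqrtA f) (sqrtA g)"
proof -
  have *: "lam j powr (1/2) * coef f j * (lam j powr (1/2) * coef g j) = lam j * (coef f j * coef g j)" for j
    using lam_pos[of j] by (simp add: powr_half_sqrt algebra_simps flip: real_sqrt_mult)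
  show ?thesis
    using parseval[OF op_power_Hsp(1)[OF assms(1)] op_power_Hsp(1)[OF assms(2)]]
    unfolding op_power_Hsp(2)[OF assms(1)] op_power_Hsp(2)[OF assms(2)] * .
qed

lemma op_power_norm_sums:
  assumes "f \<in> H1"
  shows "(\<lambda>j. lam j * (coef f j)\<^sup>2) sums (L2_norm L (sqrtA f))\<^sup>2"
  unfolding L2_norm_sq using op_power_inner_sums[OF assms assms] by (simp add: power2_eq_square)

text \<open>Off \<open>H\<^sup>1\<close> the choice in \<open>op_power\<close> is made from the empty predicate, hence does not depend
  on the argument; this makes the norm below a measurable function on all of \<open>L\<^sup>2\<close>.\<close>

lemma op_power_not_Hsp:
  assumes "f \<in> L2 L" "f \<notin> H1"
  shows "sqrtA f = (SOME g. False)"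
proof -
  let ?a = "\<lambda>j. lam j powr (1/2) * coef f j"
  have "\<not> (g \<in> L2 L \<and> (\<lambda>n. L2_norm L (\<lambda>x. g x - (\<Sum>j<n. ?a j * \<zeta> j x))) \<longlonglongrightarrow> 0)" for g
  proof
    assume g: "g \<in> L2 L \<and> (\<lambda>n. L2_norm L (\<lambda>x. g x - (\<Sum>j<n. ?a j * \<zeta> j x))) \<longlonglongrightarrow> 0"
    then have "coef g j = ?a j" for j
      using coef_of_limit[of g ?a] by (simp add: L2_norm_minus_commute[of L g])
    then have "summable (\<lambda>j. (?a j)\<^sup>2)" using norm_sq_sums[of g] g by (auto simp: sums_iff)
    then show False using assms by (simp add: Hsp_def power_dom_def)
  qed
  then show ?thesis unfolding op_power_def by (intro arg_cong[where f=Eps] ext) blast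
qed

text \<open>Termwise comparison of the two Parseval series, \<open>lam 0\<close> being the least
  eigenvalue.\<close>

lemma poincare:
  assumes "f \<in> H1"
  shows "lam 0 * (L2_norm L f)\<^sup>2 \<le> (L2_norm L (sqrtA f))\<^sup>2"
proof (rule sums_le)
  show "(\<lambda>j. lam 0 * (coef f j)\<^sup>2) sums (lam 0 * (L2_norm L f)\<^sup>2)"
    by (intro sums_mult norm_sq_sums Hsp_1_L2 assms)
  show "(\<lambda>j. lam j * (coef f j)\<^sup>2) sums (L2_norm L (sqrtA f))\<^sup>2"
    by (rule op_power_norm_sums[OF assms])
qed (simp add: lam_ge mult_right_mono)

text \<open>Boundedness and convergence of every coefficient amount to weak convergence: X is
  replaced by a partial sum at a cost of e/4 uniformly in m, and the partial sum involves finitely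
  many coefficients. It serves for \<open>sqrtA\<close> of truncated temperatures, for which no
  strong convergence is established.\<close>

lemma weak_limit_inner:
  assumes X: "X \<in> L2 L" and Y: "\<And>m. Y m \<in> L2 L" and bd: "\<And>m. L2_norm L (Y m) \<le> c"
    and lim: "\<And>j. (\<lambda>m. coef (Y m) j) \<longlonglongrightarrow> coef X j"
  shows "(\<lambda>m. L2_inner L X (Y m)) \<longlonglongrightarrow> L2_inner L X X"
proof (rule LIMSEQ_I)
  fix e :: real assume e: "0 < e"
  define S where "S n x = (\<Sum>j<n. coef X j * \<zeta> j x)" for n x
  have S: "S n \<in> L2 L" for n unfolding S_def by (rule partial_sum_L2)
  \<comment> \<open>A common bound for the norms of \<open>X\<close> and of all \<open>Y m\<close>,
    made positive so that it can be divided by.\<close>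
  define B where "B = \<bar>c\<bar> + L2_norm L X + 1"
  have B: "0 < B" by (simp add: B_def add_nonneg_pos)
  have "(\<lambda>n. L2_norm L (\<lambda>x. S n x - X x)) \<longlonglongrightarrow> 0"
    using zeta_complete[OF X] by (simp add: S_def)
  then obtain n where n: "L2_norm L (\<lambda>x. S n x - X x) < e / 4 / B"
    using e B by (force dest!: LIMSEQ_D[of _ _ "e / 4 / B"])
  have Sn: "\<bar>L2_inner L X Z - L2_inner L (S n) Z\<bar> \<le> e / 4" if "Z \<in> L2 L" "L2_norm L Z \<le> B" for Z
  proof -
    have "\<bar>L2_inner L X Z - L2_inner L (S n) Z\<bar> = \<bar>L2_inner L (\<lambda>x. S n x - X x) Z\<bar>"
      using S X that by (simp add: L2_inner_diff_left)
    also have "\<dots> \<le> L2_norm L (\<lambda>x. S n x - X x) * L2_norm L Z"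
      using S X that by (intro L2_Cauchy_Schwarz) auto
    also have "\<dots> \<le> e / 4 / B * B" using n that(2) e B by (intro mult_mono) auto
    finally show ?thesis using B by simp
  qed
  have "(\<lambda>m. L2_inner L (S n) (Y m)) \<longlonglongrightarrow> L2_inner L (S n) X"
    unfolding S_def using X Y by (simp add: inner_partial_sum) (intro tendsto_intros lim)
  then obtain M where M: "\<And>m. m \<ge> M \<Longrightarrow> \<bar>L2_inner L (S n) (Y m) - L2_inner L (S n) X\<bar> < e / 4"
    using e by (force dest!: LIMSEQ_D[of _ _ "e / 4"])
  show "\<exists>no. \<forall>m\<ge>no. norm (L2_inner L X (Y m) - L2_inner L X X) < e"
  proof (intro exI allI impI)
    fix m assume "M \<le> m"
    have "L2_norm L (Y m) \<le> B" "L2_norm L X \<le> B"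
      using bd[of m] L2_norm_nonneg[of L X] unfolding B_def by linarith+
    then show "norm (L2_inner L X (Y m) - L2_inner L X X) < e"
      using M[OF \<open>M \<le> m\<close>] Sn[OF Y[of m]] Sn[OF X] e unfolding real_norm_def by linarith
  qed
qed

subsection \<open>Weak gradients\<close>

lemma zeta_approx:
  obtains \<phi> where "\<And>n::nat. \<phi> n \<in> strip_test L"
    "(\<lambda>n. L2_norm L (\<lambda>x. \<phi> n x - \<zeta> j x)) \<longlonglongrightarrow> 0"
    "\<And>i. (\<lambda>n. L2_norm L (\<lambda>x. pderiv_dir i (\<phi> n) x - D i (\<zeta> j) x)) \<longlonglongrightarrow> 0"
proof -
  have "vanishes_on_sides L (\<zeta> j)"
    using eigensystem by (auto simp: temp_eigensystem_def tempop_dom_def)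
  then show thesis using that unfolding vanishes_on_sides_def by blast
qed

text \<open>Completeness of the eigenfunctions, which are limits of test functions, replaces the
  fundamental lemma of the calculus of variations.\<close>

lemma orthogonal_strip_test_AE:
  assumes g: "g \<in> L2 L" and orth: "\<And>\<phi>. \<phi> \<in> strip_test L \<Longrightarrow> L2_inner L \<phi> g = 0"
  shows "AE x in dom_measure L. g x = 0"
proof -
  have "coef g j = 0" for j
  proof -
    obtain \<phi> where \<phi>: "\<And>n::nat. \<phi> n \<in> strip_test L"
      "(\<lambda>n. L2_norm L (\<lambda>x. \<phi> n x - \<zeta> j x)) \<longlonglongrightarrow> 0" by (rule zeta_approx[of j]) blast
    have "(\<lambda>n. L2_inner L (\<phi> n) g) \<longlonglongrightarrow> L2_inner L (\<zeta> j) g"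
      by (rule L2_inner_tendsto[OF strip_test_L2[OF \<phi>(1)] zeta_L2 g \<phi>(2)])
    then show ?thesis using orth[OF \<phi>(1)] by (simp add: LIMSEQ_const_iff L2_inner_commute[of L g])
  qed
  then have "(L2_norm L g)\<^sup>2 = 0" using norm_sq_sums[OF g] by (simp add: sums_iff)
  then show ?thesis using L2_norm_eq_0_AE[OF g] by simp
qed

lemma wderiv_unique:
  assumes "has_wderiv L (strip_test L) i f g" "has_wderiv L (strip_test L) i f g'"
  shows "AE x in dom_measure L. g x = (g' x :: real)"
proof -
  have g: "g \<in> L2 L" "g' \<in> L2 L" using assms by (auto simp: has_wderiv_real)
  have "AE x in dom_measure L. g x - g' x = 0"
  proof (rule orthogonal_strip_test_AE)
    fix \<phi> assume "\<phi> \<in> strip_test L"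
    then show "L2_inner L \<phi> (\<lambda>x. g x - g' x) = 0"
      using assms g strip_test_L2 by (subst L2_inner_diff_right) (auto simp: has_wderiv_real)
  qed (use g in auto)
  then show ?thesis by simp
qed

text \<open>Membership in the second Sobolev space yields a derivative of some first derivative, not
  of the chosen one \<open>D i\<close>; uniqueness almost everywhere transfers it.\<close>

lemma zeta_wderiv:
  "has_wderiv L (strip_test L) i (\<zeta> j) (D i (\<zeta> j))"
  "has_wderiv L (strip_test L) i (D i (\<zeta> j)) (D i (D i (\<zeta> j)))"
proof -
  have "\<zeta> j \<in> sobolev L (strip_test L) 2"
    using eigensystem by (auto simp: temp_eigensystem_def tempop_dom_def)
  then obtain g g' where g: "g \<in> L2 L" "has_wderiv L (strip_test L) i (\<zeta> j) g"
    "has_wderiv L (strip_test L) i g g'"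
    by (auto simp: numeral_2_eq_2) metis
  show 1: "has_wderiv L (strip_test L) i (\<zeta> j) (D i (\<zeta> j))" using g(2) by (rule has_wderiv_wderiv)
  have "has_wderiv L (strip_test L) i (D i (\<zeta> j)) g'"
    using 1 g by (intro has_wderiv_cong_AE[OF _ _ wderiv_unique[OF g(2) 1] g(3)]) (auto simp: has_wderiv_real)
  then show "has_wderiv L (strip_test L) i (D i (\<zeta> j)) (D i (D i (\<zeta> j)))"
    by (rule has_wderiv_wderiv)
qed

lemma D_zeta_L2: "D i (\<zeta> j) \<in> L2 L"
  using zeta_wderiv(1) by (simp add: has_wderiv_real)

text \<open>Weak form of the eigenvalue equation: testing the second weak derivatives of the
  eigenfunction with \<phi> moves one derivative onto \<phi>.\<close>

lemma grad_inner_strip_test: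
  assumes \<phi>: "\<phi> \<in> strip_test L"
  shows "(\<Sum>i\<in>UNIV. L2_inner L (pderiv_dir i \<phi>) (D i (\<zeta> j))) = lam j * coef \<phi> j"
proof -
  have DD: "D i (D i (\<zeta> j)) \<in> L2 L" for i using zeta_wderiv(2) by (simp add: has_wderiv_real)
  have \<phi>2: "\<phi> \<in> L2 L" by (rule strip_test_L2[OF \<phi>])
  have tm: "tempop L (\<zeta> j) = (\<lambda>x. (-1) * (\<Sum>i\<in>UNIV. D i (D i (\<zeta> j)) x))"
    by (simp add: fun_eq_iff tempop_def wlaplacian_def)
  have t2: "tempop L (\<zeta> j) \<in> L2 L" unfolding tm by (intro L2_cmult L2_sum DD)
  have "(\<Sum>i\<in>UNIV. L2_inner L (pderiv_dir i \<phi>) (D i (\<zeta> j))) = - (\<Sum>i\<in>UNIV. L2_inner L \<phi> (D i (D i (\<zeta> j))))"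
    using zeta_wderiv(2) \<phi> by (simp add: has_wderiv_real sum_negf)
  also have "\<dots> = L2_inner L \<phi> (tempop L (\<zeta> j))"
    unfolding tm by (simp only: L2_inner_cmult_right L2_inner_sum_right[OF DD \<phi>2])
  also have "\<dots> = L2_inner L \<phi> (\<lambda>x. lam j * \<zeta> j x)"
    using eigensystem \<phi>2 t2 zeta_L2
    by (intro L2_inner_cong_AE) (auto simp: temp_eigensystem_def)
  also have "\<dots> = lam j * coef \<phi> j" by (rule L2_inner_cmult_right)
  finally show ?thesis .
qed

text \<open>The weak eigenvalue equation is closed under convergence of \<phi> together with its
  gradient, so \<open>\<zeta> k\<close> itself may be inserted.\<close>

lemma grad_inner_zeta:
  "(\<Sum>i\<in>UNIV. L2_inner L (D i (\<zeta> k)) (D i (\<zeta> j))) = (if k = j then lam j else 0)"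
proof -
  obtain \<phi> where \<phi>: "\<And>n::nat. \<phi> n \<in> strip_test L"
    "(\<lambda>n. L2_norm L (\<lambda>x. \<phi> n x - \<zeta> k x)) \<longlonglongrightarrow> 0"
    "\<And>i. (\<lambda>n. L2_norm L (\<lambda>x. pderiv_dir i (\<phi> n) x - D i (\<zeta> k) x)) \<longlonglongrightarrow> 0" by (rule zeta_approx[of k]) blast
  have "(\<lambda>n. \<Sum>i\<in>UNIV. L2_inner L (pderiv_dir i (\<phi> n)) (D i (\<zeta> j)))
      \<longlonglongrightarrow> (\<Sum>i\<in>UNIV. L2_inner L (D i (\<zeta> k)) (D i (\<zeta> j)))"
    using strip_test_pderiv_L2[OF \<phi>(1)] D_zeta_L2 \<phi>(3)
    by (intro tendsto_sum L2_inner_tendsto) auto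
  moreover have "(\<lambda>n. lam j * coef (\<phi> n) j) \<longlonglongrightarrow> lam j * coef (\<zeta> k) j"
    by (intro tendsto_mult_left L2_inner_tendsto[OF strip_test_L2[OF \<phi>(1)] zeta_L2 zeta_L2 \<phi>(2)])
  ultimately have "(\<Sum>i\<in>UNIV. L2_inner L (D i (\<zeta> k)) (D i (\<zeta> j))) = lam j * coef (\<zeta> k) j"
    using LIMSEQ_unique by (simp add: grad_inner_strip_test[OF \<phi>(1)])
  then show ?thesis by (simp add: zeta_orthonormal)
qed

lemma D_sum_L2: "(\<lambda>x. \<Sum>j\<in>I. a j * D i (\<zeta> j) x) \<in> L2 L"
  by (intro L2_sum L2_cmult D_zeta_L2)

lemma grad_norm_partial_sum:
  assumes "finite I"
  shows "(\<Sum>i\<in>UNIV. (L2_norm L (\<lambda>x. \<Sum>j\<in>I. a j * D i (\<zeta> j) x))\<^sup>2) = (\<Sum>j\<in>I. lam j * (a j)\<^sup>2)"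
proof -
  have "(L2_norm L (\<lambda>x. \<Sum>j\<in>I. a j * D i (\<zeta> j) x))\<^sup>2
      = (\<Sum>k\<in>I. a k * (\<Sum>j\<in>I. a j * L2_inner L (D i (\<zeta> k)) (D i (\<zeta> j))))" for i
    unfolding L2_norm_sq
    by (simp add: L2_inner_sum_left L2_inner_sum_right L2_inner_cmult_left L2_inner_cmult_right
        L2_cmult D_zeta_L2 D_sum_L2)
  then have "(\<Sum>i\<in>UNIV. (L2_norm L (\<lambda>x. \<Sum>j\<in>I. a j * D i (\<zeta> j) x))\<^sup>2)
      = (\<Sum>k\<in>I. a k * (\<Sum>j\<in>I. a j * (\<Sum>i\<in>UNIV. L2_inner L (D i (\<zeta> k)) (D i (\<zeta> j)))))"
    by (simp add: sum.swap[of _ _ UNIV] flip: sum_distrib_left)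
  also have "\<dots> = (\<Sum>j\<in>I. lam j * (a j)\<^sup>2)"
    using assms by (simp add: grad_inner_zeta if_distrib power2_eq_square ac_simps cong: if_cong)
  finally show ?thesis .
qed

text \<open>Bessel's inequality for gradients. With H the gradient of the partial expansion, the
  pairing of H with the gradient of \<phi> equals the square of its norm, and expanding the squared
  distance between the two gives the bound.\<close>

lemma bessel_strip_test:
  assumes \<phi>: "\<phi> \<in> strip_test L" and "finite I"
  shows "(\<Sum>j\<in>I. lam j * (coef \<phi> j)\<^sup>2) \<le> (\<Sum>i\<in>UNIV. (L2_norm L (pderiv_dir i \<phi>))\<^sup>2)"
proof -
  define H where "H i x = (\<Sum>j\<in>I. coef \<phi> j * D i (\<zeta> j) x)" for i x
  have H: "H i \<in> L2 L" for i unfolding H_def by (rule D_sum_L2)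
  have P: "pderiv_dir i \<phi> \<in> L2 L" for i by (rule strip_test_pderiv_L2[OF \<phi>])
  have "(\<Sum>i\<in>UNIV. L2_inner L (pderiv_dir i \<phi>) (H i))
      = (\<Sum>i\<in>UNIV. \<Sum>j\<in>I. coef \<phi> j * L2_inner L (pderiv_dir i \<phi>) (D i (\<zeta> j)))"
    unfolding H_def
    by (simp add: L2_inner_sum_right L2_inner_cmult_right L2_cmult D_zeta_L2 P)
  also have "\<dots> = (\<Sum>j\<in>I. coef \<phi> j * (\<Sum>i\<in>UNIV. L2_inner L (pderiv_dir i \<phi>) (D i (\<zeta> j))))"
    by (subst sum.swap) (simp add: sum_distrib_left)
  also have "\<dots> = (\<Sum>j\<in>I. lam j * (coef \<phi> j)\<^sup>2)"
    by (simp add: grad_inner_strip_test[OF \<phi>] power2_eq_square ac_simps)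
  finally have PH: "(\<Sum>i\<in>UNIV. L2_inner L (pderiv_dir i \<phi>) (H i)) = (\<Sum>j\<in>I. lam j * (coef \<phi> j)\<^sup>2)" .
  have "0 \<le> (\<Sum>i\<in>UNIV. L2_inner L (\<lambda>x. pderiv_dir i \<phi> x - H i x) (\<lambda>x. pderiv_dir i \<phi> x - H i x))"
    by (intro sum_nonneg) simp
  also have "\<dots> = (\<Sum>i\<in>UNIV. (L2_norm L (pderiv_dir i \<phi>))\<^sup>2)
      - 2 * (\<Sum>i\<in>UNIV. L2_inner L (pderiv_dir i \<phi>) (H i)) + (\<Sum>i\<in>UNIV. (L2_norm L (H i))\<^sup>2)"
    using P H by (simp add: L2_inner_self_diff L2_norm_sq sum.distrib sum_subtractf sum_distrib_left)
  also have "(\<Sum>i\<in>UNIV. (L2_norm L (H i))\<^sup>2) = (\<Sum>j\<in>I. lam j * (coef \<phi> j)\<^sup>2)"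
    unfolding H_def by (rule grad_norm_partial_sum[OF assms(2)])
  finally show ?thesis using PH by simp
qed

text \<open>The bridge from the spectral space to weak derivatives. Partial sums of the expansion
  are Cauchy together with their gradients, and each is a finite combination of eigenfunctions,
  hence approximable by test functions; a diagonal choice joins the two limits.\<close>

lemma Hsp_approx:
  assumes f: "f \<in> H1"
  obtains \<phi> where "\<And>n::nat. \<phi> n \<in> strip_test L"
    "(\<lambda>n. L2_norm L (\<lambda>x. \<phi> n x - f x)) \<longlonglongrightarrow> 0"
    "\<And>i. D i f \<in> L2 L"
    "\<And>i. (\<lambda>n. L2_norm L (\<lambda>x. pderiv_dir i (\<phi> n) x - D i f x)) \<longlonglongrightarrow> 0"
    "AE x in dom_measure L. (\<lambda>n. \<phi> n x) \<longlonglongrightarrow> f x"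
proof -
  have f2: "f \<in> L2 L" and sm: "summable (\<lambda>j. lam j * (coef f j)\<^sup>2)" using f unfolding Hsp_1_iff by auto
  define S where "S n x = (\<Sum>j<n. coef f j * \<zeta> j x)" for n x
  define G where "G n i x = (\<Sum>j<n. coef f j * D i (\<zeta> j) x)" for n i x
  have S: "S n \<in> L2 L" for n unfolding S_def by (rule partial_sum_L2)
  have G: "G n i \<in> L2 L" for n i unfolding G_def by (rule D_sum_L2)
  have S_lim: "(\<lambda>n. L2_norm L (\<lambda>x. S n x - f x)) \<longlonglongrightarrow> 0" using zeta_complete[OF f2] by (simp add: S_def)
  have "\<exists>g\<in>L2 L. (\<lambda>n. L2_norm L (\<lambda>x. G n i x - g x)) \<longlonglongrightarrow> 0" for i
    unfolding G_def
  proof (rule L2_series_converges[OF D_zeta_L2 sm])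
    fix m n :: nat
    have "(L2_norm L (\<lambda>x. \<Sum>j\<in>{m..<n}. coef f j * D i (\<zeta> j) x))\<^sup>2
        \<le> (\<Sum>i\<in>UNIV. (L2_norm L (\<lambda>x. \<Sum>j\<in>{m..<n}. coef f j * D i (\<zeta> j) x))\<^sup>2)"
      by (rule member_le_sum) auto
    then show "(L2_norm L (\<lambda>x. \<Sum>j\<in>{m..<n}. coef f j * D i (\<zeta> j) x))\<^sup>2 \<le> (\<Sum>j\<in>{m..<n}. lam j * (coef f j)\<^sup>2)"
      by (simp add: grad_norm_partial_sum)
  qed
  then have "\<exists>g. \<forall>i. g i \<in> L2 L \<and> (\<lambda>n. L2_norm L (\<lambda>x. G n i x - g i x)) \<longlonglongrightarrow> 0"
    by (intro choice allI) blast
  then obtain g where g: "\<And>i. g i \<in> L2 L" and g_lim: "\<And>i. (\<lambda>n. L2_norm L (\<lambda>x. G n i x - g i x)) \<longlonglongrightarrow> 0"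
    by blast
  \<comment> \<open>Closedness of the weak derivative: the defining identity holds for the partial
    sums and both sides converge.\<close>
  have hg: "has_wderiv L (strip_test L) i f (g i)" for i
    unfolding has_wderiv_real
  proof (intro conjI ballI)
    fix \<psi> assume \<psi>: "\<psi> \<in> strip_test L"
    have "L2_inner L (pderiv_dir i \<psi>) (S n) = - L2_inner L \<psi> (G n i)" for n
      unfolding S_def G_def
      using strip_test_pderiv_L2[OF \<psi>] strip_test_L2[OF \<psi>] zeta_L2 D_zeta_L2 zeta_wderiv(1) \<psi>
      by (simp add: L2_inner_sum_right L2_inner_cmult_right L2_cmult has_wderiv_real sum_negf)
    then have "L2_inner L (S n) (pderiv_dir i \<psi>) = - L2_inner L (G n i) \<psi>" for n
      by (simp add: L2_inner_commute)
    moreover have "(\<lambda>n. L2_inner L (S n) (pderiv_dir i \<psi>)) \<longlonglongrightarrow> L2_inner L f (pderiv_dir i \<psi>)"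
      by (rule L2_inner_tendsto[OF S f2 strip_test_pderiv_L2[OF \<psi>] S_lim])
    moreover have "(\<lambda>n. - L2_inner L (G n i) \<psi>) \<longlonglongrightarrow> - L2_inner L (g i) \<psi>"
      by (intro tendsto_minus L2_inner_tendsto[OF G g strip_test_L2[OF \<psi>] g_lim])
    ultimately have "L2_inner L f (pderiv_dir i \<psi>) = - L2_inner L (g i) \<psi>"
      using LIMSEQ_unique by simp
    then show "L2_inner L (pderiv_dir i \<psi>) f = - L2_inner L \<psi> (g i)" by (simp add: L2_inner_commute)
  qed (rule g)
  have hD: "has_wderiv L (strip_test L) i f (D i f)" for i by (rule has_wderiv_wderiv[OF hg])
  have Df: "D i f \<in> L2 L" for i using hD by (simp add: has_wderiv_real)
  \<comment> \<open>\<open>D i f\<close> is an unspecified choice of weak derivative, known to agree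
    with \<open>g i\<close> only almost everywhere.\<close>
  have D_lim: "(\<lambda>n. L2_norm L (\<lambda>x. G n i x - D i f x)) \<longlonglongrightarrow> 0" for i
  proof -
    have ae: "AE x in dom_measure L. g i x = D i f x" by (rule wderiv_unique[OF hg hD])
    have "L2_norm L (\<lambda>x. G n i x - D i f x) = L2_norm L (\<lambda>x. G n i x - g i x)" for n
      unfolding L2_norm_def using ae G g Df
      by (intro arg_cong[where f=sqrt] L2_inner_cong_AE) auto
    then show ?thesis using g_lim by simp
  qed
  \<comment> \<open>One test function has to approximate the partial sum and both its derivatives at
    once; since the directions are finitely many, a common index exists.\<close>
  have ex: "\<exists>\<phi>. \<phi> \<in> strip_test L \<and> L2_norm L (\<lambda>x. \<phi> x - S n x) < 1 / real (Suc n) \<and>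
      (\<forall>i. L2_norm L (\<lambda>x. pderiv_dir i \<phi> x - G n i x) < 1 / real (Suc n))" for n
  proof -
    have "\<exists>p. (\<forall>m::nat. p m \<in> strip_test L) \<and> (\<lambda>m. L2_norm L (\<lambda>x. p m x - \<zeta> j x)) \<longlonglongrightarrow> 0 \<and>
       (\<forall>i. (\<lambda>m. L2_norm L (\<lambda>x. pderiv_dir i (p m) x - D i (\<zeta> j) x)) \<longlonglongrightarrow> 0)" for j
      by (rule zeta_approx[of j]) blast
    then have "\<exists>p. \<forall>j. (\<forall>m::nat. p j m \<in> strip_test L) \<and>
       (\<lambda>m. L2_norm L (\<lambda>x. p j m x - \<zeta> j x)) \<longlonglongrightarrow> 0 \<and>
       (\<forall>i. (\<lambda>m. L2_norm L (\<lambda>x. pderiv_dir i (p j m) x - D i (\<zeta> j) x)) \<longlonglongrightarrow> 0)"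
      by (rule choice[OF allI])
    then obtain p where p: "\<And>j m. p j (m::nat) \<in> strip_test L"
      "\<And>j. (\<lambda>m. L2_norm L (\<lambda>x. p j m x - \<zeta> j x)) \<longlonglongrightarrow> 0"
      "\<And>j i. (\<lambda>m. L2_norm L (\<lambda>x. pderiv_dir i (p j m) x - D i (\<zeta> j) x)) \<longlonglongrightarrow> 0"
      by blast
    define c where "c j = coef f j" for j
    define q where "q m x = (\<Sum>j<n. c j * p j m x)" for m x
    have q: "q m \<in> strip_test L" for m unfolding q_def using p(1) by (rule strip_test_sum)
    have lin: "(\<lambda>m. L2_norm L (\<lambda>x. (\<Sum>j<n. c j * a j m x) - (\<Sum>j<n. c j * b j x))) \<longlonglongrightarrow> 0"
      if a: "\<And>j m. a j m \<in> L2 L" "\<And>j. b j \<in> L2 L"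
        and l: "\<And>j. (\<lambda>m. L2_norm L (\<lambda>x. a j m x - b j x)) \<longlonglongrightarrow> 0"
      for a :: "nat \<Rightarrow> nat \<Rightarrow> real^2 \<Rightarrow> real" and b
    proof -
      have le: "L2_norm L (\<lambda>x. (\<Sum>j<k. c j * a j m x) - (\<Sum>j<k. c j * b j x))
          \<le> (\<Sum>j<k. \<bar>c j\<bar> * L2_norm L (\<lambda>x. a j m x - b j x))" for m k
      proof (induction k)
        case (Suc k)
        let ?A = "\<lambda>x. (\<Sum>j<k. c j * a j m x) - (\<Sum>j<k. c j * b j x)"
        have "L2_norm L (\<lambda>x. (\<Sum>j<Suc k. c j * a j m x) - (\<Sum>j<Suc k. c j * b j x))
            = L2_norm L (\<lambda>x. ?A x + c k * (a k m x - b k x))"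
          by (simp add: algebra_simps)
        also have "\<dots> \<le> L2_norm L ?A + L2_norm L (\<lambda>x. c k * (a k m x - b k x))"
          using a by (intro L2_norm_triangle L2_diff L2_sum L2_cmult) auto
        finally show ?case using Suc by (simp add: L2_norm_cmult)
      qed (simp add: L2_norm_def L2_inner_real)
      have "(\<lambda>m. \<Sum>j<n. \<bar>c j\<bar> * L2_norm L (\<lambda>x. a j m x - b j x)) \<longlonglongrightarrow> (\<Sum>j<n. \<bar>c j\<bar> * 0)"
        by (intro tendsto_intros l)
      then have "(\<lambda>m. \<Sum>j<n. \<bar>c j\<bar> * L2_norm L (\<lambda>x. a j m x - b j x)) \<longlonglongrightarrow> 0" by simp
      then show ?thesis by (rule Lim_null_comparison[rotated]) (simp add: le)
    qed
    have l1: "(\<lambda>m. L2_norm L (\<lambda>x. q m x - S n x)) \<longlonglongrightarrow> 0"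
      unfolding q_def S_def c_def[symmetric] by (intro lin strip_test_L2[OF p(1)] zeta_L2 p(2))
    have l2: "(\<lambda>m. L2_norm L (\<lambda>x. pderiv_dir i (q m) x - G n i x)) \<longlonglongrightarrow> 0" for i
    proof -
      have "pderiv_dir i (q m) = (\<lambda>x. \<Sum>j<n. c j * pderiv_dir i (p j m) x)" for m
        unfolding q_def using p(1) by (intro ext pderiv_dir_sum) (auto intro: smooth_strip_test)
      then show ?thesis
        unfolding G_def c_def[symmetric]
        by (simp only:) (intro lin strip_test_pderiv_L2[OF p(1)] D_zeta_L2 p(3))
    qed
    have "\<forall>\<^sub>F m in sequentially. L2_norm L (\<lambda>x. q m x - S n x) < 1 / real (Suc n) \<and>
      (\<forall>i. L2_norm L (\<lambda>x. pderiv_dir i (q m) x - G n i x) < 1 / real (Suc n))"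
      using l1 l2 by (intro eventually_conj eventually_all_finite order_tendstoD(2)) auto
    then obtain m where "L2_norm L (\<lambda>x. q m x - S n x) < 1 / real (Suc n) \<and>
      (\<forall>i. L2_norm L (\<lambda>x. pderiv_dir i (q m) x - G n i x) < 1 / real (Suc n))"
      using eventually_happens' trivial_limit_sequentially by blast
    then show ?thesis using q by blast
  qed
  have "\<exists>\<phi>. \<forall>n. \<phi> n \<in> strip_test L \<and> L2_norm L (\<lambda>x. \<phi> n x - S n x) < 1 / real (Suc n) \<and>
      (\<forall>i. L2_norm L (\<lambda>x. pderiv_dir i (\<phi> n) x - G n i x) < 1 / real (Suc n))"
    by (intro choice allI ex)
  then obtain \<phi> where \<phi>: "\<And>n. \<phi> n \<in> strip_test L" "\<And>n. L2_norm L (\<lambda>x. \<phi> n x - S n x) < 1 / real (Suc n)"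
    "\<And>n i. L2_norm L (\<lambda>x. pderiv_dir i (\<phi> n) x - G n i x) < 1 / real (Suc n)"
    by blast
  have inv: "(\<lambda>n. 1 / real (Suc n)) \<longlonglongrightarrow> 0" using LIMSEQ_inverse_real_of_nat by (simp add: inverse_eq_divide)
  have p1: "(\<lambda>n. L2_norm L (\<lambda>x. \<phi> n x - f x)) \<longlonglongrightarrow> 0"
  proof (rule Lim_null_comparison)
    show "\<forall>\<^sub>F n in sequentially. norm (L2_norm L (\<lambda>x. \<phi> n x - f x))
        \<le> 1 / real (Suc n) + L2_norm L (\<lambda>x. S n x - f x)"
      proof (intro always_eventually allI)
      fix n
      show "norm (L2_norm L (\<lambda>x. \<phi> n x - f x))
        \<le> 1 / real (Suc n) + L2_norm L (\<lambda>x. S n x - f x)"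
        using L2_norm_triangle_diff[OF strip_test_L2[OF \<phi>(1)[of n]] S[of n] f2] \<phi>(2)[of n]
        by simp
    qed
    show "(\<lambda>n. 1 / real (Suc n) + L2_norm L (\<lambda>x. S n x - f x)) \<longlonglongrightarrow> 0"
      using tendsto_add[OF inv S_lim] by simp
  qed
  have p2: "(\<lambda>n. L2_norm L (\<lambda>x. pderiv_dir i (\<phi> n) x - D i f x)) \<longlonglongrightarrow> 0" for i
  proof (rule Lim_null_comparison)
    show "\<forall>\<^sub>F n in sequentially. norm (L2_norm L (\<lambda>x. pderiv_dir i (\<phi> n) x - D i f x))
        \<le> 1 / real (Suc n) + L2_norm L (\<lambda>x. G n i x - D i f x)"
      proof (intro always_eventually allI)
      fix n
      show "norm (L2_norm L (\<lambda>x. pderiv_dir i (\<phi> n) x - D i f x))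
        \<le> 1 / real (Suc n) + L2_norm L (\<lambda>x. G n i x - D i f x)"
        using L2_norm_triangle_diff[OF strip_test_pderiv_L2[OF \<phi>(1)[of n], of i] G[of n i] Df[of i]] \<phi>(3)[where n=n and i=i]
        by simp
    qed
    show "(\<lambda>n. 1 / real (Suc n) + L2_norm L (\<lambda>x. G n i x - D i f x)) \<longlonglongrightarrow> 0"
      using tendsto_add[OF inv D_lim] by simp
  qed
  \<comment> \<open>The norm limits survive on every subsequence, so thinning out for pointwise
    convergence costs nothing.\<close>
  obtain r :: "nat \<Rightarrow> nat" where r: "strict_mono r"
    "AE x in dom_measure L. (\<lambda>n. \<phi> (r n) x) \<longlonglongrightarrow> f x"
    using L2_AE_subseq[OF strip_test_L2[OF \<phi>(1)] f2 p1] by blast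
  show thesis
  proof (rule that[of "\<lambda>n. \<phi> (r n)"])
    show "(\<lambda>n. L2_norm L (\<lambda>x. \<phi> (r n) x - f x)) \<longlonglongrightarrow> 0"
      using LIMSEQ_subseq_LIMSEQ[OF p1 r(1)] by (simp add: o_def)
    show "(\<lambda>n. L2_norm L (\<lambda>x. pderiv_dir i (\<phi> (r n)) x - D i f x)) \<longlonglongrightarrow> 0" for i
      using LIMSEQ_subseq_LIMSEQ[OF p2 r(1)] by (simp add: o_def)
  qed (use \<phi>(1) Df r(2) in auto)
qed

end

section \<open>The energy identity\<close>

text \<open>The advection term need not be integrable against \<open>\<theta>\<close> itself, so the scheme is tested with
  the bounded functions \<open>M sin (\<theta>/M)\<close>, and \<open>M\<close> tends to infinity.\<close>

definition sin_trunc :: "real \<Rightarrow> real \<Rightarrow> real" where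
  "sin_trunc M s = M * sin (s / M)"

lemma sin_trunc_measurable [measurable]: "sin_trunc M \<in> borel_measurable borel"
  unfolding sin_trunc_def by measurable

lemma sin_trunc_le_bound: "0 < M \<Longrightarrow> \<bar>sin_trunc M s\<bar> \<le> M"
  by (simp add: sin_trunc_def abs_mult mult_left_le)

lemma sin_trunc_lipschitz:
  assumes "0 < M"
  shows "\<bar>sin_trunc M s - sin_trunc M t\<bar> \<le> \<bar>s - t\<bar>"
proof -
  have "\<bar>sin (s / M) - sin (t / M)\<bar> = 2 * \<bar>sin ((s / M - t / M) / 2)\<bar> * \<bar>cos ((s / M + t / M) / 2)\<bar>"
    by (simp add: sin_diff_sin abs_mult)
  also have "\<dots> \<le> 2 * \<bar>(s / M - t / M) / 2\<bar> * 1"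
    by (intro mult_mono abs_sin_x_le_abs_x) auto
  also have "\<dots> = \<bar>s - t\<bar> / M" using assms by (simp add: diff_divide_distrib[symmetric])
  finally have "M * \<bar>sin (s / M) - sin (t / M)\<bar> \<le> \<bar>s - t\<bar>" using assms by (simp add: field_simps)
  then show ?thesis using assms by (simp add: sin_trunc_def abs_mult flip: right_diff_distrib)
qed

lemma sin_trunc_le: "0 < M \<Longrightarrow> \<bar>sin_trunc M s\<bar> \<le> \<bar>s\<bar>"
  using sin_trunc_lipschitz[of M s 0] by (simp add: sin_trunc_def)

lemma sin_trunc_tendsto: "(\<lambda>m. sin_trunc (real (Suc m)) s) \<longlonglongrightarrow> s"
proof (rule LIM_zero_cancel, rule Lim_null_comparison)
  show "(\<lambda>m. s\<^sup>2 / 2 * (1 / real (Suc m))) \<longlonglongrightarrow> 0"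
    using tendsto_mult[OF tendsto_const LIMSEQ_inverse_real_of_nat, of "s\<^sup>2 / 2"]
    unfolding inverse_eq_divide mult_zero_right .
  have "\<bar>sin_trunc M s - s\<bar> \<le> s\<^sup>2 / 2 * (1 / M)" if "0 < M" for M
  proof -
    \<comment> \<open>Taylor remainder of order two; after multiplication by M the error is
      s^2/(2M).\<close>
    have "\<bar>sin (s / M) - s / M\<bar> \<le> (s / M)\<^sup>2 / 2"
      using Maclaurin_sin_bound[of "s / M" 2]
      by (simp add: numeral_2_eq_2 lessThan_Suc sin_coeff_def fact_numeral)
    then have "M * \<bar>sin (s / M) - s / M\<bar> \<le> M * ((s / M)\<^sup>2 / 2)" using that by (intro mult_left_mono) auto
    moreover have "M * \<bar>sin (s / M) - s / M\<bar> = \<bar>sin_trunc M s - s\<bar>"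
      using that by (simp add: sin_trunc_def abs_mult_pos' right_diff_distrib)
    ultimately show ?thesis using that by (simp add: power2_eq_square)
  qed
  then show "\<forall>\<^sub>F m in sequentially. norm (sin_trunc (real (Suc m)) s - s) \<le> s\<^sup>2 / 2 * (1 / real (Suc m))"
    unfolding real_norm_def by (intro always_eventually allI) (simp only: of_nat_0_less_iff zero_less_Suc)
qed

lemma sin_trunc_L2:
  assumes "0 < M" "f \<in> L2 L"
  shows "(\<lambda>x. sin_trunc M (f x)) \<in> L2 L"
  using assms by (intro L2_bound[OF assms(2), of _ 1]) (auto simp: sin_trunc_le)

lemma sin_trunc_L2_tendsto:
  assumes "0 < M" and f: "\<And>n. f n \<in> L2 L" "g \<in> L2 L"
    and lim: "(\<lambda>n. L2_norm L (\<lambda>x. f n x - g x)) \<longlonglongrightarrow> 0"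
  shows "(\<lambda>n. L2_norm L (\<lambda>x. sin_trunc M (f n x) - sin_trunc M (g x))) \<longlonglongrightarrow> 0"
proof (rule Lim_null_comparison[OF _ lim], intro always_eventually allI)
  fix n
  have "L2_norm L (\<lambda>x. sin_trunc M (f n x) - sin_trunc M (g x)) \<le> L2_norm L (\<lambda>x. f n x - g x)"
    using assms by (intro L2_norm_mono L2_diff sin_trunc_L2 sin_trunc_lipschitz) auto
  then show "norm (L2_norm L (\<lambda>x. sin_trunc M (f n x) - sin_trunc M (g x))) \<le> L2_norm L (\<lambda>x. f n x - g x)"
    by simp
qed

lemma sin_trunc_L2_limit:
  assumes f: "f \<in> L2 L"
  shows "(\<lambda>m. L2_norm L (\<lambda>x. sin_trunc (real (Suc m)) (f x) - f x)) \<longlonglongrightarrow> 0"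
proof -
  note [measurable] = L2_measurable[OF f]
  have "(\<lambda>m. \<integral>x. (sin_trunc (real (Suc m)) (f x) - f x)\<^sup>2 \<partial>dom_measure L) \<longlonglongrightarrow> (\<integral>x. 0 \<partial>dom_measure L)"
  proof (rule integral_dominated_convergence[where w="\<lambda>x. 4 * (f x)\<^sup>2"])
    show "integrable (dom_measure L) (\<lambda>x. 4 * (f x)\<^sup>2)" using L2_square_integrable[OF f] by simp
    show "AE x in dom_measure L. (\<lambda>m. (sin_trunc (real (Suc m)) (f x) - f x)\<^sup>2) \<longlonglongrightarrow> 0"
      using tendsto_power[OF LIM_zero[OF sin_trunc_tendsto], of _ 2] by simp
    have "(sin_trunc (real (Suc m)) s - s)\<^sup>2 \<le> 4 * s\<^sup>2" for m s
    proof -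
      have "\<bar>sin_trunc (real (Suc m)) s - s\<bar> \<le> 2 * \<bar>s\<bar>" using sin_trunc_le[of "real (Suc m)" s] by linarith
      then have "\<bar>sin_trunc (real (Suc m)) s - s\<bar>\<^sup>2 \<le> (2 * \<bar>s\<bar>)\<^sup>2" by (intro power_mono) auto
      then show ?thesis by (simp add: power_mult_distrib)
    qed
    then show "AE x in dom_measure L. norm ((sin_trunc (real (Suc m)) (f x) - f x)\<^sup>2) \<le> 4 * (f x)\<^sup>2" for m
      by simp
  qed measurable
  then have "(\<lambda>m. sqrt (\<integral>x. (sin_trunc (real (Suc m)) (f x) - f x)\<^sup>2 \<partial>dom_measure L)) \<longlonglongrightarrow> sqrt 0"
    by (intro tendsto_real_sqrt) simp
  then show ?thesis by (simp add: L2_norm_def L2_inner_real power2_eq_square)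
qed

lemma L2_component:
  fixes u :: "real^2 \<Rightarrow> real^2"
  assumes "u \<in> L2 L"
  shows "(\<lambda>x. u x $ i) \<in> L2 L"
proof -
  have m[measurable]: "u \<in> borel_measurable (dom_measure L)" using assms by (rule L2_measurable)
  have n: "(\<lambda>x. norm (u x)) \<in> L2 L" using assms by (auto simp: L2_def)
  have "(\<lambda>x. u x \<bullet> axis i 1) \<in> borel_measurable (dom_measure L)" by measurable
  then have "(\<lambda>x. u x $ i) \<in> borel_measurable (dom_measure L)" by (simp add: inner_axis)
  then show ?thesis by (rule L2_bound[OF n, where c=1]) (simp add: component_le_norm_cart)
qed

lemma L2_mult_bounded:
  fixes f g :: "real^2 \<Rightarrow> real"
  assumes "f \<in> L2 L" "g \<in> borel_measurable (dom_measure L)" "\<And>x. \<bar>g x\<bar> \<le> M"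
  shows "(\<lambda>x. f x * g x) \<in> L2 L"
proof (rule L2_bound[OF assms(1), where c=M])
  note [measurable] = L2_measurable[OF assms(1)] assms(2)
  show "(\<lambda>x. f x * g x) \<in> borel_measurable (dom_measure L)" by measurable
  show "\<bar>f x * g x\<bar> \<le> M * \<bar>f x\<bar>" for x
    using mult_right_mono[OF assms(3)[of x], of "\<bar>f x\<bar>"] by (simp add: abs_mult mult.commute)
qed

section \<open>The truncated temperature as a test function\<close>

context temp_basis
begin

text \<open>For a test function \<phi> in place of \<open>f\<close>, the integrand is u times the
  gradient of M^2 (1 - cos (\<phi>/M)), whose integral vanishes. Boundedness of the truncation keeps
  its product with u, which is only in L^2, square integrable, so that it can be paired with
  gradients in the limit.\<close>

lemma advect_sin_trunc:
  assumes f: "f \<in> H1" and u: "u \<in> L2 L" "divfree L u" and M: "0 < M"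
  shows "integrable (dom_measure L) (\<lambda>x. advect L (strip_test L) u f x * sin_trunc M (f x))"
    and "L2_inner L (advect L (strip_test L) u f) (\<lambda>x. sin_trunc M (f x)) = 0"
proof -
  obtain \<phi> where \<phi>: "\<And>n::nat. \<phi> n \<in> strip_test L"
    "(\<lambda>n. L2_norm L (\<lambda>x. \<phi> n x - f x)) \<longlonglongrightarrow> 0"
    "\<And>i. D i f \<in> L2 L"
    "\<And>i. (\<lambda>n. L2_norm L (\<lambda>x. pderiv_dir i (\<phi> n) x - D i f x)) \<longlonglongrightarrow> 0"
    "AE x in dom_measure L. (\<lambda>n. \<phi> n x) \<longlonglongrightarrow> f x"
    using that by (rule Hsp_approx[OF f])
  have f2: "f \<in> L2 L" by (rule Hsp_1_L2[OF f])
  have \<phi>2: "\<phi> n \<in> L2 L" for n by (rule strip_test_L2[OF \<phi>(1)])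
  have P: "pderiv_dir i (\<phi> n) \<in> L2 L" for i n by (rule strip_test_pderiv_L2[OF \<phi>(1)])
  note [measurable] = L2_measurable[OF f2] L2_measurable[OF \<phi>2] L2_measurable[OF \<phi>(3)]
  define U where "U i x = u x $ i" for i x
  have U: "U i \<in> L2 L" for i unfolding U_def by (rule L2_component[OF u(1)])
  note [measurable] = L2_measurable[OF U]
  let ?T = "\<lambda>i g x. U i x * sin_trunc M (g x)" and ?d = "\<lambda>n i x. pderiv_dir i (\<phi> n) x - D i f x"
  have UT: "(\<lambda>x. U i x * sin_trunc M (g x)) \<in> L2 L" if "g \<in> borel_measurable (dom_measure L)" for i g
    using that M by (intro L2_mult_bounded[OF U, where M=M]) (auto simp: sin_trunc_le_bound)
  have expand: "advect L (strip_test L) u f x * sin_trunc M (f x)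
      = (\<Sum>i\<in>UNIV. U i x * sin_trunc M (f x) * D i f x)" for x
    by (simp add: advect_def U_def sum_distrib_left ac_simps)
  have int: "integrable (dom_measure L) (\<lambda>x. U i x * sin_trunc M (f x) * D i f x)" for i
    by (rule L2_mult_integrable[OF UT \<phi>(3)]) measurable
  then show "integrable (dom_measure L) (\<lambda>x. advect L (strip_test L) u f x * sin_trunc M (f x))"
    unfolding expand by (intro Bochner_Integration.integrable_sum)
  have zero: "(\<Sum>i\<in>UNIV. L2_inner L (?T i (\<phi> n)) (pderiv_dir i (\<phi> n))) = 0" for n
  proof -
    have "(\<Sum>i\<in>UNIV. L2_inner L (?T i (\<phi> n)) (pderiv_dir i (\<phi> n)))
        = (\<integral>x. (\<Sum>i\<in>UNIV. U i x * sin_trunc M (\<phi> n x) * pderiv_dir i (\<phi> n) x) \<partial>dom_measure L)"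
      unfolding L2_inner_real
      by (intro Bochner_Integration.integral_sum[symmetric] L2_mult_integrable[OF UT P]) measurable
    also have "\<dots> = (\<integral>x. (\<Sum>i\<in>UNIV. u x $ i * pderiv_dir i (\<lambda>x. M\<^sup>2 * (1 - cos (\<phi> n x / M))) x) \<partial>dom_measure L)"
      using M by (simp add: pderiv_dir_cos[OF smooth_strip_test[OF \<phi>(1)]] sin_trunc_def U_def mult.assoc)
    also have "\<dots> = 0" by (rule divfree_strip_test[OF L_pos u(2) strip_test_cos[OF \<phi>(1)]])
    finally show ?thesis .
  qed
  have lim: "(\<lambda>n. L2_inner L (?T i (\<phi> n)) (pderiv_dir i (\<phi> n)))
      \<longlonglongrightarrow> L2_inner L (?T i f) (D i f)" for i
  proof -
    \<comment> \<open>Both factors vary with n. The gradient error is paired with functions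
      dominated by M |u|; what remains contains the fixed gradient \<open>D i f\<close> and is left
      to dominated convergence.\<close>
    have "(\<lambda>n. L2_inner L (?T i (\<phi> n)) (?d n i)) \<longlonglongrightarrow> 0"
    proof (rule Lim_null_comparison)
      show "(\<lambda>n. L2_norm L (\<lambda>x. M * U i x) * L2_norm L (?d n i)) \<longlonglongrightarrow> 0"
        using tendsto_mult[OF tendsto_const \<phi>(4)] by simp
      show "\<forall>\<^sub>F n in sequentially.
          norm (L2_inner L (?T i (\<phi> n)) (?d n i))
          \<le> L2_norm L (\<lambda>x. M * U i x) * L2_norm L (?d n i)"
      proof (intro always_eventually allI)
        fix n
        have "\<bar>L2_inner L (?T i (\<phi> n)) (?d n i)\<bar>
            \<le> L2_norm L (?T i (\<phi> n)) * L2_norm L (?d n i)"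
          by (intro L2_Cauchy_Schwarz UT L2_diff P \<phi>(3)) measurable
        also have "\<dots> \<le> L2_norm L (\<lambda>x. M * U i x) * L2_norm L (?d n i)"
        proof (intro mult_right_mono L2_norm_mono UT L2_cmult U)
          fix x
          show "\<bar>U i x * sin_trunc M (\<phi> n x)\<bar> \<le> \<bar>M * U i x\<bar>"
            using mult_left_mono[OF sin_trunc_le_bound[OF M, of "\<phi> n x"], of "\<bar>U i x\<bar>"] M
            by (simp add: abs_mult mult.commute)
        qed (use L2_measurable[OF \<phi>2] in simp_all)
        finally show "norm (L2_inner L (?T i (\<phi> n)) (?d n i))
          \<le> L2_norm L (\<lambda>x. M * U i x) * L2_norm L (?d n i)" by simp
      qed
    qed
    moreover have "(\<lambda>n. L2_inner L (?T i (\<phi> n)) (D i f))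
        \<longlonglongrightarrow> L2_inner L (?T i f) (D i f)"
      unfolding L2_inner_real
    proof (rule integral_dominated_convergence[where w="\<lambda>x. M * \<bar>U i x * D i f x\<bar>"])
      show "integrable (dom_measure L) (\<lambda>x. M * \<bar>U i x * D i f x\<bar>)"
        using L2_mult_integrable[OF U \<phi>(3), of i i] by simp
      show "AE x in dom_measure L. (\<lambda>n. U i x * sin_trunc M (\<phi> n x) * D i f x)
          \<longlonglongrightarrow> U i x * sin_trunc M (f x) * D i f x"
        using \<phi>(5)
      proof eventually_elim
        case (elim x)
        then show ?case using M unfolding sin_trunc_def by (intro tendsto_intros) auto
      qed
      show "AE x in dom_measure L. norm (U i x * sin_trunc M (\<phi> n x) * D i f x) \<le> M * \<bar>U i x * D i f x\<bar>" for n
      proof (rule AE_I2)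
        fix x
        have "\<bar>sin_trunc M (\<phi> n x)\<bar> * \<bar>U i x * D i f x\<bar> \<le> M * \<bar>U i x * D i f x\<bar>"
          by (intro mult_right_mono sin_trunc_le_bound M) auto
        then show "norm (U i x * sin_trunc M (\<phi> n x) * D i f x) \<le> M * \<bar>U i x * D i f x\<bar>"
          by (simp add: abs_mult ac_simps)
      qed
    qed measurable
    ultimately have "(\<lambda>n. L2_inner L (?T i (\<phi> n)) (?d n i)
        + L2_inner L (?T i (\<phi> n)) (D i f))
      \<longlonglongrightarrow> 0 + L2_inner L (?T i f) (D i f)" by (rule tendsto_add)
    moreover have "L2_inner L (?T i (\<phi> n)) (?d n i)
      = L2_inner L (?T i (\<phi> n)) (pderiv_dir i (\<phi> n))
        - L2_inner L (?T i (\<phi> n)) (D i f)" for n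
      by (intro L2_inner_diff_right P \<phi>(3) UT) measurable
    ultimately show ?thesis by simp
  qed
  have "(\<lambda>n. \<Sum>i\<in>UNIV. L2_inner L (?T i (\<phi> n)) (pderiv_dir i (\<phi> n)))
      \<longlonglongrightarrow> (\<Sum>i\<in>UNIV. L2_inner L (?T i f) (D i f))"
    by (intro tendsto_sum lim)
  then have "(\<Sum>i\<in>UNIV. L2_inner L (?T i f) (D i f)) = 0"
    unfolding zero by (simp add: LIMSEQ_const_iff)
  moreover have "L2_inner L (advect L (strip_test L) u f) (\<lambda>x. sin_trunc M (f x))
      = (\<Sum>i\<in>UNIV. L2_inner L (?T i f) (D i f))"
    unfolding L2_inner_real expand by (intro Bochner_Integration.integral_sum int)
  ultimately show "L2_inner L (advect L (strip_test L) u f) (\<lambda>x. sin_trunc M (f x)) = 0" by simp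
qed

text \<open>The chain rule produces the factor cos (\<phi>/M), of modulus at most 1, so truncation
  does not increase gradients and Bessel's inequality gives a bound free of M. Finite sections of
  the series are used because they pass to the limit in n termwise.\<close>

lemma sin_trunc_Hsp:
  assumes f: "f \<in> H1"
  obtains C where "\<And>M. 0 < M \<Longrightarrow> (\<lambda>x. sin_trunc M (f x)) \<in> H1"
    "\<And>M. 0 < M \<Longrightarrow> (L2_norm L (sqrtA (\<lambda>x. sin_trunc M (f x))))\<^sup>2 \<le> C"
proof -
  obtain \<phi> where \<phi>: "\<And>n::nat. \<phi> n \<in> strip_test L"
    "(\<lambda>n. L2_norm L (\<lambda>x. \<phi> n x - f x)) \<longlonglongrightarrow> 0"
    "\<And>i. D i f \<in> L2 L"
    "\<And>i. (\<lambda>n. L2_norm L (\<lambda>x. pderiv_dir i (\<phi> n) x - D i f x)) \<longlonglongrightarrow> 0"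
    "AE x in dom_measure L. (\<lambda>n. \<phi> n x) \<longlonglongrightarrow> f x"
    using that by (rule Hsp_approx[OF f])
  have f2: "f \<in> L2 L" by (rule Hsp_1_L2[OF f])
  have \<phi>2: "\<phi> n \<in> L2 L" for n by (rule strip_test_L2[OF \<phi>(1)])
  have P: "pderiv_dir i (\<phi> n) \<in> L2 L" for i n by (rule strip_test_pderiv_L2[OF \<phi>(1)])
  define C where "C = (\<Sum>i\<in>UNIV. (L2_norm L (D i f))\<^sup>2)"
  have C: "(\<Sum>j<J. lam j * (coef (\<lambda>x. sin_trunc M (f x)) j)\<^sup>2) \<le> C" if M: "0 < M" for M J
  proof (rule LIMSEQ_le)
    show "(\<lambda>n. \<Sum>j<J. lam j * (coef (\<lambda>x. sin_trunc M (\<phi> n x)) j)\<^sup>2)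
        \<longlonglongrightarrow> (\<Sum>j<J. lam j * (coef (\<lambda>x. sin_trunc M (f x)) j)\<^sup>2)"
      using sin_trunc_L2_tendsto[OF M \<phi>2 f2 \<phi>(2)]
      by (intro tendsto_intros L2_inner_tendsto sin_trunc_L2[OF M] \<phi>2 f2 zeta_L2)
    show "(\<lambda>n. \<Sum>i\<in>UNIV. (L2_norm L (pderiv_dir i (\<phi> n)))\<^sup>2) \<longlonglongrightarrow> C"
      unfolding C_def by (intro tendsto_intros L2_norm_tendsto P \<phi>)
    show "\<exists>N. \<forall>n\<ge>N. (\<Sum>j<J. lam j * (coef (\<lambda>x. sin_trunc M (\<phi> n x)) j)\<^sup>2)
        \<le> (\<Sum>i\<in>UNIV. (L2_norm L (pderiv_dir i (\<phi> n)))\<^sup>2)"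
    proof (intro exI allI impI)
      fix n
      have T: "(\<lambda>x. sin_trunc M (\<phi> n x)) \<in> strip_test L"
        unfolding sin_trunc_def by (rule strip_test_sin[OF \<phi>(1)])
      have "(\<Sum>j<J. lam j * (coef (\<lambda>x. sin_trunc M (\<phi> n x)) j)\<^sup>2)
          \<le> (\<Sum>i\<in>UNIV. (L2_norm L (pderiv_dir i (\<lambda>x. sin_trunc M (\<phi> n x))))\<^sup>2)"
        by (rule bessel_strip_test[OF T]) simp
      also have "\<dots> \<le> (\<Sum>i\<in>UNIV. (L2_norm L (pderiv_dir i (\<phi> n)))\<^sup>2)"
      proof (intro sum_mono power_mono L2_norm_mono strip_test_pderiv_L2[OF T] P)
        fix i x
        show "\<bar>pderiv_dir i (\<lambda>x. sin_trunc M (\<phi> n x)) x\<bar> \<le> \<bar>pderiv_dir i (\<phi> n) x\<bar>"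
          unfolding sin_trunc_def using M
          by (simp add: pderiv_dir_sin[OF smooth_strip_test[OF \<phi>(1)]] abs_mult mult_left_le_one_le)
      qed simp
      finally show "(\<Sum>j<J. lam j * (coef (\<lambda>x. sin_trunc M (\<phi> n x)) j)\<^sup>2)
        \<le> (\<Sum>i\<in>UNIV. (L2_norm L (pderiv_dir i (\<phi> n)))\<^sup>2)" .
    qed
  qed
  have H: "(\<lambda>x. sin_trunc M (f x)) \<in> H1" if M: "0 < M" for M
    unfolding Hsp_1_iff
  proof
    show "(\<lambda>x. sin_trunc M (f x)) \<in> L2 L" by (rule sin_trunc_L2[OF M f2])
    show "summable (\<lambda>j. lam j * (coef (\<lambda>x. sin_trunc M (f x)) j)\<^sup>2)"
      by (rule summableI_nonneg_bounded[OF _ C[OF M]]) (simp add: less_imp_le[OF lam_pos])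
  qed
  show thesis
  proof (rule that[OF H])
    fix M :: real assume M: "0 < M"
    show "(L2_norm L (sqrtA (\<lambda>x. sin_trunc M (f x))))\<^sup>2 \<le> C"
      using op_power_norm_sums[OF H[OF M]] unfolding sums_def
      by (rule LIMSEQ_le_const2) (use C[OF M] in blast)
  qed
qed

text \<open>Truncations of \<theta>' are admissible tests on which advection vanishes. They converge
  to \<theta>' in L^2, while their images under \<open>sqrtA\<close> are merely bounded with
  convergent coefficients; this is enough against the fixed function
  \<open>sqrtA \<theta>'\<close>.\<close>

lemma energy_identity:
  assumes step: "euler_temperature_step L lam \<zeta> \<kappa> h u \<theta> \<Delta>W \<theta>'"
    and u: "u \<in> L2 L" "divfree L u" and \<theta>: "\<theta> \<in> L2 L" and W: "\<Delta>W \<in> L2 L"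
  shows "\<theta>' \<in> H1"
    and "L2_inner L (\<lambda>x. \<theta>' x - \<theta> x) \<theta>' + h * \<kappa> * (L2_norm L (sqrtA \<theta>'))\<^sup>2
      = L2_inner L \<Delta>W \<theta>'"
proof -
  show H: "\<theta>' \<in> H1" using step unfolding euler_temperature_step_def by blast
  then have \<theta>'2: "\<theta>' \<in> L2 L" by (rule Hsp_1_L2)
  define \<psi> where "\<psi> m x = sin_trunc (real (Suc m)) (\<theta>' x)" for m x
  obtain C where C: "\<And>M. 0 < M \<Longrightarrow> (\<lambda>x. sin_trunc M (\<theta>' x)) \<in> H1"
    "\<And>M. 0 < M \<Longrightarrow> (L2_norm L (sqrtA (\<lambda>x. sin_trunc M (\<theta>' x))))\<^sup>2 \<le> C"
    using that by (rule sin_trunc_Hsp[OF H])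
  have \<psi>H: "\<psi> m \<in> H1" for m unfolding \<psi>_def by (rule C(1)) simp
  have \<psi>2: "\<psi> m \<in> L2 L" for m by (rule Hsp_1_L2[OF \<psi>H])
  have lim: "(\<lambda>m. L2_norm L (\<lambda>x. \<psi> m x - \<theta>' x)) \<longlonglongrightarrow> 0"
    unfolding \<psi>_def by (rule sin_trunc_L2_limit[OF \<theta>'2])
  have eq: "L2_inner L (\<lambda>x. \<theta>' x - \<theta> x) (\<psi> m) + h * \<kappa> * L2_inner L (sqrtA \<theta>') (sqrtA (\<psi> m)) = L2_inner L \<Delta>W (\<psi> m)" for m
  proof -
    have int: "integrable (dom_measure L) (\<lambda>x. advect L (strip_test L) u \<theta>' x * \<psi> m x)"
      and zero: "L2_inner L (advect L (strip_test L) u \<theta>') (\<psi> m) = 0"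
      unfolding \<psi>_def by (rule advect_sin_trunc[OF H u]; simp)+
    from step[unfolded euler_temperature_step_def, THEN conjunct2, THEN bspec, OF \<psi>H, THEN mp, OF int]
    show ?thesis by (simp add: zero)
  qed
  have Alim: "(\<lambda>m. L2_inner L (sqrtA \<theta>') (sqrtA (\<psi> m))) \<longlonglongrightarrow> L2_inner L (sqrtA \<theta>') (sqrtA \<theta>')"
  proof (rule weak_limit_inner[OF op_power_Hsp(1)[OF H] op_power_Hsp(1)[OF \<psi>H]])
    show "L2_norm L (sqrtA (\<psi> m)) \<le> sqrt C" for m
      unfolding \<psi>_def using C(2)[of "real (Suc m)"] by (intro real_le_rsqrt) simp
    show "(\<lambda>m. coef (sqrtA (\<psi> m)) j) \<longlonglongrightarrow> coef (sqrtA \<theta>') j" for j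
      unfolding op_power_Hsp(2)[OF H] op_power_Hsp(2)[OF \<psi>H]
      by (intro tendsto_intros L2_inner_tendsto[OF \<psi>2 \<theta>'2 zeta_L2 lim])
  qed
  have inner: "(\<lambda>m. L2_inner L g (\<psi> m)) \<longlonglongrightarrow> L2_inner L g \<theta>'" if "g \<in> L2 L" for g
    using L2_inner_tendsto[OF \<psi>2 \<theta>'2 that lim] by (simp add: L2_inner_commute[of L g])
  have "(\<lambda>m. L2_inner L (\<lambda>x. \<theta>' x - \<theta> x) (\<psi> m) + h * \<kappa> * L2_inner L (sqrtA \<theta>') (sqrtA (\<psi> m)))
      \<longlonglongrightarrow> L2_inner L (\<lambda>x. \<theta>' x - \<theta> x) \<theta>' + h * \<kappa> * L2_inner L (sqrtA \<theta>') (sqrtA \<theta>')"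
    by (intro tendsto_intros inner Alim L2_diff \<theta>'2 \<theta>)
  then show "L2_inner L (\<lambda>x. \<theta>' x - \<theta> x) \<theta>' + h * \<kappa> * (L2_norm L (sqrtA \<theta>'))\<^sup>2 = L2_inner L \<Delta>W \<theta>'"
    unfolding eq L2_norm_sq by (rule LIMSEQ_unique[OF _ inner[OF W]])
qed

text \<open>Nonnegativity of |\<theta>' - \<theta> - \<Delta>W|^2 trades (\<Delta>W, \<theta>') for
  (\<Delta>W, \<theta>), in which the increment meets the temperature of the previous step; the
  price is |\<Delta>W|^2.\<close>

lemma energy_inequality:
  assumes step: "euler_temperature_step L lam \<zeta> \<kappa> h u \<theta> \<Delta>W \<theta>'"
    and u: "u \<in> L2 L" "divfree L u" and \<theta>: "\<theta> \<in> L2 L" and W: "\<Delta>W \<in> L2 L"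
  shows "(L2_norm L \<theta>')\<^sup>2 + 2 * h * \<kappa> * (L2_norm L (sqrtA \<theta>'))\<^sup>2
    \<le> (L2_norm L \<theta>)\<^sup>2 + 2 * L2_inner L \<Delta>W \<theta> + (L2_norm L \<Delta>W)\<^sup>2"
proof -
  note e = energy_identity[OF assms]
  have \<theta>'2: "\<theta>' \<in> L2 L" by (rule Hsp_1_L2[OF e(1)])
  have "0 \<le> L2_inner L (\<lambda>x. (\<theta>' x - \<theta> x) - \<Delta>W x) (\<lambda>x. (\<theta>' x - \<theta> x) - \<Delta>W x)" by simp
  also have "\<dots> = L2_inner L \<theta>' \<theta>' - 2 * L2_inner L \<theta>' \<theta> + L2_inner L \<theta> \<theta>
      - 2 * (L2_inner L \<Delta>W \<theta>' - L2_inner L \<Delta>W \<theta>) + L2_inner L \<Delta>W \<Delta>W"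
    unfolding L2_inner_self_diff[OF L2_diff[OF \<theta>'2 \<theta>] W] L2_inner_self_diff[OF \<theta>'2 \<theta>]
      L2_inner_diff_left[OF \<theta>'2 \<theta> W] L2_inner_commute[of L \<theta>' \<Delta>W] L2_inner_commute[of L \<theta> \<Delta>W] ..
  finally show ?thesis
    using e(2) L2_inner_diff_left[OF \<theta>'2 \<theta> \<theta>'2] L2_inner_commute[of L \<theta>' \<theta>]
    by (simp add: L2_norm_sq algebra_simps)
qed

end

section \<open>Exponential moments of Gaussian increments\<close>

lemma nn_integral_normal_density: "0 < \<sigma> \<Longrightarrow> (\<integral>\<^sup>+y. ennreal (normal_density \<mu> \<sigma> y) \<partial>lborel) = 1"
  by (subst nn_integral_eq_integral) auto

lemma nn_integral_normal_exp:
  assumes "0 < \<sigma>"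
  shows "(\<integral>\<^sup>+y. ennreal (normal_density 0 \<sigma> y) * ennreal (exp (v * y)) \<partial>lborel) = ennreal (exp (v\<^sup>2 * \<sigma>\<^sup>2 / 2))"
proof -
  \<comment> \<open>Completing the square moves the mean to v \<sigma>^2.\<close>
  have "normal_density 0 \<sigma> y * exp (v * y) = exp (v\<^sup>2 * \<sigma>\<^sup>2 / 2) * normal_density (v * \<sigma>\<^sup>2) \<sigma> y" for y
  proof -
    have "- y\<^sup>2 / (2 * \<sigma>\<^sup>2) + v * y = v\<^sup>2 * \<sigma>\<^sup>2 / 2 + - (y - v * \<sigma>\<^sup>2)\<^sup>2 / (2 * \<sigma>\<^sup>2)"
      using assms by (simp add: field_simps power2_eq_square)
    then have "exp (- y\<^sup>2 / (2 * \<sigma>\<^sup>2)) * exp (v * y)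
        = exp (v\<^sup>2 * \<sigma>\<^sup>2 / 2) * exp (- (y - v * \<sigma>\<^sup>2)\<^sup>2 / (2 * \<sigma>\<^sup>2))"
      by (simp add: exp_add[symmetric])
    then show ?thesis by (simp add: normal_density_def)
  qed
  then have "(\<integral>\<^sup>+y. ennreal (normal_density 0 \<sigma> y) * ennreal (exp (v * y)) \<partial>lborel)
      = (\<integral>\<^sup>+y. ennreal (exp (v\<^sup>2 * \<sigma>\<^sup>2 / 2)) * ennreal (normal_density (v * \<sigma>\<^sup>2) \<sigma> y) \<partial>lborel)"
    by (simp add: ennreal_mult[symmetric])
  also have "\<dots> = ennreal (exp (v\<^sup>2 * \<sigma>\<^sup>2 / 2))"
    by (subst nn_integral_cmult) (auto simp: nn_integral_normal_density assms)
  finally show ?thesis .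
qed

lemma nn_integral_normal_exp_sq:
  assumes "0 < \<sigma>" "2 * c * \<sigma>\<^sup>2 < 1"
  shows "(\<integral>\<^sup>+y. ennreal (normal_density 0 \<sigma> y) * ennreal (exp (c * y\<^sup>2)) \<partial>lborel)
    = ennreal (1 / sqrt (1 - 2 * c * \<sigma>\<^sup>2))"
proof -
  define d where "d = 1 - 2 * c * \<sigma>\<^sup>2"
  have d: "0 < d" using assms(2) by (simp add: d_def)
  \<comment> \<open>The Gaussian exponent absorbs c y^2: 1/\<sigma>'^2 = 1/\<sigma>^2 - 2c, which is
    positive by assumption.\<close>
  define \<sigma>' where "\<sigma>' = \<sigma> / sqrt d"
  have \<sigma>': "0 < \<sigma>'" "\<sigma>'\<^sup>2 = \<sigma>\<^sup>2 / d" using d assms(1) by (simp_all add: \<sigma>'_def power_divide)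
  have "normal_density 0 \<sigma> y * exp (c * y\<^sup>2) = 1 / sqrt d * normal_density 0 \<sigma>' y" for y
  proof -
    have "- y\<^sup>2 / (2 * \<sigma>\<^sup>2) + c * y\<^sup>2 = - y\<^sup>2 / (2 * \<sigma>'\<^sup>2)"
      using assms(1) d by (simp add: \<sigma>'(2) d_def field_simps)
    then have e: "exp (- y\<^sup>2 / (2 * \<sigma>\<^sup>2)) * exp (c * y\<^sup>2) = exp (- y\<^sup>2 / (2 * \<sigma>'\<^sup>2))"
      by (simp add: exp_add[symmetric])
    have "sqrt (2 * pi * \<sigma>\<^sup>2) = sqrt d * sqrt (2 * pi * \<sigma>'\<^sup>2)"
      using d by (simp add: \<sigma>'(2) flip: real_sqrt_mult)
    with e show ?thesis by (simp add: normal_density_def)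
  qed
  then have "(\<integral>\<^sup>+y. ennreal (normal_density 0 \<sigma> y) * ennreal (exp (c * y\<^sup>2)) \<partial>lborel)
      = (\<integral>\<^sup>+y. ennreal (1 / sqrt d) * ennreal (normal_density 0 \<sigma>' y) \<partial>lborel)"
    using d by (simp add: ennreal_mult[symmetric])
  also have "\<dots> = ennreal (1 / sqrt d)"
    by (subst nn_integral_cmult) (auto simp: nn_integral_normal_density \<sigma>')
  finally show ?thesis by (simp add: d_def)
qed

section \<open>Integration against increments independent of the past\<close>

context prob_space
begin

definition gaussian_indep :: "'a measure \<Rightarrow> real \<Rightarrow> ('a \<Rightarrow> real) \<Rightarrow> bool" where
  "gaussian_indep F \<sigma> Y \<longleftrightarrow> 0 < \<sigma> \<and> distributed M lborel Y (normal_density 0 \<sigma>) \<and>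
     indep_set (sets F) (sets (vimage_algebra (space M) Y borel))"

lemma gaussian_indep_measurable: "gaussian_indep F \<sigma> Y \<Longrightarrow> Y \<in> borel_measurable M"
  unfolding gaussian_indep_def using distributed_measurable[of M lborel Y] by fastforce

text \<open>Independence makes the joint law of X and Y a product, so Fubini's theorem integrates Y
  out with X frozen.\<close>

lemma nn_integral_gaussian_indep:
  assumes F: "subalgebra M F" and X: "X \<in> measurable F N" and Y: "gaussian_indep F \<sigma> Y"
    and f: "f \<in> borel_measurable (N \<Otimes>\<^sub>M borel)"
  shows "(\<integral>\<^sup>+x. f (X x, Y x) \<partial>M) = (\<integral>\<^sup>+x. (\<integral>\<^sup>+y. ennreal (normal_density 0 \<sigma> y) * f (X x, y) \<partial>lborel) \<partial>M)"
proof -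
  have Ym[measurable]: "Y \<in> borel_measurable M" by (rule gaussian_indep_measurable[OF Y])
  have sp: "space F = space M" using F by (simp add: subalgebra_def)
  have Xm[measurable]: "X \<in> measurable M N" by (rule measurable_from_subalg[OF F X])
  note [measurable] = f
  interpret dX: prob_space "distr M N X" by (rule prob_space_distr[OF Xm])
  interpret dY: prob_space "distr M borel Y" by (rule prob_space_distr[OF Ym])
  have eq: "distr M N X \<Otimes>\<^sub>M distr M borel Y = distr M (N \<Otimes>\<^sub>M borel) (\<lambda>x. (X x, Y x))"
  proof (rule pair_measure_eqI)
    fix A B assume "A \<in> sets (distr M N X)" "B \<in> sets (distr M borel Y)"
    then have A[measurable]: "A \<in> sets N" and B[measurable]: "B \<in> sets borel" by simp_all
    have a: "X -` A \<inter> space M \<in> sets F" using measurable_sets[OF X A] by (simp add: sp)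
    have b: "Y -` B \<inter> space M \<in> sets (vimage_algebra (space M) Y borel)"
      using B by (simp add: in_vimage_algebra)
    have "indep_set (sets F) (sets (vimage_algebra (space M) Y borel))"
      using Y by (simp add: gaussian_indep_def)
    then have "prob ((X -` A \<inter> space M) \<inter> (Y -` B \<inter> space M)) = prob (X -` A \<inter> space M) * prob (Y -` B \<inter> space M)"
      unfolding indep_sets2_eq using a b by blast
    moreover have "(X -` A \<inter> space M) \<inter> (Y -` B \<inter> space M) = (\<lambda>x. (X x, Y x)) -` (A \<times> B) \<inter> space M" by auto
    ultimately show "emeasure (distr M N X) A * emeasure (distr M borel Y) B
        = emeasure (distr M (N \<Otimes>\<^sub>M borel) (\<lambda>x. (X x, Y x))) (A \<times> B)"
      by (simp add: emeasure_distr emeasure_eq_measure ennreal_mult)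
  qed (auto intro: dX.sigma_finite_measure_axioms dY.sigma_finite_measure_axioms cong: sets_pair_measure_cong)
  have dens: "distr M borel Y = density lborel (normal_density 0 \<sigma>)"
    using Y unfolding gaussian_indep_def by (auto simp: distributed_def cong: distr_cong)
  have "(\<integral>\<^sup>+x. f (X x, Y x) \<partial>M) = (\<integral>\<^sup>+p. f p \<partial>distr M (N \<Otimes>\<^sub>M borel) (\<lambda>x. (X x, Y x)))"
    by (subst nn_integral_distr) auto
  also have "\<dots> = (\<integral>\<^sup>+x. \<integral>\<^sup>+y. f (x, y) \<partial>distr M borel Y \<partial>distr M N X)"
    unfolding eq[symmetric] by (subst dY.nn_integral_fst[symmetric]) auto
  also have "\<dots> = (\<integral>\<^sup>+x. \<integral>\<^sup>+y. f (X x, y) \<partial>distr M borel Y \<partial>M)"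
    by (subst nn_integral_distr) (auto intro!: dY.borel_measurable_nn_integral)
  also have "\<dots> = (\<integral>\<^sup>+x. (\<integral>\<^sup>+y. ennreal (normal_density 0 \<sigma> y) * f (X x, y) \<partial>lborel) \<partial>M)"
  proof (rule nn_integral_cong)
    fix x assume "x \<in> space M"
    then have [measurable]: "X x \<in> space N" using measurable_space[OF Xm] by blast
    show "(\<integral>\<^sup>+y. f (X x, y) \<partial>distr M borel Y) = (\<integral>\<^sup>+y. ennreal (normal_density 0 \<sigma> y) * f (X x, y) \<partial>lborel)"
      unfolding dens by (subst nn_integral_density) auto
  qed
  finally show ?thesis .
qed

text \<open>Allowing every nonnegative weight Z measurable with respect to F states the conditional
  exponential moment without conditional expectations and without integrability conditions.\<close>

lemma nn_integral_exp_gaussian_indep: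
  fixes Z :: "'a \<Rightarrow> ennreal"
  assumes F: "subalgebra M F" and Z: "Z \<in> borel_measurable F" and V: "V \<in> borel_measurable F"
    and Y: "gaussian_indep F \<sigma> Y"
  shows "(\<integral>\<^sup>+x. Z x * ennreal (exp (V x * Y x)) \<partial>M) = (\<integral>\<^sup>+x. Z x * ennreal (exp ((V x)\<^sup>2 * \<sigma>\<^sup>2 / 2)) \<partial>M)"
proof -
  have \<sigma>: "0 < \<sigma>" using Y by (simp add: gaussian_indep_def)
  have X: "(\<lambda>x. (Z x, V x)) \<in> measurable F (borel \<Otimes>\<^sub>M borel)" using Z V by measurable
  have "(\<integral>\<^sup>+x. Z x * ennreal (exp (V x * Y x)) \<partial>M)
      = (\<integral>\<^sup>+x. (\<lambda>p. fst (fst p) * ennreal (exp (snd (fst p) * snd p))) ((Z x, V x), Y x) \<partial>M)" by simp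
  also have "\<dots> = (\<integral>\<^sup>+x. (\<integral>\<^sup>+y. ennreal (normal_density 0 \<sigma> y) * (Z x * ennreal (exp (V x * y))) \<partial>lborel) \<partial>M)"
    by (subst nn_integral_gaussian_indep[OF F X Y]) simp_all
  also have "\<dots> = (\<integral>\<^sup>+x. Z x * ennreal (exp ((V x)\<^sup>2 * \<sigma>\<^sup>2 / 2)) \<partial>M)"
  proof (rule nn_integral_cong)
    fix x
    have "(\<integral>\<^sup>+y. ennreal (normal_density 0 \<sigma> y) * (Z x * ennreal (exp (V x * y))) \<partial>lborel)
        = (\<integral>\<^sup>+y. Z x * (ennreal (normal_density 0 \<sigma> y) * ennreal (exp (V x * y))) \<partial>lborel)"
      by (simp add: ac_simps)
    also have "\<dots> = Z x * ennreal (exp ((V x)\<^sup>2 * \<sigma>\<^sup>2 / 2))"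
      by (subst nn_integral_cmult) (auto simp: nn_integral_normal_exp[OF \<sigma>])
    finally show "(\<integral>\<^sup>+y. ennreal (normal_density 0 \<sigma> y) * (Z x * ennreal (exp (V x * y))) \<partial>lborel)
        = Z x * ennreal (exp ((V x)\<^sup>2 * \<sigma>\<^sup>2 / 2))" .
  qed
  finally show ?thesis .
qed

lemma nn_integral_exp_sq_gaussian_indep:
  fixes Z :: "'a \<Rightarrow> ennreal"
  assumes F: "subalgebra M F" and Z: "Z \<in> borel_measurable F"
    and Y: "gaussian_indep F \<sigma> Y" and c: "2 * c * \<sigma>\<^sup>2 < 1"
  shows "(\<integral>\<^sup>+x. Z x * ennreal (exp (c * (Y x)\<^sup>2)) \<partial>M) = ennreal (1 / sqrt (1 - 2 * c * \<sigma>\<^sup>2)) * (\<integral>\<^sup>+x. Z x \<partial>M)"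
proof -
  have \<sigma>: "0 < \<sigma>" using Y by (simp add: gaussian_indep_def)
  have ZM[measurable]: "Z \<in> borel_measurable M" by (rule measurable_from_subalg[OF F Z])
  have "(\<integral>\<^sup>+x. Z x * ennreal (exp (c * (Y x)\<^sup>2)) \<partial>M)
      = (\<integral>\<^sup>+x. (\<lambda>p. fst p * ennreal (exp (c * (snd p)\<^sup>2))) (Z x, Y x) \<partial>M)" by simp
  also have "\<dots> = (\<integral>\<^sup>+x. (\<integral>\<^sup>+y. ennreal (normal_density 0 \<sigma> y) * (Z x * ennreal (exp (c * y\<^sup>2))) \<partial>lborel) \<partial>M)"
    by (subst nn_integral_gaussian_indep[OF F Z Y]) simp_all
  also have "\<dots> = (\<integral>\<^sup>+x. ennreal (1 / sqrt (1 - 2 * c * \<sigma>\<^sup>2)) * Z x \<partial>M)"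
  proof (rule nn_integral_cong)
    fix x
    have "(\<integral>\<^sup>+y. ennreal (normal_density 0 \<sigma> y) * (Z x * ennreal (exp (c * y\<^sup>2))) \<partial>lborel)
        = (\<integral>\<^sup>+y. Z x * (ennreal (normal_density 0 \<sigma> y) * ennreal (exp (c * y\<^sup>2))) \<partial>lborel)"
      by (simp add: ac_simps)
    also have "\<dots> = Z x * ennreal (1 / sqrt (1 - 2 * c * \<sigma>\<^sup>2))"
      by (subst nn_integral_cmult) (auto simp: nn_integral_normal_exp_sq[OF \<sigma> c])
    finally show "(\<integral>\<^sup>+y. ennreal (normal_density 0 \<sigma> y) * (Z x * ennreal (exp (c * y\<^sup>2))) \<partial>lborel)
        = ennreal (1 / sqrt (1 - 2 * c * \<sigma>\<^sup>2)) * Z x" by (simp add: mult.commute)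
  qed
  also have "\<dots> = ennreal (1 / sqrt (1 - 2 * c * \<sigma>\<^sup>2)) * (\<integral>\<^sup>+x. Z x \<partial>M)"
    by (rule nn_integral_cmult) simp
  finally show ?thesis .
qed

end

text \<open>Jensen's inequality for the points S y_j with the normalised weights w_j / S, where S is
  the total weight; normalising the weights is what puts S into the exponent.\<close>

lemma exp_sum_le_Jensen:
  fixes w y :: "nat \<Rightarrow> real"
  assumes "0 < (\<Sum>j<n. w j)" "\<And>j. 0 \<le> w j"
  shows "exp (\<Sum>j<n. w j * y j) \<le> (\<Sum>j<n. w j / (\<Sum>k<n. w k) * exp ((\<Sum>k<n. w k) * y j))"
proof -
  let ?S = "\<Sum>k<n. w k"
  have "n \<noteq> 0" using assms(1) by (cases n) auto
  then have "exp (\<Sum>j<n. (w j / ?S) *\<^sub>R (?S * y j)) \<le> (\<Sum>j<n. w j / ?S * exp (?S * y j))"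
    using assms by (intro convex_on_sum[OF _ _ exp_convex])
      (auto simp: sum_divide_distrib[symmetric] intro!: divide_nonneg_pos)
  moreover have "(w j / ?S) *\<^sub>R (?S * y j) = w j * y j" for j using assms(1) by simp
  ultimately show ?thesis by simp
qed

text \<open>The Brownian motions are only known to be separately independent of the past. Jensen's
  inequality with the (random, but past-measurable) weights \<open>\<bar>d\<^sub>j\<bar> / \<Sum>\<^sub>k \<bar>d\<^sub>k\<bar>\<close> reduces the joint
  exponential moment to those of the individual increments.\<close>

lemma (in prob_space) nn_integral_exp_linear:
  fixes Z :: "'a \<Rightarrow> ennreal" and d Y :: "nat \<Rightarrow> 'a \<Rightarrow> real"
  assumes F: "subalgebra M F" and Z: "Z \<in> borel_measurable F" and d: "\<And>j. d j \<in> borel_measurable F"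
    and Y: "\<And>j. gaussian_indep F \<sigma> (Y j)"
  shows "(\<integral>\<^sup>+x. Z x * ennreal (exp (\<Sum>j<n. d j x * Y j x)) \<partial>M)
    \<le> (\<integral>\<^sup>+x. Z x * ennreal (exp ((\<Sum>j<n. \<bar>d j x\<bar>)\<^sup>2 * \<sigma>\<^sup>2 / 2)) \<partial>M)"
proof -
  define S where "S x = (\<Sum>j<n. \<bar>d j x\<bar>)" for x
  have S0: "0 \<le> S x" for x by (simp add: S_def sum_nonneg)
  note [measurable] = Z d
  have SF[measurable]: "S \<in> borel_measurable F" unfolding S_def by measurable
  note m = measurable_from_subalg[OF F]
  note [measurable] = m[OF Z] m[OF d] m[OF SF] gaussian_indep_measurable[OF Y]
  \<comment> \<open>When all coefficients vanish there are no weights to normalise; the exponential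
    is then 1 and \<open>Z\<close> is kept as it is.\<close>
  define z where "z x = (if S x = 0 then Z x else 0)" for x
  define w where "w j x = Z x * ennreal (\<bar>d j x\<bar> / S x)" for j x
  have zF[measurable]: "z \<in> borel_measurable F" unfolding z_def by measurable
  have wF[measurable]: "w j \<in> borel_measurable F" for j unfolding w_def by measurable
  note [measurable] = m[OF zF] m[OF wF]
  have pt: "Z x * ennreal (exp (\<Sum>j<n. d j x * Y j x))
      \<le> z x + (\<Sum>j<n. w j x * ennreal (exp ((S x * sgn (d j x)) * Y j x)))" for x
  proof (cases "S x = 0")
    case True
    then have "\<forall>j\<in>{..<n}. \<bar>d j x\<bar> = 0"
      unfolding S_def by (subst (asm) sum_nonneg_eq_0_iff) auto
    then show ?thesis using True by (simp add: z_def)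
  next
    case False
    then have pos: "0 < (\<Sum>j<n. \<bar>d j x\<bar>)" using S0[of x] unfolding S_def by linarith
    \<comment> \<open>Jensen's inequality needs nonnegative weights, so the sign is moved to the
      increment; its square drops out of the Gaussian moment.\<close>
    have "d j x * Y j x = \<bar>d j x\<bar> * (sgn (d j x) * Y j x)" for j by (simp add: sgn_if)
    then have "exp (\<Sum>j<n. d j x * Y j x) = exp (\<Sum>j<n. \<bar>d j x\<bar> * (sgn (d j x) * Y j x))"
      by (simp only:)
    also have "\<dots> \<le> (\<Sum>j<n. \<bar>d j x\<bar> / S x * exp (S x * (sgn (d j x) * Y j x)))"
      unfolding S_def by (rule exp_sum_le_Jensen[OF pos]) simp
    finally have "ennreal (exp (\<Sum>j<n. d j x * Y j x))
        \<le> ennreal (\<Sum>j<n. \<bar>d j x\<bar> / S x * exp (S x * (sgn (d j x) * Y j x)))" by (rule ennreal_leI)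
    also have "\<dots> = (\<Sum>j<n. ennreal (\<bar>d j x\<bar> / S x) * ennreal (exp (S x * sgn (d j x) * Y j x)))"
      by (simp add: ennreal_mult[symmetric] mult.assoc S0)
    finally have "Z x * ennreal (exp (\<Sum>j<n. d j x * Y j x))
        \<le> Z x * (\<Sum>j<n. ennreal (\<bar>d j x\<bar> / S x) * ennreal (exp (S x * sgn (d j x) * Y j x)))"
      by (intro mult_left_mono) auto
    then show ?thesis using False by (simp add: z_def w_def sum_distrib_left mult.assoc)
  qed
  have "(\<integral>\<^sup>+x. Z x * ennreal (exp (\<Sum>j<n. d j x * Y j x)) \<partial>M)
      \<le> (\<integral>\<^sup>+x. z x + (\<Sum>j<n. w j x * ennreal (exp ((S x * sgn (d j x)) * Y j x))) \<partial>M)"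
    by (intro nn_integral_mono pt)
  also have "\<dots> = (\<integral>\<^sup>+x. z x \<partial>M) + (\<Sum>j<n. \<integral>\<^sup>+x. w j x * ennreal (exp ((S x * sgn (d j x)) * Y j x)) \<partial>M)"
    by (subst nn_integral_add) (auto simp: nn_integral_sum)
  also have "\<dots> = (\<integral>\<^sup>+x. z x \<partial>M) + (\<Sum>j<n. \<integral>\<^sup>+x. w j x * ennreal (exp ((S x * sgn (d j x))\<^sup>2 * \<sigma>\<^sup>2 / 2)) \<partial>M)"
    by (subst nn_integral_exp_gaussian_indep[OF F wF _ Y]) auto
  also have "\<dots> = (\<integral>\<^sup>+x. z x + (\<Sum>j<n. w j x * ennreal (exp ((S x * sgn (d j x))\<^sup>2 * \<sigma>\<^sup>2 / 2))) \<partial>M)"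
    by (subst nn_integral_add) (auto simp: nn_integral_sum)
  also have "\<dots> \<le> (\<integral>\<^sup>+x. Z x * ennreal (exp ((S x)\<^sup>2 * \<sigma>\<^sup>2 / 2)) \<partial>M)"
  proof (rule nn_integral_mono)
    fix x
    show "z x + (\<Sum>j<n. w j x * ennreal (exp ((S x * sgn (d j x))\<^sup>2 * \<sigma>\<^sup>2 / 2)))
      \<le> Z x * ennreal (exp ((S x)\<^sup>2 * \<sigma>\<^sup>2 / 2))"
    proof (cases "S x = 0")
      case True
      then show ?thesis by (simp add: z_def w_def)
    next
      case False
      have "(\<Sum>j<n. w j x * ennreal (exp ((S x * sgn (d j x))\<^sup>2 * \<sigma>\<^sup>2 / 2)))
          \<le> (\<Sum>j<n. w j x * ennreal (exp ((S x)\<^sup>2 * \<sigma>\<^sup>2 / 2)))"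
        by (intro sum_mono mult_left_mono ennreal_leI) (auto simp: power_mult_distrib sgn_if)
      also have "\<dots> = (\<Sum>j<n. w j x) * ennreal (exp ((S x)\<^sup>2 * \<sigma>\<^sup>2 / 2))"
        by (simp only: sum_distrib_right)
      also have "(\<Sum>j<n. w j x) = Z x * ennreal (\<Sum>j<n. \<bar>d j x\<bar> / S x)"
        unfolding w_def sum_distrib_left[symmetric] by (simp add: S0)
      also have "(\<Sum>j<n. \<bar>d j x\<bar> / S x) = 1"
        using False by (simp add: S_def sum_divide_distrib[symmetric])
      finally show ?thesis using False by (simp add: z_def)
    qed
  qed
  finally show ?thesis by (simp add: S_def)
qed

lemma inverse_sqrt_le_exp:
  fixes x :: real
  assumes "0 \<le> x" "x \<le> 1/2"
  shows "1 / sqrt (1 - x) \<le> exp x"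
proof -
  have "1 \<le> (1 - x) * (1 + 2 * x)" using mult_nonneg_nonneg[of x "1 - 2 * x"] assms by (simp add: algebra_simps)
  also have "\<dots> \<le> (1 - x) * exp (2 * x)" using assms exp_ge_add_one_self[of "2 * x"] by (intro mult_left_mono) auto
  finally have "1 / (1 - x) \<le> exp (2 * x)" using assms by (simp add: field_simps)
  also have "\<dots> = (exp x)\<^sup>2" by (simp add: exp_double)
  finally have "sqrt (1 / (1 - x)) \<le> sqrt ((exp x)\<^sup>2)" by (rule real_sqrt_le_mono)
  then show ?thesis by (simp add: real_sqrt_divide)
qed

text \<open>Convexity again makes separate independence sufficient: with weights q_j / S the
  exponential is dominated by an average of one-dimensional quadratic moments. Replacing S by its
  bound \<open>Q\<close> frees the constant of n, and the limit 1/2 in the hypothesis is the range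
  where 1 / sqrt (1 - x) \<le> exp x is applied.\<close>

lemma (in prob_space) nn_integral_exp_quadratic:
  fixes Z :: "'a \<Rightarrow> ennreal" and q :: "nat \<Rightarrow> real" and Y :: "nat \<Rightarrow> 'a \<Rightarrow> real"
  assumes F: "subalgebra M F" and Z: "Z \<in> borel_measurable F"
    and Y: "\<And>j. gaussian_indep F \<sigma> (Y j)" and q: "\<And>j. 0 < q j" "(\<Sum>j<n. q j) \<le> Q"
    and c: "0 \<le> c" "2 * c * Q * \<sigma>\<^sup>2 \<le> 1/2"
  shows "(\<integral>\<^sup>+x. Z x * ennreal (exp (c * (\<Sum>j<n. q j * (Y j x)\<^sup>2))) \<partial>M)
    \<le> ennreal (exp (2 * c * Q * \<sigma>\<^sup>2)) * (\<integral>\<^sup>+x. Z x \<partial>M)"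
\<comment> \<open>An empty sum has total weight 0 and cannot be normalised.\<close>
proof (cases "n = 0")
  case True
  have "(\<integral>\<^sup>+x. Z x \<partial>M) * 1 \<le> (\<integral>\<^sup>+x. Z x \<partial>M) * ennreal (exp (2 * c * Q * \<sigma>\<^sup>2))"
    using True q(2) c by (intro mult_left_mono) (auto simp: ennreal_1[symmetric] simp del: ennreal_1 intro!: ennreal_leI)
  then show ?thesis using True by (simp add: mult.commute)
next
  case False
  define S where "S = (\<Sum>j<n. q j)"
  have S: "0 < S" unfolding S_def using False q(1) by (intro sum_pos) auto
  note m = measurable_from_subalg[OF F]
  note [measurable] = m[OF Z] gaussian_indep_measurable[OF Y]
  have cQ: "2 * (c * Q) * \<sigma>\<^sup>2 < 1" using c(2) by (simp add: mult.assoc)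
  have cQ0: "0 \<le> 2 * (c * Q) * \<sigma>\<^sup>2" using S q(2) c(1) by (auto simp: S_def)
  have pt: "ennreal (exp (c * (\<Sum>j<n. q j * (Y j x)\<^sup>2)))
      \<le> (\<Sum>j<n. ennreal (q j / S) * ennreal (exp (c * Q * (Y j x)\<^sup>2)))" for x
  proof -
    have "exp (c * (\<Sum>j<n. q j * (Y j x)\<^sup>2)) = exp (\<Sum>j<n. q j * (c * (Y j x)\<^sup>2))"
      by (simp add: sum_distrib_left ac_simps)
    also have "\<dots> \<le> (\<Sum>j<n. q j / S * exp (S * (c * (Y j x)\<^sup>2)))"
      unfolding S_def using S q(1) by (intro exp_sum_le_Jensen) (auto simp: S_def less_imp_le)
    also have "\<dots> \<le> (\<Sum>j<n. q j / S * exp (c * Q * (Y j x)\<^sup>2))"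
    proof (intro sum_mono mult_left_mono)
      fix j
      have "S * (c * (Y j x)\<^sup>2) \<le> Q * (c * (Y j x)\<^sup>2)"
        using q(2) c(1) by (intro mult_right_mono) (auto simp: S_def)
      then show "exp (S * (c * (Y j x)\<^sup>2)) \<le> exp (c * Q * (Y j x)\<^sup>2)" by (simp add: ac_simps)
    qed (use S q(1) in \<open>auto simp: less_imp_le\<close>)
    finally show ?thesis
      using S q(1) by (subst ennreal_mult[symmetric], auto simp: less_imp_le sum_ennreal intro!: ennreal_leI)
  qed
  have "(\<integral>\<^sup>+x. Z x * ennreal (exp (c * (\<Sum>j<n. q j * (Y j x)\<^sup>2))) \<partial>M)
      \<le> (\<integral>\<^sup>+x. (\<Sum>j<n. ennreal (q j / S) * (Z x * ennreal (exp (c * Q * (Y j x)\<^sup>2)))) \<partial>M)"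
  proof (rule nn_integral_mono)
    fix x
    have "Z x * ennreal (exp (c * (\<Sum>j<n. q j * (Y j x)\<^sup>2)))
        \<le> Z x * (\<Sum>j<n. ennreal (q j / S) * ennreal (exp (c * Q * (Y j x)\<^sup>2)))"
      by (intro mult_left_mono pt) simp
    then show "Z x * ennreal (exp (c * (\<Sum>j<n. q j * (Y j x)\<^sup>2)))
        \<le> (\<Sum>j<n. ennreal (q j / S) * (Z x * ennreal (exp (c * Q * (Y j x)\<^sup>2))))"
      by (simp add: sum_distrib_left ac_simps)
  qed
  also have "\<dots> = (\<Sum>j<n. ennreal (q j / S) * (\<integral>\<^sup>+x. Z x * ennreal (exp (c * Q * (Y j x)\<^sup>2)) \<partial>M))"
    by (simp add: nn_integral_sum nn_integral_cmult)
  also have "\<dots> = (\<Sum>j<n. ennreal (q j / S)) * (ennreal (1 / sqrt (1 - 2 * (c * Q) * \<sigma>\<^sup>2)) * (\<integral>\<^sup>+x. Z x \<partial>M))"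
    by (simp only: nn_integral_exp_sq_gaussian_indep[OF F Z Y cQ] sum_distrib_right)
  also have "(\<Sum>j<n. ennreal (q j / S)) = 1"
    using S q(1) by (simp add: sum_ennreal less_imp_le sum_divide_distrib[symmetric] S_def[symmetric])
  also have "1 * (ennreal (1 / sqrt (1 - 2 * (c * Q) * \<sigma>\<^sup>2)) * (\<integral>\<^sup>+x. Z x \<partial>M))
      \<le> ennreal (exp (2 * (c * Q) * \<sigma>\<^sup>2)) * (\<integral>\<^sup>+x. Z x \<partial>M)"
    unfolding mult_1 using c(2) cQ0
    by (intro mult_right_mono ennreal_leI inverse_sqrt_le_exp) (auto simp: mult.assoc)
  finally show ?thesis by (simp add: mult.assoc)
qed

section \<open>A maximal inequality\<close>

text \<open>Weighted arithmetic-geometric mean inequality for 1 and x, that is, convexity of exp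
  between 0 and ln x.\<close>

lemma powr_le_affine:
  fixes x \<rho> :: real
  assumes "0 < x" "0 < \<rho>" "\<rho> < 1"
  shows "x powr \<rho> \<le> 1 - \<rho> + \<rho> * x"
proof -
  have "exp ((1 - \<rho>) *\<^sub>R 0 + \<rho> *\<^sub>R ln x) \<le> (1 - \<rho>) * exp 0 + \<rho> * exp (ln x)"
    using assms by (intro convex_onD[OF exp_convex]) auto
  then show ?thesis using assms(1) by (simp add: powr_def)
qed

text \<open>The potential \<open>m\<^sup>\<rho> + \<rho>/(1-\<rho>) u m\<^sup>\<rho>\<^sup>-\<^sup>1\<close> of the running maximum \<open>m\<close> and the current value \<open>u\<close> of
  a positive supermartingale decreases in mean, since it is dominated by its linear
  continuation in \<open>u\<close> beyond \<open>u = m\<close>.\<close>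

lemma max_potential_le:
  fixes m u \<rho> :: real
  assumes "0 < m" "0 < u" "0 < \<rho>" "\<rho> < 1"
  shows "(max m u) powr \<rho> + \<rho> / (1 - \<rho>) * (u * (max m u) powr (\<rho> - 1))
    \<le> m powr \<rho> + \<rho> / (1 - \<rho>) * (u * m powr (\<rho> - 1))"
proof (cases "u \<le> m")
  case True
  then show ?thesis by (simp add: max_absorb1)
next
  case False
  have u: "u * u powr (\<rho> - 1) = u powr \<rho>" using assms by (simp add: powr_mult_base)
  have "m powr (\<rho> - 1) = m powr \<rho> / m" using assms by (simp add: powr_diff)
  then have m: "u * m powr (\<rho> - 1) = m powr \<rho> * (u / m)" by simp
  have "u powr \<rho> = m powr \<rho> * (u / m) powr \<rho>"
    using assms by (simp add: powr_divide)
  also have "\<dots> \<le> m powr \<rho> * (1 - \<rho> + \<rho> * (u / m))"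
    using assms by (intro mult_left_mono powr_le_affine) auto
  finally have "u powr \<rho> / (1 - \<rho>) \<le> m powr \<rho> * (1 - \<rho> + \<rho> * (u / m)) / (1 - \<rho>)"
    using assms by (intro divide_right_mono) auto
  moreover have "u powr \<rho> + \<rho> / (1 - \<rho>) * u powr \<rho> = u powr \<rho> / (1 - \<rho>)"
    using assms by (simp add: field_simps)
  moreover have "m powr \<rho> + \<rho> / (1 - \<rho>) * (m powr \<rho> * (u / m)) = m powr \<rho> * (1 - \<rho> + \<rho> * (u / m)) / (1 - \<rho>)"
    using assms by (simp add: field_simps)
  ultimately show ?thesis using False by (simp add: u m max_absorb2)
qed

text \<open>A maximal inequality of order \<rho> < 1 without stopping times: the mean of the
  potential does not increase, and its initial value is 1 + \<rho>/(1-\<rho>) = 1/(1-\<rho>). The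
  same constant results from integrating the weak-type bound P(max \<ge> x) \<le> 1/x.\<close>

lemma (in prob_space) supermartingale_maximal:
  fixes U :: "nat \<Rightarrow> 'a \<Rightarrow> real" and G :: "nat \<Rightarrow> 'a measure"
  assumes G: "\<And>n. n \<le> N \<Longrightarrow> subalgebra M (G n)"
    and mono: "\<And>k n. k \<le> n \<Longrightarrow> n \<le> N \<Longrightarrow> subalgebra (G n) (G k)"
    and U: "\<And>n. n \<le> N \<Longrightarrow> U n \<in> borel_measurable (G n)"
    and pos: "\<And>n x. 0 < U n x" and init: "\<And>x. U 0 x = 1"
    and super: "\<And>n Z. n < N \<Longrightarrow> Z \<in> borel_measurable (G n) \<Longrightarrow>
      (\<integral>\<^sup>+x. Z x * ennreal (U (Suc n) x) \<partial>M) \<le> (\<integral>\<^sup>+x. Z x * ennreal (U n x) \<partial>M)"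
    and \<rho>: "0 < \<rho>" "\<rho> < 1"
  shows "(\<integral>\<^sup>+x. ennreal (Max ((\<lambda>k. U k x) ` {0..N}) powr \<rho>) \<partial>M) \<le> ennreal (1 / (1 - \<rho>))"
proof -
  define c where "c = \<rho> / (1 - \<rho>)"
  have c: "0 < c" using \<rho> by (simp add: c_def)
  define m where "m n x = Max ((\<lambda>k. U k x) ` {0..n})" for n x
  have m_Suc: "m (Suc n) x = max (m n x) (U (Suc n) x)" for n x
    by (simp add: m_def atLeastAtMostSuc_conv Max_insert max.commute)
  have m_pos: "0 < m n x" for n x
    unfolding m_def by (rule less_le_trans[OF pos[of 0 x] Max_ge]) auto
  have mG: "m n \<in> borel_measurable (G n)" if "n \<le> N" for n
    using that
  proof (induction n)
    case 0
    then show ?case using U[of 0] by (simp add: m_def[abs_def])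
  next
    case (Suc n)
    have "m n \<in> borel_measurable (G (Suc n))"
      using Suc by (intro measurable_from_subalg[OF mono[of n "Suc n"]]) auto
    then show ?case unfolding m_Suc[abs_def] using U[OF Suc.prems] by measurable
  qed
  have mM: "m n \<in> borel_measurable M" "U n \<in> borel_measurable M" if "n \<le> N" for n
    using that by (auto intro!: measurable_from_subalg[OF G] mG U)
  define I where "I n = (\<integral>\<^sup>+x. ennreal (m n x powr \<rho>) + ennreal c * (ennreal (m n x powr (\<rho> - 1)) * ennreal (U n x)) \<partial>M)" for n
  have "I n \<le> ennreal (1 / (1 - \<rho>))" if "n \<le> N" for n
    using that
  proof (induction n)
    case 0
    have "1 + \<rho> / (1 - \<rho>) = 1 / (1 - \<rho>)" using \<rho> by (simp add: field_simps)
    then have "ennreal 1 + ennreal c = ennreal (1 / (1 - \<rho>))"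
      using c by (simp add: ennreal_plus[symmetric] c_def del: ennreal_plus ennreal_1)
    then show ?case by (simp add: I_def m_def init emeasure_space_1)
  next
    case (Suc n)
    then have n: "n \<le> N" "n < N" "Suc n \<le> N" by auto
    note [measurable] = mM[OF n(1)] mM[OF n(3)]
    \<comment> \<open>Once the maximum is frozen at time n, the potential is affine in the new value
      with a coefficient known at time n; this coefficient is the weight for
      \<open>super\<close>.\<close>
    have ZG: "(\<lambda>x. ennreal (m n x powr (\<rho> - 1))) \<in> borel_measurable (G n)" using mG[OF n(1)] by measurable
    have "I (Suc n) \<le> (\<integral>\<^sup>+x. ennreal (m n x powr \<rho>) + ennreal c * (ennreal (m n x powr (\<rho> - 1)) * ennreal (U (Suc n) x)) \<partial>M)"
      unfolding I_def
    proof (rule nn_integral_mono)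
      fix x
      have "m (Suc n) x powr \<rho> + c * (U (Suc n) x * m (Suc n) x powr (\<rho> - 1))
          \<le> m n x powr \<rho> + c * (U (Suc n) x * m n x powr (\<rho> - 1))"
        unfolding m_Suc c_def by (rule max_potential_le[OF m_pos pos \<rho>])
      then have "ennreal (m (Suc n) x powr \<rho> + c * (U (Suc n) x * m (Suc n) x powr (\<rho> - 1)))
          \<le> ennreal (m n x powr \<rho> + c * (U (Suc n) x * m n x powr (\<rho> - 1)))" by (rule ennreal_leI)
      then show "ennreal (m (Suc n) x powr \<rho>) + ennreal c * (ennreal (m (Suc n) x powr (\<rho> - 1)) * ennreal (U (Suc n) x))
          \<le> ennreal (m n x powr \<rho>) + ennreal c * (ennreal (m n x powr (\<rho> - 1)) * ennreal (U (Suc n) x))"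
        using c pos[of "Suc n" x] by (simp add: ennreal_mult ennreal_plus mult.commute less_imp_le)
    qed
    also have "\<dots> = (\<integral>\<^sup>+x. ennreal (m n x powr \<rho>) \<partial>M)
        + ennreal c * (\<integral>\<^sup>+x. ennreal (m n x powr (\<rho> - 1)) * ennreal (U (Suc n) x) \<partial>M)"
      by (subst nn_integral_add) (auto simp: nn_integral_cmult)
    also have "\<dots> \<le> (\<integral>\<^sup>+x. ennreal (m n x powr \<rho>) \<partial>M)
        + ennreal c * (\<integral>\<^sup>+x. ennreal (m n x powr (\<rho> - 1)) * ennreal (U n x) \<partial>M)"
      by (intro add_left_mono mult_left_mono super[OF n(2) ZG]) auto
    also have "\<dots> = I n"
      unfolding I_def by (subst nn_integral_add) (auto simp: nn_integral_cmult)
    also have "\<dots> \<le> ennreal (1 / (1 - \<rho>))" by (rule Suc.IH[OF n(1)])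
    finally show ?case .
  qed
  from this[OF order_refl] show ?thesis
    unfolding I_def m_def[symmetric] by (rule order_trans[rotated]) (auto intro!: nn_integral_mono)
qed

section \<open>Measurability of functionals on \<open>L\<^sup>2\<close>\<close>

lemma space_L2_borel: "space (L2_borel L) = L2 L"
  unfolding L2_borel_def by (rule space_measure_of) (auto simp: L2_open_def)

lemma sets_L2_borel: "sets (L2_borel L) = sigma_sets (L2 L) {U. L2_open L U}"
  unfolding L2_borel_def by (rule sets_measure_of) (auto simp: L2_open_def)

lemma L2_borel_lipschitz_measurable:
  fixes \<Phi> :: "(real^2 \<Rightarrow> 'b::euclidean_space) \<Rightarrow> real"
  assumes lip: "\<And>f g. f \<in> L2 L \<Longrightarrow> g \<in> L2 L \<Longrightarrow> \<bar>\<Phi> g - \<Phi> f\<bar> \<le> c * L2_norm L (\<lambda>x. g x - f x)" and c: "0 \<le> c"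
  shows "\<Phi> \<in> borel_measurable (L2_borel L)"
proof (rule borel_measurableI)
  fix S :: "real set" assume S: "open S"
  have "L2_open L (\<Phi> -` S \<inter> L2 L)"
    unfolding L2_open_def
  proof (intro conjI ballI)
    fix f assume f: "f \<in> \<Phi> -` S \<inter> L2 L"
    then obtain e where e: "0 < e" "\<And>y. \<bar>y - \<Phi> f\<bar> < e \<Longrightarrow> y \<in> S"
      using S unfolding open_dist by (auto simp: dist_real_def)
    show "\<exists>r>0. \<forall>g\<in>L2 L. L2_norm L (\<lambda>x. g x - f x) < r \<longrightarrow> g \<in> \<Phi> -` S \<inter> L2 L"
    proof (intro exI conjI ballI impI)
      show "0 < e / (c + 1)" using e c by simp
      fix g assume g: "g \<in> L2 L" "L2_norm L (\<lambda>x. g x - f x) < e / (c + 1)"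
      have "\<bar>\<Phi> g - \<Phi> f\<bar> \<le> c * L2_norm L (\<lambda>x. g x - f x)" using lip f g by auto
      also have "\<dots> \<le> c * (e / (c + 1))" using g c by (intro mult_left_mono) auto
      also have "\<dots> < e" using c e by (simp add: field_simps)
      finally show "g \<in> \<Phi> -` S \<inter> L2 L" using e g by auto
    qed
  qed auto
  then show "\<Phi> -` S \<inter> space (L2_borel L) \<in> sets (L2_borel L)"
    by (auto simp: sets_L2_borel space_L2_borel)
qed

lemma L2_norm_borel_measurable [measurable]:
  "(\<lambda>f::real^2 \<Rightarrow> real. L2_norm L f) \<in> borel_measurable (L2_borel L)"
  by (rule L2_borel_lipschitz_measurable[where c=1]) (simp_all add: L2_norm_diff_le)

lemma L2_inner_borel_measurable:
  fixes h :: "real^2 \<Rightarrow> real"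
  assumes "h \<in> L2 L"
  shows "(\<lambda>f. L2_inner L f h) \<in> borel_measurable (L2_borel L)"
proof (rule L2_borel_lipschitz_measurable[where c="L2_norm L h"])
  fix f g :: "real^2 \<Rightarrow> real" assume "f \<in> L2 L" "g \<in> L2 L"
  then show "\<bar>L2_inner L g h - L2_inner L f h\<bar> \<le> L2_norm L h * L2_norm L (\<lambda>x. g x - f x)"
    using L2_Cauchy_Schwarz[OF L2_diff assms, of g f] assms
    by (simp add: L2_inner_diff_left mult.commute)
qed simp

context temp_basis
begin

lemma coef_measurable [measurable]: "(\<lambda>f. coef f j) \<in> borel_measurable (L2_borel L)"
  by (rule L2_inner_borel_measurable[OF zeta_L2])

text \<open>By Parseval the squared norm is a series of measurable coefficients, read in the
  extended reals. It is infinite exactly off \<open>H1\<close>, where the norm is one fixed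
  unspecified number.\<close>

lemma op_power_norm_measurable [measurable]:
  "(\<lambda>f. (L2_norm L (sqrtA f))\<^sup>2) \<in> borel_measurable (L2_borel L)"
proof -
  define S where "S f = (\<Sum>j. ennreal (lam j * (coef f j)\<^sup>2))" for f
  have [measurable]: "S \<in> borel_measurable (L2_borel L)" unfolding S_def by measurable
  have "(L2_norm L (sqrtA f))\<^sup>2
      = (if S f = \<infinity> then (L2_norm L ((SOME g. False) :: real^2 \<Rightarrow> real))\<^sup>2 else enn2real (S f))"
    if f: "f \<in> L2 L" for f
  proof (cases "f \<in> H1")
    case True
    note s = op_power_norm_sums[OF True]
    have "S f = ennreal ((L2_norm L (sqrtA f))\<^sup>2)"
      unfolding S_def using s lam_pos
      by (subst suminf_ennreal2) (auto simp: sums_iff less_imp_le)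
    then show ?thesis by simp
  next
    case False
    have "S f = \<infinity>"
    proof (rule ccontr)
      assume "S f \<noteq> \<infinity>"
      then have "summable (\<lambda>j. lam j * (coef f j)\<^sup>2)"
        unfolding S_def using lam_pos by (intro summable_suminf_not_top) (auto simp: less_imp_le)
      then show False using False f unfolding Hsp_1_iff by blast
    qed
    then show ?thesis using op_power_not_Hsp[OF f False] by simp
  qed
  moreover have "(\<lambda>f. if S f = \<infinity> then (L2_norm L ((SOME g. False) :: real^2 \<Rightarrow> real))\<^sup>2 else enn2real (S f))
      \<in> borel_measurable (L2_borel L)" by measurable
  ultimately show ?thesis by (subst measurable_cong) (auto simp: space_L2_borel)
qed

end

section \<open>The noise and its spectral truncations\<close>

locale temp_noise = temp_basis L lam \<zeta> + prob_space P
  for L :: real and lam :: "nat \<Rightarrow> real" and \<zeta> :: "nat \<Rightarrow> real^2 \<Rightarrow> real" and P :: "'w measure" +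
  fixes F :: "real \<Rightarrow> 'w measure" and q :: "nat \<Rightarrow> real" and b :: "nat \<Rightarrow> real \<Rightarrow> 'w \<Rightarrow> real"
    and W :: "real \<Rightarrow> 'w \<Rightarrow> real^2 \<Rightarrow> real"
  assumes filtered: "filtered_space P F"
    and q_pos: "\<And>j. 0 < q j" and lam_q_summable: "summable (\<lambda>j. lam j * q j)"
    and brownian: "\<And>j. brownian P F (b j)" and wiener: "wiener_series P L q b \<zeta> W"
begin

abbreviation "Tr \<equiv> (\<Sum>j. q j)"

lemma q_summable: "summable q"
proof (rule summable_comparison_test')
  show "summable (\<lambda>j. lam j * q j / lam 0)" using lam_q_summable by (rule summable_divide)
  show "norm (q j) \<le> lam j * q j / lam 0" if "0 \<le> j" for j
    using lam_ge[of j] lam_pos[of 0] q_pos[of j] by (simp add: field_simps)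
qed

lemma Tr_pos: "0 < Tr"
  by (rule suminf_pos[OF q_summable q_pos])

lemma q_partial_le: "(\<Sum>j<n. q j) \<le> Tr"
  by (rule sum_le_suminf[OF q_summable]) (auto simp: q_pos less_imp_le)

lemma subalgebra_F: "0 \<le> t \<Longrightarrow> subalgebra P (F t)"
  using filtered by (simp add: filtered_space_def)

lemma subalgebra_F_mono: "0 \<le> s \<Longrightarrow> s \<le> t \<Longrightarrow> subalgebra (F t) (F s)"
  using filtered by (simp add: filtered_space_def)

lemma increment_gaussian:
  "0 \<le> s \<Longrightarrow> s < t \<Longrightarrow> gaussian_indep (F s) (sqrt (t - s)) (\<lambda>w. b j t w - b j s w)"
  using brownian[of j] by (simp add: brownian_def gaussian_indep_def)

lemma b_measurable_F: "0 \<le> t \<Longrightarrow> b j t \<in> borel_measurable (F t)"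
  using brownian[of j] by (simp add: brownian_def)

lemma W_L2: "0 \<le> t \<Longrightarrow> w \<in> space P \<Longrightarrow> W t w \<in> L2 L"
  using wiener measurable_space[of "W t" P "L2_borel L"] by (auto simp: wiener_series_def space_L2_borel)

definition WJ :: "nat \<Rightarrow> real \<Rightarrow> 'w \<Rightarrow> real^2 \<Rightarrow> real" where
  "WJ J t w x = (\<Sum>j<J. (sqrt (q j) * b j t w) * \<zeta> j x)"

definition err :: "nat \<Rightarrow> real \<Rightarrow> 'w \<Rightarrow> real" where
  "err J t w = (L2_norm L (\<lambda>x. W t w x - WJ J t w x))\<^sup>2"

lemma WJ_L2: "WJ J t w \<in> L2 L"
  unfolding WJ_def by (rule partial_sum_L2)

text \<open>Expanding the square reduces the claim to real random variables; measurability of a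
  difference of two maps into L^2 is thereby avoided.\<close>

lemma err_measurable:
  assumes t: "0 \<le> t"
  shows "err J t \<in> borel_measurable P"
proof -
  have Wm[measurable]: "W t \<in> measurable P (L2_borel L)" using wiener t by (simp add: wiener_series_def)
  have [measurable]: "b j t \<in> borel_measurable P" for j
    by (rule measurable_from_subalg[OF subalgebra_F[OF t] b_measurable_F[OF t]])
  have "err J t w = (L2_norm L (W t w))\<^sup>2 - 2 * (\<Sum>j<J. sqrt (q j) * b j t w * coef (W t w) j)
      + (\<Sum>j<J. (sqrt (q j) * b j t w)\<^sup>2)" if "w \<in> space P" for w
  proof -
    note w = W_L2[OF t that]
    have 1: "L2_inner L (W t w) (WJ J t w) = (\<Sum>j<J. sqrt (q j) * b j t w * coef (W t w) j)"
      unfolding L2_inner_commute[of L "W t w" "WJ J t w"] WJ_def by (rule inner_partial_sum[OF w])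
    have 2: "(L2_norm L (WJ J t w))\<^sup>2 = (\<Sum>j<J. (sqrt (q j) * b j t w)\<^sup>2)"
      unfolding WJ_def by (rule norm_partial_sum) simp
    show ?thesis
      unfolding err_def L2_norm_sq L2_inner_self_diff[OF w WJ_L2] 1 using 2 by (simp add: L2_norm_sq)
  qed
  then show ?thesis by (subst measurable_cong) auto
qed

lemma err_nn_integral_tendsto: "0 \<le> t \<Longrightarrow> (\<lambda>J. \<integral>\<^sup>+w. ennreal (err J t w) \<partial>P) \<longlonglongrightarrow> 0"
  using wiener by (simp add: wiener_series_def err_def WJ_def)

text \<open>Summing the errors over the finite set of times produces a single subsequence, and a
  single null set, for all of them.\<close>

lemma err_AE_subseq:
  assumes A: "finite A" "\<And>t. t \<in> A \<Longrightarrow> 0 \<le> t"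
  shows "\<exists>r::nat \<Rightarrow> nat. AE w in P. \<forall>t\<in>A. (\<lambda>n. err (r n) t w) \<longlonglongrightarrow> 0"
proof -
  define E where "E J w = (\<Sum>t\<in>A. err J t w)" for J w
  have err0: "0 \<le> err J t w" for J t w by (simp add: err_def)
  have E0: "0 \<le> E J w" for J w unfolding E_def by (intro sum_nonneg err0)
  have em: "err J t \<in> borel_measurable P" if "t \<in> A" for J t using that A by (intro err_measurable) auto
  have Em[measurable]: "E J \<in> borel_measurable P" for J unfolding E_def using em by (intro borel_measurable_sum)
  have "(\<integral>\<^sup>+w. ennreal (E J w) \<partial>P) = (\<Sum>t\<in>A. \<integral>\<^sup>+w. ennreal (err J t w) \<partial>P)" for J
    unfolding E_def using em by (subst nn_integral_sum[symmetric]) (auto simp: err0)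
  moreover have "(\<lambda>J. \<Sum>t\<in>A. \<integral>\<^sup>+w. ennreal (err J t w) \<partial>P) \<longlonglongrightarrow> (\<Sum>t\<in>A. 0)"
    using A by (intro tendsto_sum err_nn_integral_tendsto) auto
  ultimately have lim: "(\<lambda>J. \<integral>\<^sup>+w. ennreal (E J w) \<partial>P) \<longlonglongrightarrow> 0" by simp
  then have "\<forall>\<^sub>F J in sequentially. (\<integral>\<^sup>+w. ennreal (E J w) \<partial>P) < 1" by (rule order_tendstoD) simp
  then obtain J0 where J0: "\<And>J. J \<ge> J0 \<Longrightarrow> (\<integral>\<^sup>+w. ennreal (E J w) \<partial>P) < 1"
    by (auto simp: eventually_sequentially)
  \<comment> \<open>The subsequence theorem for L^1 needs integrable functions, which is known only
    from \<open>J0\<close> on, where the integral is below 1.\<close>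
  have int: "integrable P (E (J + J0))" for J
    using J0[of "J + J0"] E0 by (intro integrableI_nonneg) (auto intro: less_trans[OF _ ennreal_one_less_top])
  have "(\<lambda>J. enn2real (\<integral>\<^sup>+w. ennreal (E (J + J0) w) \<partial>P)) \<longlonglongrightarrow> 0"
    by (rule tendsto_enn2real) (use LIMSEQ_ignore_initial_segment[OF lim, of J0] in simp_all)
  then have "(\<lambda>J. \<integral>w. norm (E (J + J0) w) \<partial>P) \<longlonglongrightarrow> 0"
    using E0 int by (simp add: integral_eq_nn_integral)
  then obtain r :: "nat \<Rightarrow> nat" where r: "AE w in P. (\<lambda>n. E (r n + J0) w) \<longlonglongrightarrow> 0"
    using tendsto_L1_AE_subseq[of P "\<lambda>J. E (J + J0)", OF int] by blast
  have "AE w in P. \<forall>t\<in>A. (\<lambda>n. err (r n + J0) t w) \<longlonglongrightarrow> 0"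
    using r
  proof eventually_elim
    case (elim w)
    show ?case
    proof
      fix t assume "t \<in> A"
      then have "norm (err J t w) \<le> E J w" for J
        unfolding E_def using A(1) err0 member_le_sum[of t A "\<lambda>t. err J t w"] by simp
      then show "(\<lambda>n. err (r n + J0) t w) \<longlonglongrightarrow> 0"
        by (intro Lim_null_comparison[OF _ elim] always_eventually allI)
    qed
  qed
  then show ?thesis by (intro exI[of _ "\<lambda>n. r n + J0"])
qed

text \<open>For a fixed outcome the truncated increments converge in L^2(D), the error being at most
  the sum of the errors at the two times; continuity of inner product and norm does the rest. The
  outcome being fixed, \<open>f\<close> may depend on it.\<close>

lemma increment_limit:
  assumes st: "0 \<le> s" "0 \<le> t" and w: "w \<in> space P" and f: "f \<in> L2 L"
    and e: "(\<lambda>n. err (r n) s w) \<longlonglongrightarrow> 0" "(\<lambda>n. err (r n) t w) \<longlonglongrightarrow> 0"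
  shows "(\<lambda>n. \<Sum>j<r n. sqrt (q j) * coef f j * (b j t w - b j s w))
      \<longlonglongrightarrow> L2_inner L (\<lambda>x. W t w x - W s w x) f"
    and "(\<lambda>n. \<Sum>j<r n. q j * (b j t w - b j s w)\<^sup>2)
      \<longlonglongrightarrow> (L2_norm L (\<lambda>x. W t w x - W s w x))\<^sup>2"
proof -
  let ?d = "\<lambda>x. W t w x - W s w x"
  define V where "V n x = (\<Sum>j<r n. (sqrt (q j) * (b j t w - b j s w)) * \<zeta> j x)" for n x
  have V: "V n \<in> L2 L" for n unfolding V_def by (rule partial_sum_L2)
  have Wt: "W t w \<in> L2 L" and Ws: "W s w \<in> L2 L" using st w by (auto intro: W_L2)
  have eq: "V n x - ?d x = (WJ (r n) t w x - W t w x) + (W s w x - WJ (r n) s w x)" for n x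
    by (simp add: V_def WJ_def algebra_simps sum_subtractf)
  have lim: "(\<lambda>n. L2_norm L (\<lambda>x. V n x - ?d x)) \<longlonglongrightarrow> 0"
  proof (rule Lim_null_comparison)
    have "(\<lambda>n. sqrt (err (r n) t w) + sqrt (err (r n) s w)) \<longlonglongrightarrow> sqrt 0 + sqrt 0"
      by (intro tendsto_intros e)
    then show "(\<lambda>n. sqrt (err (r n) t w) + sqrt (err (r n) s w)) \<longlonglongrightarrow> 0" by simp
    show "\<forall>\<^sub>F n in sequentially. norm (L2_norm L (\<lambda>x. V n x - ?d x)) \<le> sqrt (err (r n) t w) + sqrt (err (r n) s w)"
    proof (intro always_eventually allI)
      fix n
      have "L2_norm L (\<lambda>x. V n x - ?d x) \<le> L2_norm L (\<lambda>x. WJ (r n) t w x - W t w x) + L2_norm L (\<lambda>x. W s w x - WJ (r n) s w x)"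
        unfolding eq by (intro L2_norm_triangle L2_diff WJ_L2 Wt Ws)
      then show "norm (L2_norm L (\<lambda>x. V n x - ?d x)) \<le> sqrt (err (r n) t w) + sqrt (err (r n) s w)"
        by (simp add: err_def L2_norm_minus_commute[of L "WJ (r n) t w"])
    qed
  qed
  have d: "?d \<in> L2 L" by (intro L2_diff Wt Ws)
  have "L2_inner L (V n) f = (\<Sum>j<r n. sqrt (q j) * coef f j * (b j t w - b j s w))" for n
    unfolding V_def inner_partial_sum[OF f] by (simp add: ac_simps)
  then show "(\<lambda>n. \<Sum>j<r n. sqrt (q j) * coef f j * (b j t w - b j s w)) \<longlonglongrightarrow> L2_inner L ?d f"
    using L2_inner_tendsto[OF V d f lim] by simp
  have "(L2_norm L (V n))\<^sup>2 = (\<Sum>j<r n. q j * (b j t w - b j s w)\<^sup>2)" for n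
    unfolding V_def by (subst norm_partial_sum) (auto simp: power_mult_distrib q_pos less_imp_le)
  then show "(\<lambda>n. \<Sum>j<r n. q j * (b j t w - b j s w)\<^sup>2) \<longlonglongrightarrow> (L2_norm L ?d)\<^sup>2"
    using tendsto_power[OF L2_norm_tendsto[OF V d lim], of 2] by simp
qed

end

section \<open>Exponential moments of the scheme\<close>

locale temp_scheme = temp_noise L lam \<zeta> P F q b W
  for L :: real and lam :: "nat \<Rightarrow> real" and \<zeta> :: "nat \<Rightarrow> real^2 \<Rightarrow> real" and P :: "'w measure"
    and F :: "real \<Rightarrow> 'w measure" and q :: "nat \<Rightarrow> real" and b :: "nat \<Rightarrow> real \<Rightarrow> 'w \<Rightarrow> real"
    and W :: "real \<Rightarrow> 'w \<Rightarrow> real^2 \<Rightarrow> real" +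
  fixes T \<nu> \<kappa> :: real and V :: "real \<Rightarrow> 'w \<Rightarrow> real^2 \<Rightarrow> real^2"
    and u0 :: "'w \<Rightarrow> real^2 \<Rightarrow> real^2" and \<theta>0 :: "'w \<Rightarrow> real^2 \<Rightarrow> real" and N :: nat
    and u :: "nat \<Rightarrow> 'w \<Rightarrow> real^2 \<Rightarrow> real^2" and \<theta> :: "nat \<Rightarrow> 'w \<Rightarrow> real^2 \<Rightarrow> real"
  assumes T_pos: "0 < T" and \<kappa>_pos: "0 < \<kappa>" and N_pos: "0 < N"
    and u0_divfree: "\<And>w. w \<in> space P \<Longrightarrow> u0 w \<in> Vsp L 0"
    and \<theta>0_measurable: "\<theta>0 \<in> measurable (F 0) (L2_borel L)"
    and scheme: "euler_scheme P F L T \<nu> \<kappa> lam \<zeta> V W u0 \<theta>0 N u \<theta>"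
begin

definition h :: real where "h = T / real N"
definition \<tau> :: "nat \<Rightarrow> real" where "\<tau> l = real l * h"
abbreviation "nrm l w \<equiv> (L2_norm L (\<theta> l w))\<^sup>2"
abbreviation "diss l w \<equiv> (L2_norm L (sqrtA (\<theta> l w)))\<^sup>2"
abbreviation "energy_max \<equiv> max_energy L T \<kappa> lam \<zeta> N \<theta>"
text \<open>The index is that of the left end point: \<open>dW l\<close> drives the step from
  \<open>\<theta> l\<close> to \<open>\<theta> (Suc l)\<close> and is paired with the temperature
  known at its start.\<close>

abbreviation "dW l w \<equiv> (\<lambda>x. W (\<tau> (Suc l)) w x - W (\<tau> l) w x)"
abbreviation "db l j w \<equiv> b j (\<tau> (Suc l)) w - b j (\<tau> l) w"

lemma h_pos: "0 < h" using T_pos N_pos by (simp add: h_def)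

lemma \<tau>_nonneg: "0 \<le> \<tau> l" using h_pos by (simp add: \<tau>_def)

lemma \<tau>_mono: "k \<le> l \<Longrightarrow> \<tau> k \<le> \<tau> l"
  using h_pos by (simp add: \<tau>_def)

lemma \<tau>_Suc: "\<tau> (Suc l) - \<tau> l = h" by (simp add: \<tau>_def algebra_simps)

lemma \<tau>_less: "\<tau> l < \<tau> (Suc l)" using \<tau>_Suc[of l] h_pos by linarith

lemmas scheme_steps = scheme[unfolded euler_scheme_def Let_def, folded h_def, folded \<tau>_def]

lemma init: "u 0 = u0" "\<theta> 0 = \<theta>0"
  using scheme_steps by auto

lemma \<theta>_measurable_F: "l \<le> N \<Longrightarrow> \<theta> l \<in> measurable (F (\<tau> l)) (L2_borel L)"
  using scheme_steps \<theta>0_measurable by (cases "l = 0") (auto simp: \<tau>_def)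

lemma \<theta>_measurable: "l \<le> N \<Longrightarrow> \<theta> l \<in> measurable P (L2_borel L)"
  by (rule measurable_from_subalg[OF subalgebra_F[OF \<tau>_nonneg] \<theta>_measurable_F])

lemma \<theta>_L2: "l \<le> N \<Longrightarrow> w \<in> space P \<Longrightarrow> \<theta> l w \<in> L2 L"
  using measurable_space[OF \<theta>_measurable] by (simp add: space_L2_borel)

lemma max_energy_measurable: "energy_max \<in> borel_measurable P"
proof -
  have m1: "nrm l \<in> borel_measurable P" if "l \<le> N" for l
    using measurable_compose[OF \<theta>_measurable[OF that] L2_norm_borel_measurable] by measurable
  have m2: "diss l \<in> borel_measurable P" if "l \<le> N" for l
    using measurable_compose[OF \<theta>_measurable[OF that] op_power_norm_measurable] .
  show ?thesis
    unfolding max_energy_def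
    by (intro borel_measurable_Max borel_measurable_add borel_measurable_times borel_measurable_sum
        borel_measurable_const) (auto intro: m1 m2)
qed

lemma energy_step_AE:
  "AE w in P. \<forall>l<N. \<theta> (Suc l) w \<in> H1 \<and>
     nrm (Suc l) w + 2 * h * \<kappa> * diss (Suc l) w
       \<le> nrm l w + 2 * L2_inner L (dW l w) (\<theta> l w) + (L2_norm L (dW l w))\<^sup>2"
proof -
  have "AE w in P. \<forall>l\<in>{1..N}. u l w \<in> Vsp L 1 \<and>
     euler_temperature_step L lam \<zeta> \<kappa> h (u (l - 1) w) (\<theta> (l - 1) w)
       (\<lambda>x. W (\<tau> l) w x - W (\<tau> (l - 1)) w x) (\<theta> l w)"
  proof (rule eventually_ball_finite)
    show "\<forall>l\<in>{1..N}. AE w in P. u l w \<in> Vsp L 1 \<and>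
      euler_temperature_step L lam \<zeta> \<kappa> h (u (l - 1) w) (\<theta> (l - 1) w)
       (\<lambda>x. W (\<tau> l) w x - W (\<tau> (l - 1)) w x) (\<theta> l w)"
    proof
      fix l assume "l \<in> {1..N}"
      then have "AE w in P. euler_velocity_step L \<nu> h (u (l - 1) w) (\<theta> (l - 1) w)
               (\<lambda>x. V (\<tau> l) w x - V (\<tau> (l - 1)) w x) (u l w) \<and>
             euler_temperature_step L lam \<zeta> \<kappa> h (u (l - 1) w) (\<theta> (l - 1) w)
               (\<lambda>x. W (\<tau> l) w x - W (\<tau> (l - 1)) w x) (\<theta> l w)"
        using scheme_steps by blast
      then show "AE w in P. u l w \<in> Vsp L 1 \<and>
        euler_temperature_step L lam \<zeta> \<kappa> h (u (l - 1) w) (\<theta> (l - 1) w)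
          (\<lambda>x. W (\<tau> l) w x - W (\<tau> (l - 1)) w x) (\<theta> l w)"
        by eventually_elim (auto simp: euler_velocity_step_def)
    qed
  qed simp
  with AE_space show ?thesis
  proof eventually_elim
    case (elim w)
    show ?case
    proof (intro allI impI)
      fix l assume l: "l < N"
      have step: "euler_temperature_step L lam \<zeta> \<kappa> h (u l w) (\<theta> l w) (dW l w) (\<theta> (Suc l) w)"
        using elim(2) l by (auto dest!: bspec[of _ _ "Suc l"])
      \<comment> \<open>The initial velocity is assumed to lie in V^0; later velocities lie in V^1
        by the velocity step, from which nothing else is used.\<close>
      have "u l w \<in> L2 L \<and> divfree L (u l w)"
      proof (cases "l = 0")
        case True
        then show ?thesis using u0_divfree[OF elim(1)] by (simp add: init Vsp_def)
      next
        case False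
        then have "u l w \<in> Vsp L 1" using elim(2) l by simp
        then show ?thesis by (simp add: Vsp_def)
      qed
      moreover have "\<theta> l w \<in> L2 L" using \<theta>_L2 l elim(1) by simp
      moreover have "dW l w \<in> L2 L" by (intro L2_diff W_L2 \<tau>_nonneg elim(1))
      ultimately show "\<theta> (Suc l) w \<in> H1 \<and>
         nrm (Suc l) w + 2 * h * \<kappa> * diss (Suc l) w
           \<le> nrm l w + 2 * L2_inner L (dW l w) (\<theta> l w) + (L2_norm L (dW l w))\<^sup>2"
        using energy_identity(1)[OF step] energy_inequality[OF step] by blast
    qed
  qed
qed

lemma energy_sum_AE:
  "AE w in P. \<forall>n\<le>N. nrm n w + h * \<kappa> * (\<Sum>l=1..n. diss l w)
     \<le> (1 + h * \<kappa> * lam 0) * nrm 0 w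
       + (\<Sum>l<n. 2 * L2_inner L (dW l w) (\<theta> l w) - h * \<kappa> * lam 0 * nrm l w)
       + (\<Sum>l<N. (L2_norm L (dW l w))\<^sup>2)"
  using energy_step_AE
proof eventually_elim
  case (elim w)
  let ?I = "\<lambda>l. L2_inner L (dW l w) (\<theta> l w)" and ?Q = "\<lambda>l. (L2_norm L (dW l w))\<^sup>2"
  have hk: "0 < h * \<kappa>" using h_pos \<kappa>_pos by (rule mult_pos_pos)
  have energy: "nrm n w + 2 * (h * \<kappa>) * (\<Sum>l=1..n. diss l w) \<le> nrm 0 w + (\<Sum>l<n. 2 * ?I l) + (\<Sum>l<n. ?Q l)"
    if "n \<le> N" for n
    using that
  proof (induction n)
    case (Suc n)
    then show ?case using elim[rule_format, of n] by (simp add: algebra_simps)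
  qed simp
  \<comment> \<open>The Poincare inequality is available from l = 1 on, since the initial
    temperature need not lie in \<open>H1\<close>. The term for l = 0 is added by hand and becomes
    the factor 1 + h \<kappa> \<open>lam 0\<close> in front of \<open>nrm 0\<close>.\<close>
  have diss: "(\<Sum>l\<le>n. lam 0 * nrm l w) \<le> lam 0 * nrm 0 w + (\<Sum>l=1..n. diss l w)" if "n \<le> N" for n
    using that
  proof (induction n)
    case (Suc n)
    then show ?case using poincare[of "\<theta> (Suc n) w"] elim[rule_format, of n] by simp
  qed simp
  show ?case
  proof (intro allI impI)
    fix n assume n: "n \<le> N"
    \<comment> \<open>Extending the quadratic sum to all N steps removes its dependence on n, so it
      stays outside the maximum.\<close>
    have "(\<Sum>l<n. ?Q l) \<le> (\<Sum>l<N. ?Q l)" using n by (intro sum_mono2) auto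
    moreover have "(\<Sum>l<n. lam 0 * nrm l w) \<le> (\<Sum>l\<le>n. lam 0 * nrm l w)"
      using lam_pos[of 0] by (intro sum_mono2) auto
    then have "h * \<kappa> * (\<Sum>l<n. lam 0 * nrm l w) \<le> h * \<kappa> * (lam 0 * nrm 0 w + (\<Sum>l=1..n. diss l w))"
      using diss[OF n] hk by (intro mult_left_mono) auto
    moreover have "(\<Sum>l<n. 2 * ?I l - h * \<kappa> * lam 0 * nrm l w)
        = (\<Sum>l<n. 2 * ?I l) - h * \<kappa> * (\<Sum>l<n. lam 0 * nrm l w)"
      by (simp only: sum_subtractf sum_distrib_left mult.assoc)
    ultimately show "nrm n w + h * \<kappa> * (\<Sum>l=1..n. diss l w)
     \<le> (1 + h * \<kappa> * lam 0) * nrm 0 w + (\<Sum>l<n. 2 * ?I l - h * \<kappa> * lam 0 * nrm l w) + (\<Sum>l<N. ?Q l)"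
      using energy[OF n] unfolding distrib_left distrib_right mult_1 by (simp only: mult.assoc)
  qed
qed

definition \<alpha> :: real where "\<alpha> = \<kappa> * lam 0 / (2 * Tr)"

text \<open>Cut to J modes because independence of the past is given for single Brownian motions;
  the moment bounds that follow hold uniformly in \<open>J\<close>.\<close>

definition Y :: "nat \<Rightarrow> nat \<Rightarrow> 'w \<Rightarrow> real" where
  "Y J n w = (\<Sum>l<n. 2 * (\<Sum>j<J. sqrt (q j) * coef (\<theta> l w) j * db l j w) - h * \<kappa> * lam 0 * nrm l w)"

definition Q :: "nat \<Rightarrow> nat \<Rightarrow> 'w \<Rightarrow> real" where
  "Q J n w = (\<Sum>l<n. \<Sum>j<J. q j * (db l j w)\<^sup>2)"

lemma \<alpha>_pos: "0 < \<alpha>"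
  using \<kappa>_pos lam_pos Tr_pos by (simp add: \<alpha>_def)

lemma measurable_F_mono: "f \<in> borel_measurable (F (\<tau> k)) \<Longrightarrow> k \<le> n \<Longrightarrow> f \<in> borel_measurable (F (\<tau> n))"
  by (rule measurable_from_subalg[OF subalgebra_F_mono[OF \<tau>_nonneg \<tau>_mono]])

lemma b_measurable_\<tau>: "k \<le> n \<Longrightarrow> b j (\<tau> k) \<in> borel_measurable (F (\<tau> n))"
  by (rule measurable_F_mono[OF b_measurable_F[OF \<tau>_nonneg]])

lemma coef_measurable_\<tau>: "k \<le> n \<Longrightarrow> n \<le> N \<Longrightarrow> (\<lambda>w. coef (\<theta> k w) j) \<in> borel_measurable (F (\<tau> n))"
  by (rule measurable_F_mono[OF measurable_compose[OF \<theta>_measurable_F coef_measurable]]) auto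

lemma nrm_measurable_\<tau>: "k \<le> n \<Longrightarrow> n \<le> N \<Longrightarrow> nrm k \<in> borel_measurable (F (\<tau> n))"
  by (intro borel_measurable_power measurable_F_mono[OF measurable_compose[OF \<theta>_measurable_F L2_norm_borel_measurable]]) auto

lemma Y_measurable: "n \<le> N \<Longrightarrow> Y J n \<in> borel_measurable (F (\<tau> n))"
  unfolding Y_def
  by (intro borel_measurable_sum borel_measurable_diff borel_measurable_times borel_measurable_const)
    (auto intro!: coef_measurable_\<tau> b_measurable_\<tau> nrm_measurable_\<tau>)

lemma Q_measurable: "Q J n \<in> borel_measurable (F (\<tau> n))"
  unfolding Q_def
  by (intro borel_measurable_sum borel_measurable_diff borel_measurable_times borel_measurable_const
      borel_measurable_power) (auto intro!: b_measurable_\<tau>)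

lemma db_gaussian: "gaussian_indep (F (\<tau> l)) (sqrt h) (db l j)"
  using increment_gaussian[OF \<tau>_nonneg \<tau>_less] unfolding \<tau>_Suc .

text \<open>Jensen's inequality leaves the sum of the moduli of the coefficients, not of their
  squares. The Cauchy-Schwarz inequality controls it at the price of the full trace, which is how
  Tr(Q) enters \<alpha>.\<close>

lemma coef_sum_le:
  assumes "f \<in> L2 L"
  shows "(\<Sum>j<J. \<bar>sqrt (q j) * coef f j\<bar>)\<^sup>2 \<le> Tr * (L2_norm L f)\<^sup>2"
proof -
  have "(\<Sum>j<J. \<bar>sqrt (q j) * coef f j\<bar>)\<^sup>2 = (\<Sum>j<J. sqrt (q j) * \<bar>coef f j\<bar>)\<^sup>2"
    using q_pos by (simp add: abs_mult less_imp_le)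
  also have "\<dots> \<le> (\<Sum>j<J. (sqrt (q j))\<^sup>2) * (\<Sum>j<J. \<bar>coef f j\<bar>\<^sup>2)"
    by (rule Cauchy_Schwarz_ineq_sum)
  also have "\<dots> = (\<Sum>j<J. q j) * (\<Sum>j<J. (coef f j)\<^sup>2)"
    using q_pos by (simp add: less_imp_le)
  also have "\<dots> \<le> Tr * (L2_norm L f)\<^sup>2"
  proof (intro mult_mono q_partial_le)
    show "(\<Sum>j<J. (coef f j)\<^sup>2) \<le> (L2_norm L f)\<^sup>2"
      using sum_le_suminf[of "\<lambda>j. (coef f j)\<^sup>2" "{..<J}"] norm_sq_sums[OF assms] by (simp add: sums_iff)
  qed (use Tr_pos in \<open>auto intro!: sum_nonneg\<close>)
  finally show ?thesis .
qed

lemma exp_Y_super: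
  assumes n: "n < N" and Z: "Z \<in> borel_measurable (F (\<tau> n))"
  shows "(\<integral>\<^sup>+w. Z w * ennreal (exp (\<alpha> * Y J (Suc n) w)) \<partial>P) \<le> (\<integral>\<^sup>+w. Z w * ennreal (exp (\<alpha> * Y J n w)) \<partial>P)"
proof -
  \<comment> \<open>The compensator of the coming step is already known at its beginning, so it
    joins the weight and only an exponent linear in the increments is left.\<close>
  define Z' where "Z' w = Z w * ennreal (exp (\<alpha> * Y J n w - \<alpha> * (h * \<kappa> * lam 0 * nrm n w)))" for w
  define d where "d j w = 2 * \<alpha> * (sqrt (q j) * coef (\<theta> n w) j)" for j w
  have dm: "d j \<in> borel_measurable (F (\<tau> n))" for j
    unfolding d_def using coef_measurable_\<tau>[OF order_refl less_imp_le[OF n], of j] by measurable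
  have Z': "Z' \<in> borel_measurable (F (\<tau> n))"
    unfolding Z'_def using Z Y_measurable[OF less_imp_le[OF n], of J]
      nrm_measurable_\<tau>[OF order_refl less_imp_le[OF n]] by measurable
  have "Z w * ennreal (exp (\<alpha> * Y J (Suc n) w)) = Z' w * ennreal (exp (\<Sum>j<J. d j w * db n j w))" for w
  proof -
    have "\<alpha> * Y J (Suc n) w = (\<alpha> * Y J n w - \<alpha> * (h * \<kappa> * lam 0 * nrm n w)) + (\<Sum>j<J. d j w * db n j w)"
      unfolding Y_def d_def by (simp add: algebra_simps sum_distrib_left)
    then show ?thesis by (simp add: Z'_def exp_add ennreal_mult mult.assoc)
  qed
  then have "(\<integral>\<^sup>+w. Z w * ennreal (exp (\<alpha> * Y J (Suc n) w)) \<partial>P)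
      = (\<integral>\<^sup>+w. Z' w * ennreal (exp (\<Sum>j<J. d j w * db n j w)) \<partial>P)" by simp
  also have "\<dots> \<le> (\<integral>\<^sup>+w. Z' w * ennreal (exp ((\<Sum>j<J. \<bar>d j w\<bar>)\<^sup>2 * (sqrt h)\<^sup>2 / 2)) \<partial>P)"
    by (rule nn_integral_exp_linear[OF subalgebra_F[OF \<tau>_nonneg] Z' dm db_gaussian])
  also have "\<dots> \<le> (\<integral>\<^sup>+w. Z w * ennreal (exp (\<alpha> * Y J n w)) \<partial>P)"
  proof (rule nn_integral_mono)
    fix w assume w: "w \<in> space P"
    have "(\<Sum>j<J. \<bar>d j w\<bar>) = 2 * \<alpha> * (\<Sum>j<J. \<bar>sqrt (q j) * coef (\<theta> n w) j\<bar>)"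
      using \<alpha>_pos by (simp add: d_def sum_distrib_left abs_mult mult.assoc)
    then have "(\<Sum>j<J. \<bar>d j w\<bar>)\<^sup>2 * (sqrt h)\<^sup>2 / 2
        = 2 * \<alpha>\<^sup>2 * h * (\<Sum>j<J. \<bar>sqrt (q j) * coef (\<theta> n w) j\<bar>)\<^sup>2"
      using h_pos by (simp add: power_mult_distrib)
    also have "\<dots> \<le> 2 * \<alpha>\<^sup>2 * h * (Tr * nrm n w)"
      using coef_sum_le[OF \<theta>_L2[of n, OF _ w]] n h_pos by (intro mult_left_mono) auto
    also have "\<dots> = \<alpha> * (h * (2 * \<alpha> * Tr) * nrm n w)" by (simp add: power2_eq_square)
    \<comment> \<open>Here the defining relation of \<alpha> makes the Gaussian cost fit under the
      compensator.\<close>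
    also have "2 * \<alpha> * Tr = \<kappa> * lam 0" using Tr_pos by (simp add: \<alpha>_def)
    finally have le: "(\<Sum>j<J. \<bar>d j w\<bar>)\<^sup>2 * (sqrt h)\<^sup>2 / 2 \<le> \<alpha> * (h * \<kappa> * lam 0 * nrm n w)"
      by (simp only: mult.assoc)
    have "Z' w * ennreal (exp ((\<Sum>j<J. \<bar>d j w\<bar>)\<^sup>2 * (sqrt h)\<^sup>2 / 2))
        \<le> Z' w * ennreal (exp (\<alpha> * (h * \<kappa> * lam 0 * nrm n w)))"
      using le by (intro mult_left_mono ennreal_leI) auto
    also have "\<dots> = Z w * ennreal (exp (\<alpha> * Y J n w))"
      unfolding Z'_def mult.assoc ennreal_mult[symmetric, OF exp_ge_zero exp_ge_zero] exp_add[symmetric] by simp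
    finally show "Z' w * ennreal (exp ((\<Sum>j<J. \<bar>d j w\<bar>)\<^sup>2 * (sqrt h)\<^sup>2 / 2))
        \<le> Z w * ennreal (exp (\<alpha> * Y J n w))" .
  qed
  finally show ?thesis .
qed

lemma exp_max_Y:
  assumes \<rho>: "0 < \<rho>" "\<rho> < 1"
  shows "(\<integral>\<^sup>+w. ennreal (exp (\<rho> * \<alpha> * Max ((\<lambda>n. Y J n w) ` {0..N}))) \<partial>P) \<le> ennreal (1 / (1 - \<rho>))"
proof -
  have "(\<integral>\<^sup>+w. ennreal (Max ((\<lambda>n. exp (\<alpha> * Y J n w)) ` {0..N}) powr \<rho>) \<partial>P) \<le> ennreal (1 / (1 - \<rho>))"
  proof (rule supermartingale_maximal[where G="\<lambda>n. F (\<tau> n)", OF _ _ _ _ _ _ \<rho>])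
    show "subalgebra P (F (\<tau> n))" for n by (rule subalgebra_F[OF \<tau>_nonneg])
    show "subalgebra (F (\<tau> n)) (F (\<tau> k))" if "k \<le> n" for k n by (rule subalgebra_F_mono[OF \<tau>_nonneg \<tau>_mono[OF that]])
    show "(\<lambda>w. exp (\<alpha> * Y J n w)) \<in> borel_measurable (F (\<tau> n))" if "n \<le> N" for n
      using Y_measurable[OF that] by measurable
    show "exp (\<alpha> * Y J 0 w) = 1" for w by (simp add: Y_def)
  qed (auto intro: exp_Y_super)
  moreover have "Max ((\<lambda>n. exp (\<alpha> * Y J n w)) ` {0..N}) powr \<rho> = exp (\<rho> * \<alpha> * Max ((\<lambda>n. Y J n w) ` {0..N}))" for w
  proof -
    have "mono (\<lambda>y. exp (\<alpha> * y))" using \<alpha>_pos by (intro monoI) simp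
    then have "exp (\<alpha> * Max ((\<lambda>n. Y J n w) ` {0..N})) = Max ((\<lambda>y. exp (\<alpha> * y)) ` (\<lambda>n. Y J n w) ` {0..N})"
      by (rule mono_Max_commute) auto
    then have "Max ((\<lambda>n. exp (\<alpha> * Y J n w)) ` {0..N}) = exp (\<alpha> * Max ((\<lambda>n. Y J n w) ` {0..N}))"
      by (simp add: image_image)
    then show ?thesis by (simp add: powr_def ac_simps)
  qed
  ultimately show ?thesis by simp
qed

text \<open>Each step contributes one factor exp (2 c Tr h), the previous ones serving as weight.
  After N steps the product is exp (2 c Tr T), in which N no longer occurs.\<close>

lemma exp_Q:
  assumes c: "0 \<le> c" "2 * c * Tr * h \<le> 1/2"
  shows "(\<integral>\<^sup>+w. ennreal (exp (c * Q J n w)) \<partial>P) \<le> ennreal (exp (real n * (2 * c * Tr * h)))"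
proof (induction n)
  case 0
  show ?case by (simp add: Q_def emeasure_space_1)
next
  case (Suc n)
  have sq: "(sqrt h)\<^sup>2 = h" using h_pos by simp
  have Z: "(\<lambda>w. ennreal (exp (c * Q J n w))) \<in> borel_measurable (F (\<tau> n))"
    using Q_measurable[of J n] by measurable
  have "(\<integral>\<^sup>+w. ennreal (exp (c * Q J (Suc n) w)) \<partial>P)
      = (\<integral>\<^sup>+w. ennreal (exp (c * Q J n w)) * ennreal (exp (c * (\<Sum>j<J. q j * (db n j w)\<^sup>2))) \<partial>P)"
    by (simp add: Q_def distrib_left exp_add ennreal_mult)
  also have "\<dots> \<le> ennreal (exp (2 * c * Tr * (sqrt h)\<^sup>2)) * (\<integral>\<^sup>+w. ennreal (exp (c * Q J n w)) \<partial>P)"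
    using c by (intro nn_integral_exp_quadratic[OF subalgebra_F[OF \<tau>_nonneg] Z db_gaussian q_pos q_partial_le])
      (simp_all only: sq)
  also have "\<dots> \<le> ennreal (exp (2 * c * Tr * h)) * ennreal (exp (real n * (2 * c * Tr * h)))"
    unfolding sq by (intro mult_left_mono Suc) simp
  also have "\<dots> = ennreal (exp (real (Suc n) * (2 * c * Tr * h)))"
    unfolding ennreal_mult[symmetric, OF exp_ge_zero exp_ge_zero] exp_add[symmetric]
    by (simp only: of_nat_Suc distrib_right mult_1)
  finally show ?case .
qed

end

section \<open>Separation of the three contributions and choice of the weights\<close>

lemma exp_convex_combination3:
  fixes a b c :: real
  assumes "0 \<le> s1" "0 \<le> s2" "0 \<le> s3" "s1 + s2 + s3 = 1"
  shows "exp (s1 * a + s2 * b + s3 * c) \<le> s1 * exp a + s2 * exp b + s3 * exp c"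
proof -
  define m where "m = s1 * a + s2 * b + s3 * c"
  \<comment> \<open>Tangent of exp at the weighted mean \<open>m\<close>; the weighted average of
    the tangent values is exactly \<open>exp m\<close>.\<close>
  have t: "exp m * (1 + (y - m)) \<le> exp y" for y
    using mult_left_mono[OF exp_ge_add_one_self[of "y - m"], of "exp m"] by (simp add: exp_diff)
  have "s1 * (1 + (a - m)) + s2 * (1 + (b - m)) + s3 * (1 + (c - m)) = (s1 + s2 + s3) * (1 - m) + m"
    by (simp add: m_def algebra_simps)
  then have "exp m = s1 * (exp m * (1 + (a - m))) + s2 * (exp m * (1 + (b - m))) + s3 * (exp m * (1 + (c - m)))"
    using assms(4) by (metis (no_types, opaque_lifting) distrib_left mult.left_commute mult.right_neutral mult_1 diff_add_cancel)
  also have "\<dots> \<le> s1 * exp a + s2 * exp b + s3 * exp c"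
    using assms by (intro add_mono mult_left_mono t)
  finally show ?thesis by (simp add: m_def)
qed

text \<open>For J modes convexity splits the exponential into three expectations already bounded,
  and Fatou's lemma removes the truncation. \<open>C\<close> contains neither h nor N, which is the
  uniformity required.\<close>

lemma (in temp_scheme) exp_max_energy_le:
  assumes \<beta>: "0 < \<beta>" and s: "0 < s1" "0 < s2" "0 < s3" "s1 + s2 + s3 = 1"
    and int: "integrable P (\<lambda>w. exp (\<gamma> * (L2_norm L (\<theta>0 w))\<^sup>2))"
    and c1: "\<beta> * (1 + h * \<kappa> * lam 0) \<le> s1 * \<gamma>" and c2: "2 * \<beta> \<le> s2 * \<alpha>"
    and c3: "2 * (\<beta> / s3) * Tr * h \<le> 1/2"
  defines "C \<equiv> expectation (\<lambda>w. exp (\<gamma> * (L2_norm L (\<theta>0 w))\<^sup>2)) + 2 + exp (2 * (\<beta> / s3) * Tr * T)"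
  shows "integrable P (\<lambda>w. exp (\<beta> * energy_max w))"
    and "expectation (\<lambda>w. exp (\<beta> * energy_max w)) \<le> C"
proof -
  \<comment> \<open>Convexity divides the exponent of the supermartingale part by \<open>s2\<close>,
    so \<beta> = s2 \<rho> \<alpha>. By \<open>c2\<close>, \<rho> is at most 1/2 and the maximal
    inequality yields the bound 2.\<close>
  define \<rho> where "\<rho> = \<beta> / (s2 * \<alpha>)"
  have \<rho>: "0 < \<rho>" "\<rho> \<le> 1/2" using \<beta> s \<alpha>_pos c2 by (simp_all add: \<rho>_def field_simps)
  have \<rho>\<alpha>: "s2 * (\<rho> * \<alpha>) = \<beta>" using s \<alpha>_pos by (simp add: \<rho>_def)
  define mY where "mY J w = Max ((\<lambda>n. Y J n w) ` {0..N})" for J w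
  define R where "R J w = \<beta> * ((1 + h * \<kappa> * lam 0) * nrm 0 w + mY J w + Q J N w)" for J w
  have toP: "f \<in> borel_measurable P" if "f \<in> borel_measurable (F (\<tau> n))" for f :: "'w \<Rightarrow> real" and n
    by (rule measurable_from_subalg[OF subalgebra_F[OF \<tau>_nonneg] that])
  have [measurable]: "mY J \<in> borel_measurable P" for J
    unfolding mY_def by (intro borel_measurable_Max) (auto intro: toP[OF Y_measurable])
  have [measurable]: "Q J N \<in> borel_measurable P" for J by (rule toP[OF Q_measurable])
  have [measurable]: "nrm 0 \<in> borel_measurable P" by (rule toP[OF nrm_measurable_\<tau>[of 0 0]]) simp_all
  have [measurable]: "R J \<in> borel_measurable P" for J unfolding R_def by measurable
  have C0: "0 \<le> expectation (\<lambda>w. exp (\<gamma> * (L2_norm L (\<theta>0 w))\<^sup>2))" by (rule integral_nonneg_AE) simp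
  have ER: "(\<integral>\<^sup>+w. ennreal (exp (R J w)) \<partial>P) \<le> ennreal C" for J
  proof -
    have pt: "exp (R J w) \<le> exp (\<gamma> * nrm 0 w) + (exp (\<rho> * \<alpha> * mY J w) + exp (\<beta> / s3 * Q J N w))" for w
    proof -
      have "\<beta> * (1 + h * \<kappa> * lam 0) * nrm 0 w \<le> s1 * \<gamma> * nrm 0 w" by (intro mult_right_mono c1) simp
      then have "R J w \<le> s1 * (\<gamma> * nrm 0 w) + s2 * (\<rho> * \<alpha>) * mY J w + s3 * (\<beta> / s3 * Q J N w)"
        unfolding R_def \<rho>\<alpha> using s by (simp add: algebra_simps)
      then have "exp (R J w) \<le> exp (s1 * (\<gamma> * nrm 0 w) + s2 * (\<rho> * \<alpha> * mY J w) + s3 * (\<beta> / s3 * Q J N w))"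
        by (simp add: mult.assoc)
      also have "\<dots> \<le> s1 * exp (\<gamma> * nrm 0 w) + s2 * exp (\<rho> * \<alpha> * mY J w) + s3 * exp (\<beta> / s3 * Q J N w)"
        using s by (intro exp_convex_combination3) auto
      also have "\<dots> \<le> 1 * exp (\<gamma> * nrm 0 w) + 1 * exp (\<rho> * \<alpha> * mY J w) + 1 * exp (\<beta> / s3 * Q J N w)"
        using s by (intro add_mono mult_right_mono) auto
      finally show ?thesis by simp
    qed
    have "(\<integral>\<^sup>+w. ennreal (exp (R J w)) \<partial>P)
        \<le> (\<integral>\<^sup>+w. ennreal (exp (\<gamma> * nrm 0 w)) + (ennreal (exp (\<rho> * \<alpha> * mY J w)) + ennreal (exp (\<beta> / s3 * Q J N w))) \<partial>P)"
      using pt by (intro nn_integral_mono) (simp add: ennreal_plus[symmetric] ennreal_leI del: ennreal_plus)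
    also have "\<dots> = (\<integral>\<^sup>+w. ennreal (exp (\<gamma> * nrm 0 w)) \<partial>P) + ((\<integral>\<^sup>+w. ennreal (exp (\<rho> * \<alpha> * mY J w)) \<partial>P)
        + (\<integral>\<^sup>+w. ennreal (exp (\<beta> / s3 * Q J N w)) \<partial>P))"
      by (simp add: nn_integral_add)
    also have "\<dots> \<le> ennreal (expectation (\<lambda>w. exp (\<gamma> * (L2_norm L (\<theta>0 w))\<^sup>2)))
        + (ennreal 2 + ennreal (exp (2 * (\<beta> / s3) * Tr * T)))"
    proof (intro add_mono)
      show "(\<integral>\<^sup>+w. ennreal (exp (\<gamma> * nrm 0 w)) \<partial>P) \<le> ennreal (expectation (\<lambda>w. exp (\<gamma> * (L2_norm L (\<theta>0 w))\<^sup>2)))"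
        unfolding init using int by (subst nn_integral_eq_integral) auto
      have "(\<integral>\<^sup>+w. ennreal (exp (\<rho> * \<alpha> * mY J w)) \<partial>P) \<le> ennreal (1 / (1 - \<rho>))"
        unfolding mY_def using \<rho> by (intro exp_max_Y) auto
      also have "\<dots> \<le> ennreal 2" using \<rho> by (intro ennreal_leI) (simp add: field_simps)
      finally show "(\<integral>\<^sup>+w. ennreal (exp (\<rho> * \<alpha> * mY J w)) \<partial>P) \<le> ennreal 2" .
      have "(\<integral>\<^sup>+w. ennreal (exp (\<beta> / s3 * Q J N w)) \<partial>P) \<le> ennreal (exp (real N * (2 * (\<beta> / s3) * Tr * h)))"
        using \<beta> s c3 by (intro exp_Q) auto
      also have "real N * (2 * (\<beta> / s3) * Tr * h) = 2 * (\<beta> / s3) * Tr * T"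
        using N_pos by (simp add: h_def)
      finally show "(\<integral>\<^sup>+w. ennreal (exp (\<beta> / s3 * Q J N w)) \<partial>P) \<le> ennreal (exp (2 * (\<beta> / s3) * Tr * T))" .
    qed
    also have "\<dots> = ennreal C"
      using C0 by (simp add: C_def add.assoc add_nonneg_nonneg)
    finally show ?thesis .
  qed
  obtain r :: "nat \<Rightarrow> nat" where r: "AE w in P. \<forall>t\<in>\<tau> ` {0..N}. (\<lambda>n. err (r n) t w) \<longlonglongrightarrow> 0"
    using err_AE_subseq[of "\<tau> ` {0..N}"] \<tau>_nonneg by auto
  have ae: "AE w in P. ennreal (exp (\<beta> * energy_max w)) \<le> liminf (\<lambda>k. ennreal (exp (R (r k) w)))"
    using AE_space r energy_sum_AE
  proof eventually_elim
    case (elim w)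
    have e: "(\<lambda>n. err (r n) (\<tau> l) w) \<longlonglongrightarrow> 0" if "l \<le> N" for l using elim(2) that by auto
    \<comment> \<open>The maximising index depends on the outcome but not on the truncation; it is
      fixed before the limit is taken, and only afterwards is \<open>Y\<close> at this index
      estimated by its maximum.\<close>
    obtain n where n: "n \<le> N" and max: "energy_max w = nrm n w + h * \<kappa> * (\<Sum>l=1..n. diss l w)"
    proof -
      let ?X = "\<lambda>n. nrm n w + h * \<kappa> * (\<Sum>l=1..n. diss l w)"
      have "Max (?X ` {0..N}) \<in> ?X ` {0..N}" by (rule Max_in) auto
      then obtain n where "n \<in> {0..N}" "Max (?X ` {0..N}) = ?X n" by (elim imageE) simp
      then show thesis by (intro that[of n]) (simp_all add: max_energy_def h_def)
    qed
    define B where "B k = \<beta> * ((1 + h * \<kappa> * lam 0) * nrm 0 w + Y (r k) n w + Q (r k) N w)" for k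
    define B' where "B' = \<beta> * ((1 + h * \<kappa> * lam 0) * nrm 0 w
       + (\<Sum>l<n. 2 * L2_inner L (dW l w) (\<theta> l w) - h * \<kappa> * lam 0 * nrm l w)
       + (\<Sum>l<N. (L2_norm L (dW l w))\<^sup>2))"
    have "B \<longlonglongrightarrow> B'"
      unfolding B_def B'_def Y_def Q_def
    proof (intro tendsto_intros)
      fix l assume "l \<in> {..<n}"
      then have l: "l < N" using n by simp
      show "(\<lambda>k. \<Sum>j<r k. sqrt (q j) * coef (\<theta> l w) j * db l j w) \<longlonglongrightarrow> L2_inner L (dW l w) (\<theta> l w)"
        using l by (intro increment_limit(1) \<tau>_nonneg elim(1) \<theta>_L2 e) auto
    next
      fix l assume "l \<in> {..<N}"
      then have l: "l < N" by simp
      show "(\<lambda>k. \<Sum>j<r k. q j * (db l j w)\<^sup>2) \<longlonglongrightarrow> (L2_norm L (dW l w))\<^sup>2"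
        using l by (intro increment_limit(2)[OF _ _ _ zeta_L2] \<tau>_nonneg elim(1) e) auto
    qed
    then have "(\<lambda>k. ennreal (exp (B k))) \<longlonglongrightarrow> ennreal (exp B')" by (intro tendsto_ennrealI tendsto_exp)
    then have lim: "ennreal (exp B') = liminf (\<lambda>k. ennreal (exp (B k)))"
      by (rule lim_imp_Liminf[OF trivial_limit_sequentially, symmetric])
    have "ennreal (exp (\<beta> * energy_max w)) \<le> ennreal (exp B')"
      unfolding max B'_def using elim(3) n \<beta> by (auto intro!: ennreal_leI mult_left_mono)
    also have "\<dots> \<le> liminf (\<lambda>k. ennreal (exp (R (r k) w)))"
      unfolding lim
    proof (intro Liminf_mono always_eventually allI ennreal_leI)
      fix k
      have "Y (r k) n w \<le> mY (r k) w" unfolding mY_def using n by (intro Max_ge) auto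
      then show "exp (B k) \<le> exp (R (r k) w)" unfolding B_def R_def using \<beta> by simp
    qed
    finally show ?case .
  qed
  have "(\<integral>\<^sup>+w. ennreal (exp (\<beta> * energy_max w)) \<partial>P)
      \<le> (\<integral>\<^sup>+w. liminf (\<lambda>k. ennreal (exp (R (r k) w))) \<partial>P)"
    by (rule nn_integral_mono_AE[OF ae])
  also have "\<dots> \<le> liminf (\<lambda>k. \<integral>\<^sup>+w. ennreal (exp (R (r k) w)) \<partial>P)"
    by (rule nn_integral_liminf) measurable
  also have "\<dots> \<le> liminf (\<lambda>k. ennreal C)" by (intro Liminf_mono always_eventually allI ER)
  also have "\<dots> = ennreal C" by (simp add: Liminf_const)
  finally have bound: "(\<integral>\<^sup>+w. ennreal (exp (\<beta> * energy_max w)) \<partial>P) \<le> ennreal C" .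
  note [measurable] = max_energy_measurable
  show i: "integrable P (\<lambda>w. exp (\<beta> * energy_max w))"
    using bound by (intro integrableI_nonneg) (auto intro: le_less_trans)
  have "0 \<le> C" using C0 by (simp add: C_def add_nonneg_nonneg)
  then show "expectation (\<lambda>w. exp (\<beta> * energy_max w)) \<le> C"
    using bound by (subst (asm) nn_integral_eq_integral[OF i]) (auto simp: ennreal_le_iff)
qed

lemma (in temp_noise) eventually_exp_max_energy_le:
  assumes T: "0 < T" and \<kappa>: "0 < \<kappa>" and u0: "\<And>w. w \<in> space P \<Longrightarrow> u0 w \<in> Vsp L 0"
    and \<theta>0: "\<theta>0 \<in> measurable (F 0) (L2_borel L)" and \<gamma>: "0 < \<gamma>"
    and int: "integrable P (\<lambda>w. exp (\<gamma> * (L2_norm L (\<theta>0 w))\<^sup>2))"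
    and \<beta>: "0 < \<beta>" "\<beta> < \<kappa> * lam 0 * \<gamma> / (4 * Tr * \<gamma> + \<kappa> * lam 0)"
  shows "\<exists>C. \<forall>\<^sub>F N in sequentially. \<forall>u \<theta>. euler_scheme P F L T \<nu> \<kappa> lam \<zeta> V W u0 \<theta>0 N u \<theta> \<longrightarrow>
     integrable P (\<lambda>w. exp (\<beta> * max_energy L T \<kappa> lam \<zeta> N \<theta> w)) \<and>
     expectation (\<lambda>w. exp (\<beta> * max_energy L T \<kappa> lam \<zeta> N \<theta> w)) \<le> C"
    (is "\<exists>C. ?bound C")
proof -
  define k where "k = \<kappa> * lam 0"
  have k: "0 < k" using \<kappa> lam_pos by (simp add: k_def)
  note Tr = Tr_pos
  \<comment> \<open>A third of the slack in \<beta>/\<gamma> + 2\<beta>/\<alpha> < 1. The first two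
    weights exceed their critical values by \<delta>, and \<delta> itself is the weight of the
    quadratic part.\<close>
  define \<delta> where "\<delta> = (1 - \<beta> / \<gamma> - 4 * \<beta> * Tr / k) / 3"
  have "\<beta> * (4 * Tr * \<gamma> + k) < k * \<gamma>"
    using \<beta>(2) Tr \<gamma> k by (simp add: k_def[symmetric] pos_less_divide_eq add_pos_pos)
  then have "(\<beta> * (4 * Tr * \<gamma> + k)) / (k * \<gamma>) < 1" using k \<gamma> by simp
  moreover have "(\<beta> * (4 * Tr * \<gamma> + k)) / (k * \<gamma>) = \<beta> / \<gamma> + 4 * \<beta> * Tr / k"
    using k \<gamma> by (simp add: field_simps)
  ultimately have \<delta>: "0 < \<delta>" by (simp add: \<delta>_def)
  define s1 where "s1 = \<beta> / \<gamma> + \<delta>"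
  define s2 where "s2 = 4 * \<beta> * Tr / k + \<delta>"
  have "3 * \<delta> = 1 - \<beta> / \<gamma> - 4 * \<beta> * Tr / k" by (simp add: \<delta>_def)
  then have s3: "s1 + s2 + \<delta> = 1" unfolding s1_def s2_def by linarith
  have s: "0 < s1" "0 < s2" using \<beta>(1) \<gamma> \<delta> Tr k by (simp_all add: s1_def s2_def add_pos_pos)
  define C where "C = expectation (\<lambda>w. exp (\<gamma> * (L2_norm L (\<theta>0 w))\<^sup>2)) + 2 + exp (2 * (\<beta> / \<delta>) * Tr * T)"
  have l0: "(\<lambda>N. T / real N) \<longlonglongrightarrow> 0" by (rule lim_const_over_n)
  have l1: "(\<lambda>N. \<beta> * (1 + T / real N * \<kappa> * lam 0)) \<longlonglongrightarrow> \<beta> * (1 + 0 * \<kappa> * lam 0)"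
    by (intro tendsto_intros l0)
  have l2: "(\<lambda>N. 2 * (\<beta> / \<delta>) * Tr * (T / real N)) \<longlonglongrightarrow> 2 * (\<beta> / \<delta>) * Tr * 0"
    by (intro tendsto_intros l0)
  \<comment> \<open>The margin is \<delta> \<gamma>; it absorbs the factor 1 + h \<kappa>
    \<open>lam 0\<close> as soon as h is small.\<close>
  have "\<beta> * (1 + 0 * \<kappa> * lam 0) < s1 * \<gamma>" using \<gamma> \<delta> by (simp add: s1_def distrib_right)
  then have e1: "\<forall>\<^sub>F N in sequentially. \<beta> * (1 + T / real N * \<kappa> * lam 0) < s1 * \<gamma>"
    by (rule order_tendstoD(2)[OF l1])
  \<comment> \<open>However small \<delta> is, the exponent \<beta>/\<delta> becomes admissible for
    the quadratic part after refining the mesh.\<close>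
  have e2: "\<forall>\<^sub>F N in sequentially. 2 * (\<beta> / \<delta>) * Tr * (T / real N) < 1/2"
    by (rule order_tendstoD(2)[OF l2]) simp
  have "?bound C"
    using e1 e2 eventually_gt_at_top[of 0]
  proof eventually_elim
    case (elim N)
    show ?case
    proof (intro allI impI)
      fix u \<theta> assume "euler_scheme P F L T \<nu> \<kappa> lam \<zeta> V W u0 \<theta>0 N u \<theta>"
      then interpret temp_scheme L lam \<zeta> P F q b W T \<nu> \<kappa> V u0 \<theta>0 N u \<theta>
        using T \<kappa> elim(3) u0 \<theta>0 by unfold_locales auto
      \<comment> \<open>2\<beta>/\<alpha> = 4\<beta> Tr / k is the critical value of
        \<open>s2\<close>.\<close>
      have c2: "2 * \<beta> \<le> s2 * \<alpha>"
        using Tr k \<delta> \<beta>(1) unfolding s2_def \<alpha>_def k_def[symmetric] by (simp add: field_simps)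
      note le = exp_max_energy_le[OF \<beta>(1) s(1,2) \<delta> s3 int _ c2]
      show "integrable P (\<lambda>w. exp (\<beta> * max_energy L T \<kappa> lam \<zeta> N \<theta> w)) \<and>
        expectation (\<lambda>w. exp (\<beta> * max_energy L T \<kappa> lam \<zeta> N \<theta> w)) \<le> C"
        unfolding C_def using elim(1,2)
        by (intro conjI le) (auto simp only: h_def intro: less_imp_le)
    qed
  qed
  then show ?thesis by blast
qed

theorem corollary5p2:
  fixes P :: "'w measure" and F :: "real \<Rightarrow> 'w measure"
    and L T \<nu> \<kappa> :: real
    and lam lam' q q' :: "nat \<Rightarrow> real"
    and \<zeta> :: "nat \<Rightarrow> real^2 \<Rightarrow> real^2" and \<zeta>' :: "nat \<Rightarrow> real^2 \<Rightarrow> real"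
    and b b' :: "nat \<Rightarrow> real \<Rightarrow> 'w \<Rightarrow> real"
    and W :: "real \<Rightarrow> 'w \<Rightarrow> real^2 \<Rightarrow> real^2" and W' :: "real \<Rightarrow> 'w \<Rightarrow> real^2 \<Rightarrow> real"
  assumes "0 < L" and "0 < T" and "0 < \<nu>" and "0 < \<kappa>"
    and "filtered_space P F"
    and "stokes_eigensystem L lam \<zeta>" and "temp_eigensystem L lam' \<zeta>'"
    and "\<And>j. 0 < q j" and "\<And>j. 0 < q' j"
    and "summable (\<lambda>j. lam j * q j)" and "summable (\<lambda>j. lam' j * q' j)"
    and "\<And>j. brownian P F (b j)" and "\<And>j. brownian P F (b' j)"
    and "independent_processes P (case_sum b b')"
    and "wiener_series P L q b \<zeta> W" and "wiener_series P L q' b' \<zeta>' W'"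
  shows
    "(\<forall>u0\<in>Vsp L 0. \<forall>\<theta>0\<in>L2 L. \<forall>\<beta>.
        0 < \<beta> \<and> \<beta> < \<kappa> * lam' 0 / (4 * (\<Sum>j. q' j)) \<longrightarrow>
        (\<exists>C. \<forall>\<^sub>F N in sequentially. \<forall>u \<theta>.
           euler_scheme P F L T \<nu> \<kappa> lam' \<zeta>' W W' (\<lambda>_. u0) (\<lambda>_. \<theta>0) N u \<theta> \<longrightarrow>
           integrable P (\<lambda>\<omega>. exp (\<beta> * max_energy L T \<kappa> lam' \<zeta>' N \<theta> \<omega>)) \<and>
           prob_space.expectation P (\<lambda>\<omega>. exp (\<beta> * max_energy L T \<kappa> lam' \<zeta>' N \<theta> \<omega>)) \<le> C))
     \<and>
     (\<forall>u0 \<theta>0 \<gamma>0 \<beta>.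
        u0 \<in> measurable (F 0) (L2_borel L) \<and> (\<forall>\<omega>\<in>space P. u0 \<omega> \<in> Vsp L 0) \<and>
        \<theta>0 \<in> measurable (F 0) (L2_borel L) \<and>
        0 < \<gamma>0 \<and> integrable P (\<lambda>\<omega>. exp (\<gamma>0 * (L2_norm L (\<theta>0 \<omega>))\<^sup>2)) \<and>
        0 < \<beta> \<and> \<beta> < \<kappa> * lam' 0 * \<gamma>0 / (4 * (\<Sum>j. q' j) * \<gamma>0 + \<kappa> * lam' 0) \<longrightarrow>
        (\<exists>C. \<forall>\<^sub>F N in sequentially. \<forall>u \<theta>.
           euler_scheme P F L T \<nu> \<kappa> lam' \<zeta>' W W' u0 \<theta>0 N u \<theta> \<longrightarrow>
           integrable P (\<lambda>\<omega>. exp (\<beta> * max_energy L T \<kappa> lam' \<zeta>' N \<theta> \<omega>)) \<and>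
           prob_space.expectation P (\<lambda>\<omega>. exp (\<beta> * max_energy L T \<kappa> lam' \<zeta>' N \<theta> \<omega>)) \<le> C))"
proof -
  let ?bound = "\<lambda>u0 \<theta>0 \<beta>. \<exists>C. \<forall>\<^sub>F N in sequentially. \<forall>u \<theta>.
      euler_scheme P F L T \<nu> \<kappa> lam' \<zeta>' W W' u0 \<theta>0 N u \<theta> \<longrightarrow>
      integrable P (\<lambda>\<omega>. exp (\<beta> * max_energy L T \<kappa> lam' \<zeta>' N \<theta> \<omega>)) \<and>
      prob_space.expectation P (\<lambda>\<omega>. exp (\<beta> * max_energy L T \<kappa> lam' \<zeta>' N \<theta> \<omega>)) \<le> C"
  have prob: "prob_space P" using assms(5) by (simp add: filtered_space_def)
  interpret N: temp_noise L lam' \<zeta>' P F q' b' W'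
    using assms(1,5,7,9,11,13,16) prob by (simp add: temp_noise_def temp_basis_def temp_noise_axioms_def)
  let ?k = "\<kappa> * lam' 0"
  have k: "0 < ?k" using assms(4) N.lam_pos by simp
  \<comment> \<open>As \<gamma>0 grows, the threshold for random data increases to k / (4 Tr), so a
    finite \<gamma>0 already lifts it above \<beta>.\<close>
  have ex: "\<exists>\<gamma>0>0. \<beta> < ?k * \<gamma>0 / (4 * N.Tr * \<gamma>0 + ?k)" if \<beta>: "0 < \<beta>" "\<beta> < ?k / (4 * N.Tr)" for \<beta>
  proof -
    have "4 * N.Tr * \<beta> < ?k" using \<beta>(2) N.Tr_pos by (simp add: field_simps)
    then have d: "0 < ?k - 4 * N.Tr * \<beta>" by simp
    \<comment> \<open>Cleared of denominators the requirement is \<beta> k < g (k - 4 Tr \<beta>);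
      the summand 1 makes it strict.\<close>
    define g where "g = (\<beta> * ?k + 1) / (?k - 4 * N.Tr * \<beta>)"
    have g: "0 < g" using d \<beta>(1) k by (simp add: g_def add_pos_pos)
    have "g * (?k - 4 * N.Tr * \<beta>) = \<beta> * ?k + 1" using d by (simp add: g_def)
    then have "\<beta> * (4 * N.Tr * g + ?k) < ?k * g" by (simp add: algebra_simps)
    then have "\<beta> < ?k * g / (4 * N.Tr * g + ?k)"
      using N.Tr_pos g k by (subst pos_less_divide_eq) (auto intro!: add_pos_pos)
    with g show ?thesis by blast
  qed
  have part1: "?bound (\<lambda>_. u0) (\<lambda>_. \<theta>0) \<beta>"
    if u\<theta>: "u0 \<in> Vsp L 0" "\<theta>0 \<in> L2 L" and \<beta>: "0 < \<beta>" "\<beta> < ?k / (4 * N.Tr)" for u0 \<theta>0 \<beta>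
  proof -
    obtain \<gamma>0 where "0 < \<gamma>0" "\<beta> < ?k * \<gamma>0 / (4 * N.Tr * \<gamma>0 + ?k)"
      using ex[OF \<beta>] by blast
    then show ?thesis
      using u\<theta> \<beta> assms(2,4) by (intro N.eventually_exp_max_energy_le[where \<gamma>=\<gamma>0]) (auto simp: space_L2_borel)
  qed
  show ?thesis
  proof (intro conjI ballI allI impI; (elim conjE)?)
    fix u0 :: "real^2 \<Rightarrow> real^2" and \<theta>0 :: "real^2 \<Rightarrow> real" and \<beta> :: real
    assume "u0 \<in> Vsp L 0" "\<theta>0 \<in> L2 L" "0 < \<beta>" "\<beta> < \<kappa> * lam' 0 / (4 * N.Tr)"
    then show "?bound (\<lambda>_. u0) (\<lambda>_. \<theta>0) \<beta>"
      by (rule part1)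
  next
    fix u0 :: "'w \<Rightarrow> real^2 \<Rightarrow> real^2" and \<theta>0 :: "'w \<Rightarrow> real^2 \<Rightarrow> real" and \<gamma>0 \<beta> :: real
    assume "u0 \<in> measurable (F 0) (L2_borel L)" "\<forall>\<omega>\<in>space P. u0 \<omega> \<in> Vsp L 0"
      "\<theta>0 \<in> measurable (F 0) (L2_borel L)" "0 < \<gamma>0"
      "integrable P (\<lambda>\<omega>. exp (\<gamma>0 * (L2_norm L (\<theta>0 \<omega>))\<^sup>2))"
      "0 < \<beta>" "\<beta> < \<kappa> * lam' 0 * \<gamma>0 / (4 * N.Tr * \<gamma>0 + \<kappa> * lam' 0)"
    then show "?bound u0 \<theta>0 \<beta>"
      using assms(2,4) by (intro N.eventually_exp_max_energy_le[where \<gamma>=\<gamma>0]) auto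
  qed
qed

end
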